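(* Let $\tau\in P^+$ and fix a reduced expression $\vec t_\tau=s_1\cdots s_n a$ of $t_\tau$ ($s_i\in S$, $a\in\Pi$). Let $\lambda\in P^+$, $v\in W_0$ and let $J\subset\{1,\ldots,n\}$. (1) If $J$ is admissible, $\lambda$-dominant and maximal, then $J\in\mathfrak{I}^{\max}_{\lambda,v_J,\tau}$. (2) If $J\in\mathfrak{I}^{\max}_{\lambda,v,\tau}$, then $v=v_J$ and $J$ is admissible, $\lambda$-dominant and maximal.
   Context: Geometry. $V$ is a Euclidean space with scalar product $(\cdot,\cdot)$, $\Phi\subset V$ an irreducible root system with positive roots $\Phi^+$, $\Phi^-=-\Phi^+$ and simple roots $\Delta=\{\alpha_1,\ldots,\alpha_N\}$; $\langle x,\alpha^\vee\rangle=2(x,\alpha)/(\alpha,\alpha)$. For $\alpha\in\Phi$, $n\in\mathbf Z$ put $H_{\alpha,n}=\{x\in V\mid\langle x,\alpha^\vee\rangle=n\}$; $\mathcal F$ is the set of these hyperplanes. Each $H\in\mathcal F$ is $H_{\alpha,n}$ for a unique $(\alpha,n)\in\Phi^+\times\mathbf Z$; its direction is $\overline H=\alpha$. $W_a$ is the group generated by the orthogonal reflections $s_{\alpha,n}$ in the $H_{\alpha,n}$; $W_0$ is the stabiliser of $0$ (the finite Weyl group, with $s_\alpha=s_{\alpha,0}$) and $w_0$ its longest element. $W_a$ is a Coxeter group with generators $S=\{s_{\alpha_i,0}\mid 1\le i\le N\}\cup\{s_{\tilde\alpha,1}\}$, where $\tilde\alpha^\vee$ is the highest root of $\Phi^\vee$.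 Alcoves are the connected components of $V\setminus\bigcup_{H\in\mathcal F}H$; $A_0=\{x\in V\mid 0<\langle x,\alpha^\vee\rangle<1\ \forall\alpha\in\Phi^+\}$. A face (codimension 1 facet) of $A_0$ has type $s\in S$ if it lies in the fixed hyperplane of $s$; types are extended to all alcoves by the action of $W_a$. Weights. $L:W_a\to\mathbf N$ is a fixed positive weight function: $L(ww')=L(w)+L(w')$ whenever $\ell(ww')=\ell(w)+\ell(w')$, and $L(s)>0$ for $s\in S$. A hyperplane $H$ has weight $L(H)=L(s)$ if it contains a face of type $s$ (well defined). For $\alpha\in\Phi^+$, $L(\alpha)=\max_{\overline H=\alpha}L(H)$. For $x\in V$, $L(x)=\sum_{H\in\mathcal F,\,x\in H}L(H)$; $P$ is the set of $x\in V$ where $L(x)$ is maximal ($L$-weights); $P^+=\{\lambda\in P\mid\langle\lambda,\alpha^\vee\rangle\ge0\ \forall\alpha\in\Phi^+\}$. It is assumed throughout that $0\in P$. Extended group. $W_e=W_0\ltimes P$, with $t_\lambda$ the translation by $\lambda\in P$. $\Pi$ is the stabiliser of $A_0$ in $W_e$, and $W_e=\Pi\ltimes W_a$. For $w\in W_e$, $A_w=wA_0$. Length, $L$ and Bruhat order extend to $W_e$: $\ell(aw)=\ell(w)$, $L(aw)=L(w)$, and $aw<a'w'$ iff $a=a'$ and $w<w'$ ($a,a'\in\Pi$, $w,w'\in W_a$). The fundamental chamber is $\mathcal C_{\mathrm{id}}=\{x\in V\mid\langle x,\alpha^\vee\rangle>0\ \forall\alpha\in\Phi^+\}$. Subwords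 and admissible subsets. For the reduced expression $\vec t_\tau=s_1\cdots s_na$, $J\subset\{1,\ldots,n\}$ and $0\le k<n$, let $\vec t_\tau^{\,J}[1,k]$ be the product of the $s_r$, $1\le r\le k$, $r\notin J$, in increasing order (so $\vec t^{\,J}_\tau[1,0]=\mathrm{id}$), and let $\vec t_\tau^{\,J}[1,n]=\vec t_\tau^{\,J}=\big(\prod_{r=1,r\notin J}^ns_r\big)a$. For $x\in W_e$, $p_J(x;\vec t_\tau)$ is the sequence of alcoves $\big(A_{x\vec t_\tau^{\,J}[1,k]}\big)_{1\le k\le n}$; it is said to be contained in a subset of $V$ if all its alcoves are. Let $(\beta_k,N_k)\in\Phi^+\times\mathbf N$ be such that $H_{\beta_k,N_k}$ is the unique hyperplane separating $A_{s_1\cdots s_{k-1}}$ and $A_{s_1\cdots s_k}$. For $J=\{i_1<\cdots<i_p\}$ put $v_J=s_{\beta_{i_p}}s_{\beta_{i_{p-1}}}\cdots s_{\beta_{i_1}}\in W_0$. - $J$ is admissible if $\mathrm{id}<s_{\beta_{i_p}}<s_{\beta_{i_p}}s_{\beta_{i_{p-1}}}<\cdots<s_{\beta_{i_p}}\cdots s_{\beta_{i_1}}$ is a saturated chain in the Bruhat order of $W_0$ (equivalently $\ell(s_{\beta_{i_p}}\cdots s_{\beta_{i_k}})=p-k+1$ for all $1\le k\le p$). - An admissible $J$ is $\lambda$-dominant ($\lambda\in P^+$) if $p_J(t_\lambda v_J;\vec t_\tau)\subset\mathcal C_{\mathrm{id}}$. - An admissible $J$ is maximal if $L(s_{i_\ell})=L(\beta_{i_\ell})$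 for all $1\le\ell\le p$. The sets $\mathfrak I$. $\mathfrak{I}_{\lambda,v,\tau}$ is the set of all subsets $J=\{i_1<\cdots<i_p\}$ of $\{1,\ldots,n\}$ such that, with $x=w_0t_\lambda v$, one has $x\vec t_\tau^{\,J}[1,i_\ell-1]s_{i_\ell}<x\vec t_\tau^{\,J}[1,i_\ell-1]$ for all $\ell\in\{1,\ldots,p\}$. With $\mathsf q$ an indeterminate and $\xi_s=\mathsf q^{L(s)}-\mathsf q^{-L(s)}$, put $\xi_J=\prod_{k=1}^p\xi_{s_{i_k}}$, whose degree (highest power of $\mathsf q$) is $\deg(\xi_J)=\sum_{k=1}^pL(s_{i_k})$. Finally $\mathfrak{I}^{\max}_{\lambda,v,\tau}=\{J\in\mathfrak{I}_{\lambda,v,\tau}\mid\deg(\xi_J)=L(v)\}$. *)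

theory Defs
  imports "HOL-Analysis.Analysis" "HOL-Library.Poly_Mapping"
begin

section \<open>Root systems\<close>

definition pairing :: "'a::euclidean_space \<Rightarrow> 'a \<Rightarrow> real" where
  "pairing x \<alpha> = 2 * (x \<bullet> \<alpha>) / (\<alpha> \<bullet> \<alpha>)"

definition coroot :: "'a::euclidean_space \<Rightarrow> 'a" where
  "coroot \<alpha> = (2 / (\<alpha> \<bullet> \<alpha>)) *\<^sub>R \<alpha>"

definition hyp :: "'a::euclidean_space \<Rightarrow> int \<Rightarrow> 'a set" where
  "hyp \<alpha> n = {x. pairing x \<alpha> = of_int n}"

text \<open>The orthogonal reflection in \<open>hyp \<alpha> n\<close>; in particular it moves \<open>0\<close> to \<open>n \<alpha>\<close>, so the
  translations of the affine Weyl group form the root lattice (not the coroot lattice).\<close>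

definition refl_aff :: "'a::euclidean_space \<Rightarrow> int \<Rightarrow> 'a \<Rightarrow> 'a" where
  "refl_aff \<alpha> n x = x - (pairing x \<alpha> - of_int n) *\<^sub>R \<alpha>"

text \<open>Root systems are reduced: otherwise a hyperplane would not determine its direction.\<close>

definition root_system :: "'a::euclidean_space set \<Rightarrow> bool" where
  "root_system \<Phi> \<longleftrightarrow>
     finite \<Phi> \<and> 0 \<notin> \<Phi> \<and> span \<Phi> = UNIV \<and>
     (\<forall>\<alpha>\<in>\<Phi>. \<forall>\<beta>\<in>\<Phi>. refl_aff \<alpha> 0 \<beta> \<in> \<Phi>) \<and>
     (\<forall>\<alpha>\<in>\<Phi>. \<forall>\<beta>\<in>\<Phi>. pairing \<beta> \<alpha> \<in> \<int>) \<and>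
     (\<forall>\<alpha>\<in>\<Phi>. \<forall>c. c *\<^sub>R \<alpha> \<in> \<Phi> \<longrightarrow> c = 1 \<or> c = -1)"

definition irreducible_root_system :: "'a::euclidean_space set \<Rightarrow> bool" where
  "irreducible_root_system \<Phi> \<longleftrightarrow>
     root_system \<Phi> \<and> \<Phi> \<noteq> {} \<and>
     \<not> (\<exists>\<Phi>1 \<Phi>2. \<Phi>1 \<noteq> {} \<and> \<Phi>2 \<noteq> {} \<and> \<Phi> = \<Phi>1 \<union> \<Phi>2 \<and> \<Phi>1 \<inter> \<Phi>2 = {} \<and>
          (\<forall>\<alpha>\<in>\<Phi>1. \<forall>\<beta>\<in>\<Phi>2. \<alpha> \<bullet> \<beta> = 0))"

definition nat_combs :: "'a::euclidean_space set \<Rightarrow> 'a set" where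
  "nat_combs B = {x. \<exists>c :: 'a \<Rightarrow> nat. x = (\<Sum>b\<in>B. of_nat (c b) *\<^sub>R b)}"

definition simple_roots :: "'a::euclidean_space set \<Rightarrow> 'a set \<Rightarrow> bool" where
  "simple_roots \<Phi> \<Delta> \<longleftrightarrow>
     \<Delta> \<subseteq> \<Phi> \<and> independent \<Delta> \<and> (\<forall>\<beta>\<in>\<Phi>. \<beta> \<in> nat_combs \<Delta> \<or> - \<beta> \<in> nat_combs \<Delta>)"

definition pos_roots :: "'a::euclidean_space set \<Rightarrow> 'a set \<Rightarrow> 'a set" where
  "pos_roots \<Phi> \<Delta> = \<Phi> \<inter> nat_combs \<Delta>"

definition highest_root :: "'a::euclidean_space set \<Rightarrow> 'a set \<Rightarrow> 'a" where
  "highest_root R B = (THE \<theta>. \<theta> \<in> R \<and> (\<forall>\<beta>\<in>R. \<theta> - \<beta> \<in> nat_combs B))"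

definition alpha_tilde :: "'a::euclidean_space set \<Rightarrow> 'a set \<Rightarrow> 'a" where
  "alpha_tilde \<Phi> \<Delta> =
     (THE \<alpha>. \<alpha> \<in> \<Phi> \<and> coroot \<alpha> = highest_root (coroot ` \<Phi>) (coroot ` \<Delta>))"

section \<open>Groups of transformations with generators\<close>

inductive_set gen_group :: "('a \<Rightarrow> 'a) set \<Rightarrow> ('a \<Rightarrow> 'a) set" for X :: "('a \<Rightarrow> 'a) set" where
  one: "id \<in> gen_group X"
| gen: "x \<in> X \<Longrightarrow> w \<in> gen_group X \<Longrightarrow> x \<circ> w \<in> gen_group X"
| inv: "x \<in> X \<Longrightarrow> w \<in> gen_group X \<Longrightarrow> inv x \<circ> w \<in> gen_group X"

definition wprod :: "('a \<Rightarrow> 'a) list \<Rightarrow> 'a \<Rightarrow> 'a" where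
  "wprod ws = foldr (\<circ>) ws id"

definition word_length :: "('a \<Rightarrow> 'a) set \<Rightarrow> ('a \<Rightarrow> 'a) \<Rightarrow> nat" where
  "word_length S w = (LEAST n. \<exists>ws. set ws \<subseteq> S \<and> length ws = n \<and> w = wprod ws)"

text \<open>The strict Bruhat order of a Coxeter group \<open>W\<close> with generators \<open>S\<close>: the transitive closure
  of \<open>x < t x\<close> for \<open>t\<close> a conjugate of a generator and \<open>t x\<close> longer than \<open>x\<close>.\<close>

definition bruhat_less ::
    "('a \<Rightarrow> 'a) set \<Rightarrow> ('a \<Rightarrow> 'a) set \<Rightarrow> ('a \<Rightarrow> 'a) \<Rightarrow> ('a \<Rightarrow> 'a) \<Rightarrow> bool" where
  "bruhat_less W S u w \<longleftrightarrow>
     (u, w) \<in> {(x, t \<circ> x) | x t. x \<in> W \<and> (\<exists>y\<in>W. \<exists>s\<in>S. t = y \<circ> s \<circ> inv y) \<and>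
                 word_length S x < word_length S (t \<circ> x)}\<^sup>+"

definition bruhat_covered ::
    "('a \<Rightarrow> 'a) set \<Rightarrow> ('a \<Rightarrow> 'a) set \<Rightarrow> ('a \<Rightarrow> 'a) \<Rightarrow> ('a \<Rightarrow> 'a) \<Rightarrow> bool" where
  "bruhat_covered W S u w \<longleftrightarrow>
     bruhat_less W S u w \<and> \<not> (\<exists>z\<in>W. bruhat_less W S u z \<and> bruhat_less W S z w)"

section \<open>The affine Weyl group and its alcoves\<close>

definition hyperplanes :: "'a::euclidean_space set \<Rightarrow> 'a set set" where
  "hyperplanes \<Phi> = {hyp \<alpha> n | \<alpha> n. \<alpha> \<in> \<Phi>}"

definition direction :: "'a::euclidean_space set \<Rightarrow> 'a set \<Rightarrow> 'a set \<Rightarrow> 'a" where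
  "direction \<Phi> \<Delta> H = (THE \<alpha>. \<alpha> \<in> pos_roots \<Phi> \<Delta> \<and> (\<exists>n. H = hyp \<alpha> n))"

definition Wa :: "'a::euclidean_space set \<Rightarrow> ('a \<Rightarrow> 'a) set" where
  "Wa \<Phi> = gen_group {refl_aff \<alpha> n | \<alpha> n. \<alpha> \<in> \<Phi>}"

definition W0 :: "'a::euclidean_space set \<Rightarrow> ('a \<Rightarrow> 'a) set" where
  "W0 \<Phi> = {w \<in> Wa \<Phi>. w 0 = 0}"

definition S0 :: "'a::euclidean_space set \<Rightarrow> ('a \<Rightarrow> 'a) set" where
  "S0 \<Delta> = {refl_aff \<alpha> 0 | \<alpha>. \<alpha> \<in> \<Delta>}"

definition Sa :: "'a::euclidean_space set \<Rightarrow> 'a set \<Rightarrow> ('a \<Rightarrow> 'a) set" where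
  "Sa \<Phi> \<Delta> = S0 \<Delta> \<union> {refl_aff (alpha_tilde \<Phi> \<Delta>) 1}"

definition longest :: "'a::euclidean_space set \<Rightarrow> 'a set \<Rightarrow> 'a \<Rightarrow> 'a" where
  "longest \<Phi> \<Delta> =
     (THE w. w \<in> W0 \<Phi> \<and> (\<forall>u\<in>W0 \<Phi>. word_length (S0 \<Delta>) u \<le> word_length (S0 \<Delta>) w))"

definition A0 :: "'a::euclidean_space set \<Rightarrow> 'a set \<Rightarrow> 'a set" where
  "A0 \<Phi> \<Delta> = {x. \<forall>\<alpha>\<in>pos_roots \<Phi> \<Delta>. 0 < pairing x \<alpha> \<and> pairing x \<alpha> < 1}"

definition chamber :: "'a::euclidean_space set \<Rightarrow> 'a set \<Rightarrow> 'a set" where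
  "chamber \<Phi> \<Delta> = {x. \<forall>\<alpha>\<in>pos_roots \<Phi> \<Delta>. 0 < pairing x \<alpha>}"

definition facets :: "'a::euclidean_space set \<Rightarrow> 'a set set" where
  "facets \<Phi> = UNIV // {(x, y). \<forall>\<alpha>\<in>\<Phi>. \<forall>n::int.
                          sgn (pairing x \<alpha> - of_int n) = sgn (pairing y \<alpha> - of_int n)}"

definition faces :: "'a::euclidean_space set \<Rightarrow> 'a set \<Rightarrow> 'a set set" where
  "faces \<Phi> A = {F \<in> facets \<Phi>. aff_dim F = int DIM('a) - 1 \<and> F \<subseteq> closure A}"

definition has_type ::
    "'a::euclidean_space set \<Rightarrow> 'a set \<Rightarrow> 'a set \<Rightarrow> ('a \<Rightarrow> 'a) \<Rightarrow> bool" where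
  "has_type \<Phi> \<Delta> F s \<longleftrightarrow>
     (\<exists>w\<in>Wa \<Phi>. \<exists>G\<in>faces \<Phi> (A0 \<Phi> \<Delta>). G \<subseteq> {x. s x = x} \<and> F = w ` G)"

section \<open>Weight functions and weights\<close>

text \<open>Only the values of \<open>L\<close> on the affine Weyl group are constrained (and used).\<close>

definition pos_weight_function ::
    "'a::euclidean_space set \<Rightarrow> 'a set \<Rightarrow> (('a \<Rightarrow> 'a) \<Rightarrow> nat) \<Rightarrow> bool" where
  "pos_weight_function \<Phi> \<Delta> L \<longleftrightarrow>
     (\<forall>w\<in>Wa \<Phi>. \<forall>w'\<in>Wa \<Phi>.
        word_length (Sa \<Phi> \<Delta>) (w \<circ> w') = word_length (Sa \<Phi> \<Delta>) w + word_length (Sa \<Phi> \<Delta>) w'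
        \<longrightarrow> L (w \<circ> w') = L w + L w') \<and>
     (\<forall>s\<in>Sa \<Phi> \<Delta>. L s > 0)"

definition L_hyp ::
    "'a::euclidean_space set \<Rightarrow> 'a set \<Rightarrow> (('a \<Rightarrow> 'a) \<Rightarrow> nat) \<Rightarrow> 'a set \<Rightarrow> nat" where
  "L_hyp \<Phi> \<Delta> L H = (THE m. \<exists>s\<in>Sa \<Phi> \<Delta>. \<exists>F. has_type \<Phi> \<Delta> F s \<and> F \<subseteq> H \<and> m = L s)"

definition L_root ::
    "'a::euclidean_space set \<Rightarrow> 'a set \<Rightarrow> (('a \<Rightarrow> 'a) \<Rightarrow> nat) \<Rightarrow> 'a \<Rightarrow> nat" where
  "L_root \<Phi> \<Delta> L \<alpha> = Max {L_hyp \<Phi> \<Delta> L H | H. H \<in> hyperplanes \<Phi> \<and> direction \<Phi> \<Delta> H = \<alpha>}"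

definition L_point ::
    "'a::euclidean_space set \<Rightarrow> 'a set \<Rightarrow> (('a \<Rightarrow> 'a) \<Rightarrow> nat) \<Rightarrow> 'a \<Rightarrow> nat" where
  "L_point \<Phi> \<Delta> L x = (\<Sum>H\<in>{H \<in> hyperplanes \<Phi>. x \<in> H}. L_hyp \<Phi> \<Delta> L H)"

definition L_weights ::
    "'a::euclidean_space set \<Rightarrow> 'a set \<Rightarrow> (('a \<Rightarrow> 'a) \<Rightarrow> nat) \<Rightarrow> 'a set" where
  "L_weights \<Phi> \<Delta> L = {x. \<forall>y. L_point \<Phi> \<Delta> L y \<le> L_point \<Phi> \<Delta> L x}"

definition dominant_weights ::
    "'a::euclidean_space set \<Rightarrow> 'a set \<Rightarrow> (('a \<Rightarrow> 'a) \<Rightarrow> nat) \<Rightarrow> 'a set" where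
  "dominant_weights \<Phi> \<Delta> L = {x \<in> L_weights \<Phi> \<Delta> L. \<forall>\<alpha>\<in>pos_roots \<Phi> \<Delta>. 0 \<le> pairing x \<alpha>}"

section \<open>The extended affine Weyl group\<close>

definition transl :: "'a::euclidean_space \<Rightarrow> 'a \<Rightarrow> 'a" where
  "transl lam x = lam + x"

definition We ::
    "'a::euclidean_space set \<Rightarrow> 'a set \<Rightarrow> (('a \<Rightarrow> 'a) \<Rightarrow> nat) \<Rightarrow> ('a \<Rightarrow> 'a) set" where
  "We \<Phi> \<Delta> L = {transl lam \<circ> w | lam w. lam \<in> L_weights \<Phi> \<Delta> L \<and> w \<in> W0 \<Phi>}"

definition Pi_stab ::
    "'a::euclidean_space set \<Rightarrow> 'a set \<Rightarrow> (('a \<Rightarrow> 'a) \<Rightarrow> nat) \<Rightarrow> ('a \<Rightarrow> 'a) set" where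
  "Pi_stab \<Phi> \<Delta> L = {w \<in> We \<Phi> \<Delta> L. w ` A0 \<Phi> \<Delta> = A0 \<Phi> \<Delta>}"

definition length_e ::
    "'a::euclidean_space set \<Rightarrow> 'a set \<Rightarrow> (('a \<Rightarrow> 'a) \<Rightarrow> nat) \<Rightarrow> ('a \<Rightarrow> 'a) \<Rightarrow> nat" where
  "length_e \<Phi> \<Delta> L x =
     (THE m. \<exists>a\<in>Pi_stab \<Phi> \<Delta> L. \<exists>w\<in>Wa \<Phi>. x = a \<circ> w \<and> m = word_length (Sa \<Phi> \<Delta>) w)"

definition bruhat_less_e ::
    "'a::euclidean_space set \<Rightarrow> 'a set \<Rightarrow> (('a \<Rightarrow> 'a) \<Rightarrow> nat) \<Rightarrow>
     ('a \<Rightarrow> 'a) \<Rightarrow> ('a \<Rightarrow> 'a) \<Rightarrow> bool" where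
  "bruhat_less_e \<Phi> \<Delta> L x y \<longleftrightarrow>
     (\<exists>a\<in>Pi_stab \<Phi> \<Delta> L. \<exists>w\<in>Wa \<Phi>. \<exists>w'\<in>Wa \<Phi>.
        x = a \<circ> w \<and> y = a \<circ> w' \<and> bruhat_less (Wa \<Phi>) (Sa \<Phi> \<Delta>) w w')"

text \<open>An expression \<open>s\<^sub>1 \<dots> s\<^sub>n a\<close> is given by a sequence \<open>s\<close> (only its values at \<open>1, \<dots>, n\<close> matter),
  the number \<open>n\<close> and \<open>a\<close>.\<close>

definition reduced_expr ::
    "'a::euclidean_space set \<Rightarrow> 'a set \<Rightarrow> (('a \<Rightarrow> 'a) \<Rightarrow> nat) \<Rightarrow>
     ('a \<Rightarrow> 'a) \<Rightarrow> (nat \<Rightarrow> 'a \<Rightarrow> 'a) \<Rightarrow> nat \<Rightarrow> ('a \<Rightarrow> 'a) \<Rightarrow> bool" where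
  "reduced_expr \<Phi> \<Delta> L x s n a \<longleftrightarrow>
     (\<forall>r\<in>{1..n}. s r \<in> Sa \<Phi> \<Delta>) \<and> a \<in> Pi_stab \<Phi> \<Delta> L \<and>
     x = wprod (map s [1..<Suc n]) \<circ> a \<and> length_e \<Phi> \<Delta> L x = n"

section \<open>Subwords and admissible subsets\<close>

text \<open>\<open>subword s n a J k\<close> is the partial product up to \<open>k\<close> of the letters whose index is not
  in \<open>J\<close>; the factor \<open>a\<close> is included exactly when \<open>k = n\<close>.\<close>

definition subword ::
    "(nat \<Rightarrow> 'a \<Rightarrow> 'a) \<Rightarrow> nat \<Rightarrow> ('a \<Rightarrow> 'a) \<Rightarrow> nat set \<Rightarrow> nat \<Rightarrow> 'a \<Rightarrow> 'a" where
  "subword s n a J k =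
     (let w = wprod (map s (filter (\<lambda>r. r \<notin> J) [1..<Suc k])) in if k = n then w \<circ> a else w)"

definition path_in ::
    "'a::euclidean_space set \<Rightarrow> 'a set \<Rightarrow> (nat \<Rightarrow> 'a \<Rightarrow> 'a) \<Rightarrow> nat \<Rightarrow> ('a \<Rightarrow> 'a) \<Rightarrow>
     nat set \<Rightarrow> ('a \<Rightarrow> 'a) \<Rightarrow> 'a set \<Rightarrow> bool" where
  "path_in \<Phi> \<Delta> s n a J x U \<longleftrightarrow>
     (\<forall>k\<in>{1..n}. (x \<circ> subword s n a J k) ` A0 \<Phi> \<Delta> \<subseteq> U)"

definition separates :: "'a::euclidean_space \<Rightarrow> int \<Rightarrow> 'a set \<Rightarrow> 'a set \<Rightarrow> bool" where
  "separates \<alpha> n A B \<longleftrightarrow>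
     (\<forall>x\<in>A. pairing x \<alpha> < of_int n) \<and> (\<forall>x\<in>B. pairing x \<alpha> > of_int n) \<or>
     (\<forall>x\<in>A. pairing x \<alpha> > of_int n) \<and> (\<forall>x\<in>B. pairing x \<alpha> < of_int n)"

definition crossing ::
    "'a::euclidean_space set \<Rightarrow> 'a set \<Rightarrow> (nat \<Rightarrow> 'a \<Rightarrow> 'a) \<Rightarrow> nat \<Rightarrow> 'a \<times> nat" where
  "crossing \<Phi> \<Delta> s k =
     (THE p. fst p \<in> pos_roots \<Phi> \<Delta> \<and>
        separates (fst p) (int (snd p)) (wprod (map s [1..<k]) ` A0 \<Phi> \<Delta>)
          (wprod (map s [1..<Suc k]) ` A0 \<Phi> \<Delta>))"

definition beta ::
    "'a::euclidean_space set \<Rightarrow> 'a set \<Rightarrow> (nat \<Rightarrow> 'a \<Rightarrow> 'a) \<Rightarrow> nat \<Rightarrow> 'a" where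
  "beta \<Phi> \<Delta> s k = fst (crossing \<Phi> \<Delta> s k)"

text \<open>For \<open>J = {i\<^sub>1 < \<dots> < i\<^sub>p}\<close>, the product of the \<open>m\<close> linear reflections with the largest
  indices, in decreasing order of the indices.\<close>

definition v_chain ::
    "'a::euclidean_space set \<Rightarrow> 'a set \<Rightarrow> (nat \<Rightarrow> 'a \<Rightarrow> 'a) \<Rightarrow> nat set \<Rightarrow> nat \<Rightarrow> 'a \<Rightarrow> 'a" where
  "v_chain \<Phi> \<Delta> s J m =
     wprod (map (\<lambda>j. refl_aff (beta \<Phi> \<Delta> s j) 0) (take m (rev (sorted_list_of_set J))))"

definition v_of ::
    "'a::euclidean_space set \<Rightarrow> 'a set \<Rightarrow> (nat \<Rightarrow> 'a \<Rightarrow> 'a) \<Rightarrow> nat set \<Rightarrow> 'a \<Rightarrow> 'a" where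
  "v_of \<Phi> \<Delta> s J = v_chain \<Phi> \<Delta> s J (card J)"

definition admissible ::
    "'a::euclidean_space set \<Rightarrow> 'a set \<Rightarrow> (nat \<Rightarrow> 'a \<Rightarrow> 'a) \<Rightarrow> nat set \<Rightarrow> bool" where
  "admissible \<Phi> \<Delta> s J \<longleftrightarrow>
     (\<forall>m<card J. bruhat_covered (W0 \<Phi>) (S0 \<Delta>) (v_chain \<Phi> \<Delta> s J m) (v_chain \<Phi> \<Delta> s J (Suc m)))"

definition dominant_subset ::
    "'a::euclidean_space set \<Rightarrow> 'a set \<Rightarrow> (nat \<Rightarrow> 'a \<Rightarrow> 'a) \<Rightarrow> nat \<Rightarrow> ('a \<Rightarrow> 'a) \<Rightarrow>
     'a \<Rightarrow> nat set \<Rightarrow> bool" where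
  "dominant_subset \<Phi> \<Delta> s n a lam J \<longleftrightarrow>
     path_in \<Phi> \<Delta> s n a J (transl lam \<circ> v_of \<Phi> \<Delta> s J) (chamber \<Phi> \<Delta>)"

definition maximal_subset ::
    "'a::euclidean_space set \<Rightarrow> 'a set \<Rightarrow> (('a \<Rightarrow> 'a) \<Rightarrow> nat) \<Rightarrow> (nat \<Rightarrow> 'a \<Rightarrow> 'a) \<Rightarrow>
     nat set \<Rightarrow> bool" where
  "maximal_subset \<Phi> \<Delta> L s J \<longleftrightarrow> (\<forall>j\<in>J. L (s j) = L_root \<Phi> \<Delta> L (beta \<Phi> \<Delta> s j))"

section \<open>The sets of subsets attached to the multiplication by \<open>t\<^sub>\<tau>\<close>\<close>

definition I_set ::
    "'a::euclidean_space set \<Rightarrow> 'a set \<Rightarrow> (('a \<Rightarrow> 'a) \<Rightarrow> nat) \<Rightarrow> (nat \<Rightarrow> 'a \<Rightarrow> 'a) \<Rightarrow> nat \<Rightarrow>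
     ('a \<Rightarrow> 'a) \<Rightarrow> 'a \<Rightarrow> ('a \<Rightarrow> 'a) \<Rightarrow> nat set set" where
  "I_set \<Phi> \<Delta> L s n a lam v =
     {J. J \<subseteq> {1..n} \<and>
         (let x = longest \<Phi> \<Delta> \<circ> transl lam \<circ> v in
          \<forall>j\<in>J. bruhat_less_e \<Phi> \<Delta> L (x \<circ> subword s n a J (j - 1) \<circ> s j)
                                     (x \<circ> subword s n a J (j - 1)))}"

text \<open>Laurent polynomials in \<open>q\<close> are finitely supported functions on the exponents,
  \<open>single k c\<close> being \<open>c q^k\<close>, with the convolution product.\<close>

type_synonym laurent = "int \<Rightarrow>\<^sub>0 int"

definition xi :: "nat \<Rightarrow> laurent" where
  "xi l = Poly_Mapping.single (int l) 1 - Poly_Mapping.single (- int l) 1"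

definition laurent_degree :: "laurent \<Rightarrow> int" where
  "laurent_degree p = Max (Poly_Mapping.keys p)"

definition xi_set :: "(('a \<Rightarrow> 'a) \<Rightarrow> nat) \<Rightarrow> (nat \<Rightarrow> 'a \<Rightarrow> 'a) \<Rightarrow> nat set \<Rightarrow> laurent" where
  "xi_set L s J = (\<Prod>j\<in>J. xi (L (s j)))"

definition I_max ::
    "'a::euclidean_space set \<Rightarrow> 'a set \<Rightarrow> (('a \<Rightarrow> 'a) \<Rightarrow> nat) \<Rightarrow> (nat \<Rightarrow> 'a \<Rightarrow> 'a) \<Rightarrow> nat \<Rightarrow>
     ('a \<Rightarrow> 'a) \<Rightarrow> 'a \<Rightarrow> ('a \<Rightarrow> 'a) \<Rightarrow> nat set set" where
  "I_max \<Phi> \<Delta> L s n a lam v =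
     {J \<in> I_set \<Phi> \<Delta> L s n a lam v. laurent_degree (xi_set L s J) = int (L v)}"

end

theory Submission
  imports Defs
begin

text \<open>
  Up to multiplication by \<open>w\<^sub>0\<close>, a subset \<open>J\<close> in \<open>I\<^sub>\<lambda>\<^sub>,\<^sub>v\<^sub>,\<^sub>\<tau>\<close> folds the straight alcove path from
  \<open>t\<^sub>\<lambda> v A\<^sub>0\<close> along \<open>t\<^sub>\<tau>\<close>, each time at a hyperplane across which the path was about to move towards
  the opposite alcove \<open>- A\<^sub>0\<close>. Consider the hyperplanes separating the current alcove both from \<open>- A\<^sub>0\<close>
  and from the end of the remaining straight path, and let the potential be the sum of \<open>L(\<alpha>)\<close> over
  their directions. Crossing a hyperplane does not increase the potential. Folding in direction
  \<open>\<alpha>\<close> decreases it by at least \<open>L(\<alpha>)\<close>: \<open>s\<^sub>\<alpha>\<close> can be used to inject the new directions into the old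
  ones other than \<open>\<alpha>\<close>, by an argument in the plane spanned by two roots. The initial potential is at
  most \<open>L(v)\<close>, hence \<open>deg \<xi>\<^sub>J \<le> L(v)\<close>.

  In the case of equality every step is sharp. Inductively, the path stays in the dominant chamber
  and the potential is \<open>L(u)\<close>, where \<open>u\<close> is the linear part of the remaining path. Each fold replaces
  \<open>u\<close> by \<open>u s\<^sub>\<beta>\<close> and lowers its weight by exactly \<open>L(\<beta>)\<close>, so \<open>u s\<^sub>\<beta>\<close> is covered by \<open>u\<close>, and \<open>u\<close> ends at the
  identity. Conversely, along the saturated chain of an admissible maximal \<open>J\<close> the weights add up to
  \<open>L(v\<^sub>J)\<close>, and dominance forces every fold to be of the required kind.
\<close>

section \<open>Reflection cocycles\<close>

text \<open>Directions are counted, not hyperplanes: the number of parallel hyperplanes involved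
  depends on \<open>\<tau>\<close> and \<open>lam\<close>, while the directions present at the start
  are inversions of \<open>v\<close>, and the weights of all inversions sum to \<open>L v\<close>.
  That sum uses the hyperplanes through 0, whereas a fold at step \<open>j\<close> has weight
  \<open>L (s j)\<close>, the weight of some parallel of the hyperplane through 0 with direction
  \<open>\<beta> j\<close>. The assumption that 0 is an L-weight bridges the two: it makes the
  hyperplane through 0 the heaviest of its parallel class (\<open>Lh_le_zero\<close>), so
  \<open>L (s j)\<close> is at most the guaranteed drop of the potential. Length functions, strong
  exchange and covering relations of both Weyl groups come from one object, the set of reflections
  separating two regular points. These sets are transported by conjugation, so an alcove can be
  represented by one of its points, and the Bruhat condition that defines a fold becomes a sign
  condition on pairings.\<close>

definition conj_by :: "('a \<Rightarrow> 'a) \<Rightarrow> ('a \<Rightarrow> 'a) \<Rightarrow> 'a \<Rightarrow> 'a" where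
  "conj_by g t = g \<circ> t \<circ> inv g"

lemma conj_by_id [simp]: "conj_by id t = t"
  by (simp add: conj_by_def)

lemma conj_by_comp: "bij g \<Longrightarrow> bij h \<Longrightarrow> conj_by (g \<circ> h) t = conj_by g (conj_by h t)"
  by (simp add: conj_by_def o_inv_distrib o_assoc)

lemma conj_by_inv [simp]:
  assumes "bij g"
  shows "conj_by (inv g) (conj_by g t) = t" and "conj_by g (conj_by (inv g) t) = t"
proof -
  have "inv g \<circ> g = id" "g \<circ> inv g = id"
    using assms by (simp_all add: bij_is_inj bij_is_surj surj_iff[symmetric])
  then show "conj_by (inv g) (conj_by g t) = t" "conj_by g (conj_by (inv g) t) = t"
    using conj_by_comp[of "inv g" g t] conj_by_comp[of g "inv g" t] assms
    by (simp_all add: bij_imp_bij_inv)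
qed

lemma inj_conj_by: "bij g \<Longrightarrow> inj (conj_by g)"
  by (rule inj_on_inverseI[where g = "conj_by (inv g)"]) simp

lemma conj_by_comp_right: "bij g \<Longrightarrow> conj_by g t \<circ> g = g \<circ> t"
  by (simp add: conj_by_def fun_eq_iff bij_is_inj)

lemma wprod_Nil [simp]: "wprod [] = id"
  and wprod_Cons [simp]: "wprod (x # ws) = x \<circ> wprod ws"
  by (simp_all add: wprod_def)

lemma wprod_append [simp]: "wprod (us @ ws) = wprod us \<circ> wprod ws"
  by (induction us) (simp_all add: o_assoc)

lemma involution_bij: "s \<circ> s = id \<Longrightarrow> bij s"
  by (rule o_bij)

lemma involution_inv: "s \<circ> s = id \<Longrightarrow> inv s = s"
  by (rule inv_unique_comp)

lemma wprod_involutions: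
  assumes "\<And>s. s \<in> set ws \<Longrightarrow> s \<circ> s = id"
  shows "wprod ws \<circ> wprod (rev ws) = id" and "bij (wprod ws)" and "inv (wprod ws) = wprod (rev ws)"
proof -
  have cancel: "wprod us \<circ> wprod (rev us) = id" if "\<forall>s\<in>set us. s \<circ> s = id" for us :: "('a \<Rightarrow> 'a) list"
    using that
  proof (induction us)
    case (Cons s us)
    have "wprod (s # us) \<circ> wprod (rev (s # us)) = s \<circ> (wprod us \<circ> wprod (rev us)) \<circ> s"
      by (simp add: o_assoc)
    also have "wprod us \<circ> wprod (rev us) = id" by (rule Cons.IH) (use Cons.prems in auto)
    also have "s \<circ> id \<circ> s = s \<circ> s" by simp
    also have "s \<circ> s = id" by (rule bspec[OF Cons.prems]) simp
    finally show "wprod (s # us) \<circ> wprod (rev (s # us)) = id" .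
  qed simp
  have "wprod ws \<circ> wprod (rev ws) = id" "wprod (rev ws) \<circ> wprod ws = id"
    using cancel[of ws] cancel[of "rev ws"] assms by auto
  then show "wprod ws \<circ> wprod (rev ws) = id" "bij (wprod ws)" "inv (wprod ws) = wprod (rev ws)"
    by (auto intro: o_bij inv_unique_comp)
qed

text \<open>\<open>N\<close> plays the role of the set of reflections separating the fundamental alcove from its
  image; the cocycle identity alone yields the length function and strong exchange.\<close>

locale reflection_cocycle =
  fixes W S :: "('a \<Rightarrow> 'a) set" and N :: "('a \<Rightarrow> 'a) \<Rightarrow> ('a \<Rightarrow> 'a) set"
  assumes words: "W = {wprod ws | ws. set ws \<subseteq> S}"
    and involution: "s \<in> S \<Longrightarrow> s \<circ> s = id"
    and N_simple: "s \<in> S \<Longrightarrow> N s = {s}"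
    and N_comp: "x \<in> W \<Longrightarrow> y \<in> W \<Longrightarrow> N (x \<circ> y) = sym_diff (N x) (conj_by x ` N y)"
begin

abbreviation len :: "('a \<Rightarrow> 'a) \<Rightarrow> nat" where "len \<equiv> word_length S"

definition reflections :: "('a \<Rightarrow> 'a) set" where
  "reflections = {conj_by y s | y s. y \<in> W \<and> s \<in> S}"

lemma wprod_in_W: "set ws \<subseteq> S \<Longrightarrow> wprod ws \<in> W"
  using words by blast

lemma W_wordE:
  assumes "w \<in> W" obtains ws where "set ws \<subseteq> S" "w = wprod ws"
  using assms words by blast

lemma id_in_W: "id \<in> W"
  using wprod_in_W[of "[]"] by simp

lemma S_sub_W: "s \<in> S \<Longrightarrow> s \<in> W"
  using wprod_in_W[of "[s]"] by simp

lemma W_comp: "x \<in> W \<Longrightarrow> y \<in> W \<Longrightarrow> x \<circ> y \<in> W"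
  by (metis W_wordE wprod_in_W wprod_append set_append Un_least)

lemma wprod_bij: "set ws \<subseteq> S \<Longrightarrow> bij (wprod ws)"
  by (rule wprod_involutions(2)) (use involution in blast)

lemma W_bij: "w \<in> W \<Longrightarrow> bij w"
  using wprod_bij W_wordE by metis

lemma wprod_inv: "set ws \<subseteq> S \<Longrightarrow> inv (wprod ws) = wprod (rev ws)"
  by (rule wprod_involutions(3)) (use involution in blast)

lemma W_inv: "w \<in> W \<Longrightarrow> inv w \<in> W"
  by (metis W_wordE set_rev wprod_in_W wprod_inv)

lemma conj_in_W: "y \<in> W \<Longrightarrow> t \<in> W \<Longrightarrow> conj_by y t \<in> W"
  unfolding conj_by_def by (intro W_comp W_inv)

lemma N_id: "N id = {}"
  using N_comp[OF id_in_W id_in_W] by auto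

lemma N_snoc:
  assumes "w \<in> W" "s \<in> S"
  shows "N (w \<circ> s) = (if conj_by w s \<in> N w then N w - {conj_by w s} else insert (conj_by w s) (N w))"
  using N_comp[OF assms(1) S_sub_W[OF assms(2)]] N_simple[OF assms(2)] by auto

text \<open>Each letter toggles a single reflection, by \<open>N_snoc\<close>, so only reflections
  toggled at some position can occur. Toggles may cancel, hence an inclusion only.\<close>

lemma N_word:
  "set ws \<subseteq> S \<Longrightarrow> N (wprod ws) \<subseteq> (\<lambda>i. conj_by (wprod (take i ws)) (ws ! i)) ` {..<length ws}"
proof (induction ws rule: rev_induct)
  case Nil
  then show ?case by (simp add: N_id flip: id_def)
next
  case (snoc s ws)
  then have "N (wprod (ws @ [s])) \<subseteq> insert (conj_by (wprod ws) s) (N (wprod ws))"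
    using N_snoc[of "wprod ws" s] by (auto simp: wprod_in_W split: if_splits)
  moreover have "conj_by (wprod (take i (ws @ [s]))) ((ws @ [s]) ! i)
      = (if i < length ws then conj_by (wprod (take i ws)) (ws ! i) else conj_by (wprod ws) s)"
    if "i < length (ws @ [s])" for i
    using that by (auto simp: nth_append)
  then have "(\<lambda>i. conj_by (wprod (take i (ws @ [s]))) ((ws @ [s]) ! i)) ` {..<length (ws @ [s])}
     = insert (conj_by (wprod ws) s) ((\<lambda>i. conj_by (wprod (take i ws)) (ws ! i)) ` {..<length ws})"
    by (auto simp: image_iff)
  moreover have "N (wprod ws) \<subseteq> (\<lambda>i. conj_by (wprod (take i ws)) (ws ! i)) ` {..<length ws}"
    using snoc by simp
  ultimately show "N (wprod (ws @ [s]))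
      \<subseteq> (\<lambda>i. conj_by (wprod (take i (ws @ [s]))) ((ws @ [s]) ! i)) ` {..<length (ws @ [s])}"
    by blast
qed

lemma finite_N: "w \<in> W \<Longrightarrow> finite (N w)"
  by (erule W_wordE) (auto intro: finite_subset[OF N_word])

text \<open>Moved to the right through the prefix, the conjugate becomes the letter
  \<open>ws ! i\<close>, which cancels against the next letter of the word.\<close>

lemma delete_letter:
  assumes "set ws \<subseteq> S" "i < length ws"
  shows "conj_by (wprod (take i ws)) (ws ! i) \<circ> wprod ws = wprod (take i ws @ drop (Suc i) ws)"
proof -
  have s: "ws ! i \<in> S" using assms by auto
  have "wprod ws = wprod (take i ws) \<circ> (ws ! i \<circ> wprod (drop (Suc i) ws))"
    by (subst id_take_nth_drop[OF assms(2)]) simp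
  moreover have "set (take i ws) \<subseteq> S" using assms set_take_subset by fast
  then have "conj_by (wprod (take i ws)) (ws ! i) \<circ> wprod (take i ws) = wprod (take i ws) \<circ> ws ! i"
    by (intro conj_by_comp_right wprod_bij)
  ultimately show ?thesis
    using involution[OF s] by (metis comp_assoc id_comp wprod_append)
qed

text \<open>Strong exchange: an element of \<open>N\<close> is toggled at some position, and
  multiplying by it deletes the letter there.\<close>

lemma exchange:
  assumes "set ws \<subseteq> S" "t \<in> N (wprod ws)"
  obtains i where "i < length ws" "t = conj_by (wprod (take i ws)) (ws ! i)"
    "t \<circ> wprod ws = wprod (take i ws @ drop (Suc i) ws)"
  using N_word[OF assms(1)] assms delete_letter[OF assms(1)] by auto

lemma len_le: "set ws \<subseteq> S \<Longrightarrow> len (wprod ws) \<le> length ws"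
  unfolding word_length_def by (rule Least_le) blast

lemma reduced_word:
  assumes "w \<in> W" obtains ws where "set ws \<subseteq> S" "length ws = len w" "w = wprod ws"
proof -
  obtain ws where "set ws \<subseteq> S" "w = wprod ws" using W_wordE[OF assms] .
  then have "\<exists>us. set us \<subseteq> S \<and> length us = length ws \<and> w = wprod us" by blast
  from LeastI[of "\<lambda>n. \<exists>us. set us \<subseteq> S \<and> length us = n \<and> w = wprod us", OF this]
  show thesis using that unfolding word_length_def by metis
qed

lemma card_N_reduced:
  "set ws \<subseteq> S \<Longrightarrow> len (wprod ws) = length ws \<Longrightarrow> card (N (wprod ws)) = length ws"
proof (induction ws rule: rev_induct)
  case Nil
  then show ?case by (simp add: N_id flip: id_def)
next
  case (snoc s ws)
  have ws: "set ws \<subseteq> S" "s \<in> S" using snoc.prems by auto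
  obtain us where us: "set us \<subseteq> S" "length us = len (wprod ws)" "wprod ws = wprod us"
    using reduced_word[OF wprod_in_W[OF ws(1)]] .
  have "len (wprod (us @ [s])) \<le> length (us @ [s])"
    using us ws by (intro len_le) auto
  moreover have "wprod (us @ [s]) = wprod (ws @ [s])" using us by simp
  ultimately have "length (ws @ [s]) \<le> length (us @ [s])" using snoc.prems(2) by metis
  then have red: "len (wprod ws) = length ws"
    using us(2) len_le[OF ws(1)] by simp
  \<comment> \<open>Otherwise exchange would express the reduced word with two letters
    fewer.\<close>
  have "conj_by (wprod ws) s \<notin> N (wprod ws)"
  proof
    assume "conj_by (wprod ws) s \<in> N (wprod ws)"
    then obtain i where i: "i < length ws"
      "conj_by (wprod ws) s \<circ> wprod ws = wprod (take i ws @ drop (Suc i) ws)"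
      using exchange[OF ws(1)] by metis
    have "wprod (ws @ [s]) = wprod (take i ws @ drop (Suc i) ws)"
      using i(2) conj_by_comp_right[OF wprod_bij[OF ws(1)]] by simp
    moreover have "set (take i ws @ drop (Suc i) ws) \<subseteq> S"
      using ws set_take_subset set_drop_subset by fastforce
    ultimately have "len (wprod (ws @ [s])) \<le> length (take i ws @ drop (Suc i) ws)"
      using len_le by metis
    then have "length (ws @ [s]) \<le> length (take i ws @ drop (Suc i) ws)"
      using snoc.prems(2) by metis
    then show False using i(1) by simp
  qed
  then have "card (N (wprod ws \<circ> s)) = Suc (length ws)"
    using snoc.IH[OF ws(1) red] N_snoc[OF wprod_in_W[OF ws(1)] ws(2)]
      finite_N[OF wprod_in_W[OF ws(1)]] by simp
  then show "card (N (wprod (ws @ [s]))) = length (ws @ [s])" by simp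
qed

lemma len_card_N: "w \<in> W \<Longrightarrow> len w = card (N w)"
  using card_N_reduced reduced_word by metis

lemma N_empty: "w \<in> W \<Longrightarrow> N w = {} \<Longrightarrow> w = id"
  by (metis card.empty len_card_N length_0_conv reduced_word wprod_Nil)

lemma N_inv: "w \<in> W \<Longrightarrow> N (inv w) = conj_by (inv w) ` N w"
proof -
  assume w: "w \<in> W"
  have "N (inv w \<circ> w) = {}" using W_bij[OF w] by (simp add: bij_is_inj N_id)
  then show ?thesis using N_comp[OF W_inv[OF w] w] by auto
qed

lemma N_injective:
  assumes "x \<in> W" "y \<in> W" "N x = N y" shows "x = y"
proof -
  have "N (inv x \<circ> y) = {}"
    using N_comp[OF W_inv[OF assms(1)] assms(2)] N_inv[OF assms(1)] assms(3) by simp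
  then have "inv x \<circ> y = id" using N_empty W_comp W_inv assms by blast
  then have "x \<circ> (inv x \<circ> y) = x" by simp
  then show ?thesis
    using W_bij[OF assms(1)] by (simp add: o_assoc bij_is_surj surj_iff[THEN iffD1])
qed

lemma len_inv: "w \<in> W \<Longrightarrow> len (inv w) = len w"
  by (simp add: len_card_N W_inv N_inv card_image inj_conj_by W_bij bij_imp_bij_inv inj_on_subset
      inj_on_subset[OF inj_conj_by])

lemma reflectionE:
  assumes "t \<in> reflections" obtains y s where "y \<in> W" "s \<in> S" "t = conj_by y s"
  using assms reflections_def by auto

lemma reflection_in_W: "t \<in> reflections \<Longrightarrow> t \<in> W"
  using conj_in_W S_sub_W reflections_def by auto

lemma reflection_involution: "t \<in> reflections \<Longrightarrow> t \<circ> t = id"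
proof (erule reflectionE)
  fix y s assume *: "y \<in> W" "s \<in> S" "t = conj_by y s"
  have "t \<circ> t = y \<circ> s \<circ> (inv y \<circ> y) \<circ> s \<circ> inv y" by (simp add: * conj_by_def o_assoc)
  also have "\<dots> = y \<circ> (s \<circ> s) \<circ> inv y" using W_bij[OF *(1)] by (simp add: bij_is_inj o_assoc)
  also have "\<dots> = id" using W_bij[OF *(1)] involution[OF *(2)] by (simp add: bij_is_surj surj_iff[THEN iffD1])
  finally show "t \<circ> t = id" .
qed

lemma reflection_mult: "t \<in> reflections \<Longrightarrow> t \<circ> (t \<circ> w) = w"
  by (simp add: o_assoc reflection_involution)

text \<open>Expanding \<open>N\<close> of \<open>y \<circ> s \<circ> inv y\<close> gives three
  contributions. By \<open>N_inv\<close> the two outer ones contain \<open>t\<close> simultaneously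
  and cancel, so the middle one, coming from \<open>N s = {s}\<close>, decides.\<close>

lemma reflection_in_own_N: "t \<in> reflections \<Longrightarrow> t \<in> N t"
proof (erule reflectionE)
  fix y s assume *: "y \<in> W" "s \<in> S" "t = conj_by y s"
  have b: "bij y" using * W_bij by blast
  have i: "inj (conj_by y)" "inj (conj_by s)"
    using b involution_bij[OF involution[OF *(2)]] inj_conj_by by blast+
  have "conj_by s s = s" using involution[OF *(2)] involution_inv[of s]
    by (simp add: conj_by_def)
  then have 1: "t \<in> conj_by y ` A \<longleftrightarrow> s \<in> A" "s \<in> conj_by s ` A \<longleftrightarrow> s \<in> A" for A
    using inj_image_mem_iff[OF i(1), of s A] inj_image_mem_iff[OF i(2), of s A] *(3) by metis+
  have "t = y \<circ> (s \<circ> inv y)" unfolding * conj_by_def by (rule comp_assoc)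
  then have "N t = sym_diff (N y) (conj_by y ` (sym_diff {s} (conj_by s ` N (inv y))))"
    using N_comp[OF *(1) W_comp[OF S_sub_W[OF *(2)] W_inv[OF *(1)]]]
      N_comp[OF S_sub_W[OF *(2)] W_inv[OF *(1)]] N_simple[OF *(2)] by simp
  moreover have "s \<in> N (inv y) \<longleftrightarrow> t \<in> N y"
  proof -
    have "s \<in> conj_by (inv y) ` N y \<longleftrightarrow> conj_by (inv y) t \<in> conj_by (inv y) ` N y"
      using b * by simp
    also have "\<dots> \<longleftrightarrow> t \<in> N y"
      by (rule inj_image_mem_iff[OF inj_conj_by[OF bij_imp_bij_inv[OF b]]])
    finally show ?thesis using N_inv * by simp
  qed
  ultimately show "t \<in> N t"
    using 1(1)[of "sym_diff {s} (conj_by s ` N (inv y))"] 1(2)[of "N (inv y)"] by blast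
qed

lemma conj_self: "t \<in> reflections \<Longrightarrow> conj_by t t = t"
  using reflection_involution[of t] involution_inv[of t] by (simp add: conj_by_def)

lemma mem_N_mult:
  assumes "t \<in> reflections" "w \<in> W"
  shows "t \<in> N (t \<circ> w) \<longleftrightarrow> t \<notin> N w"
proof -
  have "t \<in> conj_by t ` N w \<longleftrightarrow> t \<in> N w"
    using inj_image_mem_iff[OF inj_conj_by[OF W_bij[OF reflection_in_W[OF assms(1)]]], of t "N w"]
    unfolding conj_self[OF assms(1)] .
  then show ?thesis
    using N_comp[OF reflection_in_W assms(2)] assms(1) reflection_in_own_N by auto
qed

lemma len_mult_less:
  assumes "w \<in> W" "t \<in> N w" shows "len (t \<circ> w) < len w"
proof -
  obtain ws where ws: "set ws \<subseteq> S" "length ws = len w" "w = wprod ws"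
    using reduced_word[OF assms(1)] .
  then obtain i where i: "i < length ws" "t \<circ> w = wprod (take i ws @ drop (Suc i) ws)"
    using exchange assms(2) by metis
  have "set (take i ws @ drop (Suc i) ws) \<subseteq> S"
    using ws set_take_subset set_drop_subset by fastforce
  from len_le[OF this] show ?thesis using i ws by simp
qed

lemma len_mult_greater:
  assumes "w \<in> W" "t \<in> reflections" "t \<notin> N w" shows "len w < len (t \<circ> w)"
proof -
  have "t \<in> N (t \<circ> w)" using mem_N_mult[OF assms(2,1)] assms(3) by blast
  from len_mult_less[OF W_comp[OF reflection_in_W[OF assms(2)] assms(1)] this]
  show ?thesis unfolding reflection_mult[OF assms(2)] .
qed

lemma mem_N_iff:
  assumes "w \<in> W" "t \<in> reflections" shows "t \<in> N w \<longleftrightarrow> len (t \<circ> w) < len w"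
  using len_mult_less len_mult_greater assms by fastforce

lemma conj_reflection: "w \<in> W \<Longrightarrow> s \<in> S \<Longrightarrow> conj_by w s \<in> reflections"
  using reflections_def by auto

lemma len_snoc:
  assumes "w \<in> W" "s \<in> S"
  shows "if conj_by w s \<in> N w then len w = Suc (len (w \<circ> s)) else len (w \<circ> s) = Suc (len w)"
proof -
  have "w \<circ> s \<in> W" using assms W_comp S_sub_W by blast
  then have "len w = card (N w)" "len (w \<circ> s) = card (N (w \<circ> s))"
    using len_card_N assms(1) by blast+
  moreover have "Suc (card (N w - {conj_by w s})) = card (N w)" if "conj_by w s \<in> N w"
    using that finite_N[OF assms(1)] by (rule card_Suc_Diff1[rotated])
  ultimately show ?thesis
    using N_snoc[OF assms] finite_N[OF assms(1)] by (simp split: if_splits)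
qed

lemma descent_exists:
  assumes "w \<in> W" "w \<noteq> id"
  obtains s where "s \<in> S" "len w = Suc (len (w \<circ> s))"
proof -
  obtain ws where ws: "set ws \<subseteq> S" "length ws = len w" "w = wprod ws"
    using reduced_word[OF assms(1)] .
  then have "ws \<noteq> []" using assms(2) by auto
  then obtain us s where us: "ws = us @ [s]" by (metis append_butlast_last_id)
  then have s: "s \<in> S" using ws by auto
  have "w \<circ> s = wprod us" using us ws involution[OF s] by (simp add: comp_assoc)
  then have "len (w \<circ> s) \<le> length us" using us ws len_le by auto
  then have "len (w \<circ> s) < len w" using us ws by simp
  then have "len w = Suc (len (w \<circ> s))" using len_snoc[OF assms(1) s] by (auto split: if_splits)
  then show thesis using s that by blast
qed

subsection \<open>Bruhat order\<close>

abbreviation bless :: "('a \<Rightarrow> 'a) \<Rightarrow> ('a \<Rightarrow> 'a) \<Rightarrow> bool" where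
  "bless \<equiv> bruhat_less W S"

lemma bless_alt:
  "bless u w \<longleftrightarrow> (u, w) \<in> {(x, t \<circ> x) | x t. x \<in> W \<and> t \<in> reflections \<and> len x < len (t \<circ> x)}\<^sup>+"
  unfolding bruhat_less_def reflections_def conj_by_def by (rule arg_cong[where f = "\<lambda>R. (u, w) \<in> R\<^sup>+"]) blast

lemma bless_step: "x \<in> W \<Longrightarrow> t \<in> reflections \<Longrightarrow> t \<notin> N x \<Longrightarrow> bless x (t \<circ> x)"
  unfolding bless_alt using len_mult_greater by (intro r_into_trancl) auto

lemma bless_trans: "bless x y \<Longrightarrow> bless y z \<Longrightarrow> bless x z"
  unfolding bless_alt by (rule trancl_trans)

lemma bless_induct [consumes 1, case_names step step_trans]:
  assumes "bless u w"
    and "\<And>x t. x \<in> W \<Longrightarrow> t \<in> reflections \<Longrightarrow> t \<notin> N x \<Longrightarrow> P x (t \<circ> x)"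
    and "\<And>x y z. bless x y \<Longrightarrow> bless y z \<Longrightarrow> P x y \<Longrightarrow> P y z \<Longrightarrow> P x z"
  shows "P u w"
proof -
  let ?R = "{(x, t \<circ> x) | x t. x \<in> W \<and> t \<in> reflections \<and> len x < len (t \<circ> x)}"
  have step: "P x y" if "(x, y) \<in> ?R" for x y
    using that assms(2) mem_N_iff by fastforce
  have "(u, w) \<in> ?R\<^sup>+" using assms(1) bless_alt by simp
  then show ?thesis
  proof (induction rule: trancl_induct)
    case (base y)
    then show ?case using step by blast
  next
    case (step y z)
    moreover have "bless u y" "bless y z" unfolding bless_alt using step by auto
    ultimately show ?case using assms(3) \<open>\<And>x y. (x, y) \<in> ?R \<Longrightarrow> P x y\<close> by blast
  qed
qed

lemma bless_props:
  assumes "bless u w" shows "u \<in> W \<and> w \<in> W \<and> len u < len w"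
  using assms
proof (induction rule: bless_induct)
  case (step x t)
  then show ?case using len_mult_greater W_comp reflection_in_W by blast
qed auto

lemma bless_snoc:
  assumes "w \<in> W" "s \<in> S"
  shows "bless (w \<circ> s) w \<longleftrightarrow> conj_by w s \<in> N w"
proof
  assume "bless (w \<circ> s) w"
  then have "len (w \<circ> s) < len w" using bless_props by blast
  then show "conj_by w s \<in> N w" using len_snoc[OF assms] by (auto split: if_splits)
next
  assume a: "conj_by w s \<in> N w"
  have t: "conj_by w s \<in> reflections" "conj_by w s \<circ> w = w \<circ> s"
    using conj_reflection[OF assms] conj_by_comp_right[OF W_bij[OF assms(1)]] by blast+
  then have "conj_by w s \<notin> N (w \<circ> s)" using mem_N_mult[OF t(1) assms(1)] a by metis
  from bless_step[OF _ t(1) this] show "bless (w \<circ> s) w"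
    using t reflection_mult assms W_comp S_sub_W by metis
qed

text \<open>The longer element of the coset of \<open>x\<close> under right multiplication by
  \<open>s\<close>. That this projection respects the Bruhat order is the lifting property.\<close>

definition up :: "('a \<Rightarrow> 'a) \<Rightarrow> ('a \<Rightarrow> 'a) \<Rightarrow> 'a \<Rightarrow> 'a" where
  "up s x = (if len x < len (x \<circ> s) then x \<circ> s else x)"

lemma comp_s_s: "s \<in> S \<Longrightarrow> x \<circ> s \<circ> s = x"
  by (simp add: comp_assoc involution)

lemma bless_comp_s:
  assumes "x \<in> W" "s \<in> S" "len x < len (x \<circ> s)" shows "bless x (x \<circ> s)"
proof -
  have "conj_by x s \<circ> x = x \<circ> s" "conj_by x s \<notin> N x"
    using len_snoc[OF assms(1,2)] assms conj_by_comp_right[OF W_bij] by (auto split: if_splits)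
  then show ?thesis using bless_step conj_reflection assms by metis
qed

lemma len_comp_s_less:
  assumes "x \<in> W" "s \<in> S" "\<not> len x < len (x \<circ> s)" shows "len (x \<circ> s) < len x"
  using len_snoc[OF assms(1,2)] assms(3) by (auto split: if_splits)

text \<open>\<open>N (x \<circ> s)\<close> differs from \<open>N x\<close> only by
  \<open>conj_by x s\<close>; if this were \<open>t\<close>, then
  \<open>t \<circ> x = x \<circ> s\<close>.\<close>

lemma bless_lift:
  assumes "x \<in> W" "t \<in> reflections" "t \<notin> N x" "s \<in> S" "len x < len (x \<circ> s)" "x \<circ> s \<noteq> t \<circ> x"
  shows "t \<notin> N (x \<circ> s)"
proof
  assume "t \<in> N (x \<circ> s)"
  then have "t = conj_by x s"
    using N_snoc[OF assms(1,4)] assms(3) by (auto split: if_splits)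
  then show False using assms(6) conj_by_comp_right[OF W_bij[OF assms(1)]] by simp
qed

text \<open>It suffices to treat one generating step from \<open>x\<close> to
  \<open>t \<circ> x\<close>. The only case with content is that \<open>s\<close> lengthens
  \<open>x\<close> and \<open>x \<circ> s\<close> is not \<open>t \<circ> x\<close>; then the step
  survives multiplication by \<open>s\<close>, by \<open>bless_lift\<close>.\<close>

lemma bless_up:
  assumes "bless x y" "s \<in> S" shows "up s x = up s y \<or> bless (up s x) (up s y)"
  using assms(1)
proof (induction rule: bless_induct)
  case (step x t)
  have tx: "t \<circ> x \<in> W" using step W_comp reflection_in_W by blast
  have up_tx: "up s (t \<circ> x) = t \<circ> x \<or> bless (t \<circ> x) (up s (t \<circ> x))"
    unfolding up_def using bless_comp_s[OF tx assms(2)] by metis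
  show "up s x = up s (t \<circ> x) \<or> bless (up s x) (up s (t \<circ> x))"
  proof (cases "len x < len (x \<circ> s)")
    case False
    then have "up s x = x" by (simp add: up_def)
    then show ?thesis using up_tx bless_step[OF step] bless_trans by metis
  next
    case True
    show ?thesis
    proof (cases "x \<circ> s = t \<circ> x")
      case eq: True
      have "up s x = t \<circ> x" using True eq by (metis up_def)
      then show ?thesis using up_tx by metis
    next
      case False
      have "bless (x \<circ> s) (t \<circ> (x \<circ> s))"
        using bless_step[OF _ step(2) bless_lift[OF step assms(2) True False]]
          W_comp S_sub_W assms(2) step(1) by blast
      \<comment> \<open>\<open>t \<circ> x \<circ> s\<close> lies in the coset of
        \<open>t \<circ> x\<close>, so it is the top of that coset or just below it.\<close>
      moreover have "t \<circ> (x \<circ> s) = up s (t \<circ> x) \<or> bless (t \<circ> (x \<circ> s)) (up s (t \<circ> x))"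
        using len_comp_s_less[OF tx assms(2)] bless_comp_s[of "t \<circ> x \<circ> s" s] W_comp[OF tx S_sub_W] assms(2)
        by (auto simp: up_def comp_assoc involution)
      moreover have "up s x = x \<circ> s" using True by (simp add: up_def)
      ultimately show ?thesis using bless_trans by metis
    qed
  qed
next
  case (step_trans x y z)
  then show ?case by (metis bless_trans)
qed

lemma bless_not_refl: "\<not> bless x x"
  using bless_props by blast

lemma parity_len_snoc:
  assumes "w \<in> W" "s \<in> S" shows "even (len (w \<circ> s)) \<longleftrightarrow> odd (len w)"
  using len_snoc[OF assms] by (auto split: if_splits)

lemma parity_len_word: "w \<in> W \<Longrightarrow> set ws \<subseteq> S \<Longrightarrow> even (len (w \<circ> wprod ws)) \<longleftrightarrow> even (len w + length ws)"
proof (induction ws rule: rev_induct)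
  case (snoc s ws)
  then have *: "set ws \<subseteq> S" "s \<in> S" "w \<circ> wprod ws \<in> W" using wprod_in_W W_comp by auto
  have "w \<circ> wprod (ws @ [s]) = w \<circ> wprod ws \<circ> s" by (simp add: o_assoc)
  then show "even (len (w \<circ> wprod (ws @ [s]))) \<longleftrightarrow> even (len w + length (ws @ [s]))"
    using parity_len_snoc[OF *(3,2)] snoc.IH[OF snoc.prems(1) *(1)] by simp
qed (simp flip: id_def)

lemma parity_len_comp:
  assumes "w \<in> W" "y \<in> W" shows "even (len (w \<circ> y)) \<longleftrightarrow> even (len w + len y)"
  using assms parity_len_word reduced_word by metis

lemma parity_len_reflection:
  assumes "w \<in> W" "t \<in> reflections" shows "even (len (t \<circ> w)) \<longleftrightarrow> odd (len w)"
proof -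
  obtain y s where *: "y \<in> W" "s \<in> S" "t = conj_by y s" using assms(2) reflectionE by blast
  have "odd (len t)"
    using parity_len_comp[OF W_comp[OF *(1) S_sub_W[OF *(2)]] W_inv[OF *(1)]]
      parity_len_snoc[OF *(1,2)] len_inv[OF *(1)] unfolding *(3) conj_by_def by auto
  then show ?thesis using parity_len_comp[OF reflection_in_W[OF assms(2)] assms(1)] by auto
qed

text \<open>Take a right descent \<open>s\<close> of \<open>t \<circ> u\<close>. If \<open>s\<close>
  lengthens \<open>u\<close>, then \<open>u \<circ> s\<close> lies strictly between. Otherwise
  induction applies to the shorter \<open>u \<circ> s\<close>, and the intermediate element found
  there is projected by \<open>up s\<close>; the projection can only fail to be strict if that
  element already is \<open>u\<close>, in which case \<open>t \<circ> u \<circ> s\<close>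
  serves.\<close>

lemma intermediate_exists:
  "u \<in> W \<Longrightarrow> t \<in> reflections \<Longrightarrow> t \<notin> N u \<Longrightarrow> len (t \<circ> u) \<noteq> Suc (len u) \<Longrightarrow>
    \<exists>z. bless u z \<and> bless z (t \<circ> u)"
proof (induction "len u" arbitrary: u rule: less_induct)
  case less
  define w where "w = t \<circ> u"
  have w: "w \<in> W" using less.prems W_comp reflection_in_W w_def by blast
  \<comment> \<open>A reflection changes the parity of the length, so a gap different from one is at
    least three.\<close>
  have gap: "Suc (Suc (len u)) < len w"
  proof -
    have "len w \<noteq> Suc (Suc (len u))"
      using parity_len_reflection[OF less.prems(1,2)] unfolding w_def by auto
    then show ?thesis
      using less.prems(4) len_mult_greater[OF less.prems(1-3)] unfolding w_def by linarith
  qed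
  then have "w \<noteq> id" using len_card_N[OF id_in_W] N_id by auto
  then obtain s where s: "s \<in> S" "len w = Suc (len (w \<circ> s))" using descent_exists[OF w] by blast
  have us: "u \<circ> s \<in> W" "w \<circ> s \<in> W" "w \<circ> s = t \<circ> (u \<circ> s)"
    using W_comp[OF less.prems(1) S_sub_W[OF s(1)]] W_comp[OF w S_sub_W[OF s(1)]]
    by (auto simp only: w_def comp_assoc)
  have wsw: "bless (w \<circ> s) w"
    using bless_comp_s[OF us(2) s(1)] s(2) unfolding comp_s_s[OF s(1)] by simp
  show ?case
  proof (cases "len u < len (u \<circ> s)")
    case True
    then have "len (u \<circ> s) = Suc (len u)" using len_snoc[OF less.prems(1) s(1)] by (auto split: if_splits)
    then have "t \<notin> N (u \<circ> s)" using mem_N_iff[OF us(1) less.prems(2)] us(3) gap s by auto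
    then have "bless (u \<circ> s) (w \<circ> s)" using bless_step us less.prems by auto
    then show ?thesis
      using bless_comp_s[OF less.prems(1) s(1) True] wsw bless_trans w_def by blast
  next
    case False
    have uss: "len (u \<circ> s) < len u" using len_comp_s_less[OF less.prems(1) s(1) False] .
    then have lus: "len u = Suc (len (u \<circ> s))"
      using len_snoc[OF less.prems(1) s(1)] by (auto split: if_splits)
    have nt: "t \<notin> N (u \<circ> s)" using mem_N_iff[OF us(1) less.prems(2)] us(3) gap s uss by auto
    have "len (t \<circ> (u \<circ> s)) \<noteq> Suc (len (u \<circ> s))" using us(3) gap s lus by auto
    from less.hyps[OF uss us(1) less.prems(2) nt this]
    obtain z where z: "bless (u \<circ> s) z" "bless z (w \<circ> s)" using us(3) by auto
    have zW: "z \<in> W" using z bless_props by blast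
    show ?thesis
    proof (cases "z = u")
      case True
      then show ?thesis using z wsw w_def by blast
    next
      case zu: False
      have up: "up s (u \<circ> s) = u" "up s (w \<circ> s) = w"
        using lus s by (auto simp: up_def comp_s_s)
      have "up s z \<noteq> u"
      proof
        assume "up s z = u"
        then have "z \<circ> s = u" using zu by (auto simp: up_def split: if_splits)
        then have "z = u \<circ> s" using comp_s_s[OF s(1)] by metis
        then show False using z bless_not_refl by blast
      qed
      moreover have "up s z \<noteq> w"
      proof
        assume "up s z = w"
        moreover have "z \<noteq> w" using z wsw bless_trans bless_not_refl by blast
        ultimately have "z \<circ> s = w" by (auto simp: up_def split: if_splits)
        then have "z = w \<circ> s" using comp_s_s[OF s(1)] by metis
        then show False using z bless_not_refl by blast
      qed
      ultimately show ?thesis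
        using bless_up[OF z(1) s(1)] bless_up[OF z(2) s(1)] up w_def by metis
    qed
  qed
qed

text \<open>Any larger gap is filled by \<open>intermediate_exists\<close>, while Bruhat steps
  strictly increase the length. This replaces the covers in \<open>admissible\<close> by a condition
  on lengths.\<close>

lemma covered_iff:
  assumes "u \<in> W" "t \<in> reflections"
  shows "bruhat_covered W S u (t \<circ> u) \<longleftrightarrow> len (t \<circ> u) = Suc (len u)"
proof
  assume c: "bruhat_covered W S u (t \<circ> u)"
  then have "len u < len (t \<circ> u)" using bless_props unfolding bruhat_covered_def by blast
  then have "t \<notin> N u" using len_mult_less[OF assms(1)] by fastforce
  then show "len (t \<circ> u) = Suc (len u)"
    using intermediate_exists[OF assms] c bless_props unfolding bruhat_covered_def by blast
next
  assume l: "len (t \<circ> u) = Suc (len u)"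
  then have "t \<notin> N u" using len_mult_less[OF assms(1)] by fastforce
  moreover have "\<not> (bless u z \<and> bless z (t \<circ> u))" for z
  proof
    assume "bless u z \<and> bless z (t \<circ> u)"
    then have "len u < len z" "len z < len (t \<circ> u)" using bless_props by blast+
    then show False using l by linarith
  qed
  ultimately show "bruhat_covered W S u (t \<circ> u)"
    unfolding bruhat_covered_def using bless_step[OF assms] by blast
qed

end

subsection \<open>Weight functions\<close>

locale weighted_cocycle = reflection_cocycle +
  fixes L :: "('a \<Rightarrow> 'a) \<Rightarrow> nat"
  assumes weight_snoc: "w \<in> W \<Longrightarrow> s \<in> S \<Longrightarrow> len (w \<circ> s) = Suc (len w) \<Longrightarrow> L (w \<circ> s) = L w + L s"
    and weight_cons: "w \<in> W \<Longrightarrow> s \<in> S \<Longrightarrow> len (s \<circ> w) = Suc (len w) \<Longrightarrow> L (s \<circ> w) = L s + L w"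
    and weight_id: "L id = 0"
    and weight_pos: "s \<in> S \<Longrightarrow> L s > 0"
begin

text \<open>From \<open>y \<circ> s = s' \<circ> y\<close>: if \<open>s\<close> lengthens
  \<open>y\<close>, evaluating \<open>L\<close> on both sides compares \<open>L s\<close> with
  \<open>L s'\<close>. Otherwise \<open>y \<circ> s\<close> takes the place of
  \<open>y\<close>.\<close>

lemma weight_conj:
  assumes "y \<in> W" "s \<in> S" "s' \<in> S" "conj_by y s = s'" shows "L s = L s'"
proof -
  have key: "L s = L s'" if "w \<in> W" "w \<circ> s = s' \<circ> w" "len (w \<circ> s) = Suc (len w)" for w
    using weight_snoc[OF that(1) assms(2)] weight_cons[OF that(1) assms(3)] that by simp
  have ys: "y \<circ> s = s' \<circ> y" using conj_by_comp_right[OF W_bij[OF assms(1)], of s] assms(4) by simp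
  show ?thesis
  proof (cases "len (y \<circ> s) = Suc (len y)")
    case True
    then show ?thesis using key[OF assms(1) ys] by simp
  next
    case False
    have "len (y \<circ> s \<circ> s) = Suc (len (y \<circ> s))"
      using len_snoc[OF assms(1,2)] False by (auto simp: comp_s_s[OF assms(2)] split: if_splits)
    moreover have "y \<circ> s \<circ> s = s' \<circ> (y \<circ> s)"
      by (metis ys comp_assoc)
    ultimately show ?thesis using key[of "y \<circ> s"] W_comp S_sub_W assms by blast
  qed
qed

text \<open>A letter that shortens the product subtracts its weight instead of adding it; positivity
  of the weights makes the loss strict.\<close>

lemma weight_word:
  "set ws \<subseteq> S \<Longrightarrow> L (wprod ws) \<le> sum_list (map L ws) \<and>
    (L (wprod ws) = sum_list (map L ws) \<longleftrightarrow> len (wprod ws) = length ws)"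
proof (induction ws rule: rev_induct)
  case Nil
  then show ?case using len_le[of "[]"] weight_id by (simp add: id_def)
next
  case (snoc s ws)
  let ?w = "wprod ws"
  have ws: "set ws \<subseteq> S" "s \<in> S" "?w \<in> W" using snoc.prems wprod_in_W by auto
  have IH: "L ?w \<le> sum_list (map L ws)" "L ?w = sum_list (map L ws) \<longleftrightarrow> len ?w = length ws"
    using snoc ws by auto
  have "L (?w \<circ> s) \<le> sum_list (map L (ws @ [s])) \<and>
    (L (?w \<circ> s) = sum_list (map L (ws @ [s])) \<longleftrightarrow> len (?w \<circ> s) = length (ws @ [s]))"
  proof (cases "len (?w \<circ> s) = Suc (len ?w)")
    case True
    then show ?thesis using IH weight_snoc[OF ws(3,2) True] by auto
  next
    case False
    have l: "len (?w \<circ> s \<circ> s) = Suc (len (?w \<circ> s))" "len ?w = Suc (len (?w \<circ> s))"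
      using len_snoc[OF ws(3,2)] False by (auto simp: comp_s_s[OF ws(2)] split: if_splits)
    have "L ?w = L (?w \<circ> s) + L s"
      using weight_snoc[OF _ ws(2) l(1)] W_comp S_sub_W ws by (auto simp: comp_s_s[OF ws(2)])
    then show ?thesis using IH l weight_pos[OF ws(2)] len_le[OF ws(1)] by auto
  qed
  then show "L (wprod (ws @ [s])) \<le> sum_list (map L (ws @ [s])) \<and>
    (L (wprod (ws @ [s])) = sum_list (map L (ws @ [s])) \<longleftrightarrow> len (wprod (ws @ [s])) = length (ws @ [s]))"
    by simp
qed

text \<open>Exchange deletes one letter \<open>s\<close> from a reduced word of \<open>w\<close>.
  The remaining word bounds \<open>L (t \<circ> w)\<close>, with equality exactly if it is
  reduced.\<close>

lemma weight_reflect: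
  assumes "w \<in> W" "t \<in> N w"
  obtains y s where "y \<in> W" "s \<in> S" "t = conj_by y s" "L (t \<circ> w) + L s \<le> L w"
    "L (t \<circ> w) + L s = L w \<longleftrightarrow> len w = Suc (len (t \<circ> w))"
proof -
  obtain ws where ws: "set ws \<subseteq> S" "length ws = len w" "w = wprod ws"
    using reduced_word[OF assms(1)] .
  then obtain i where i: "i < length ws" "t = conj_by (wprod (take i ws)) (ws ! i)"
     "t \<circ> w = wprod (take i ws @ drop (Suc i) ws)"
    using exchange assms(2) by metis
  have s: "set (take i ws @ drop (Suc i) ws) \<subseteq> S" "set (take i ws) \<subseteq> S" "ws ! i \<in> S"
    using ws i set_take_subset[of i ws] set_drop_subset[of "Suc i" ws] by auto
  have "L w = sum_list (map L ws)" using weight_word[OF ws(1)] ws by simp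
  also have "\<dots> = sum_list (map L (take i ws @ ws ! i # drop (Suc i) ws))"
    using id_take_nth_drop[OF i(1)] by simp
  finally have "L w = sum_list (map L (take i ws @ drop (Suc i) ws)) + L (ws ! i)" by simp
  moreover have "length (take i ws @ drop (Suc i) ws) = len w - 1" "len w > 0" using ws i by auto
  ultimately show thesis
    using that[OF wprod_in_W[OF s(2)] s(3) i(2)] weight_word[OF s(1)] i(3) by auto
qed

text \<open>Here \<open>f\<close> extends \<open>L\<close> from the generators to all reflections,
  constant on conjugacy classes. In a reduced word each letter adds exactly one new
  reflection.\<close>

lemma weight_sum_N:
  assumes "w \<in> W" and f: "\<And>y s. y \<in> W \<Longrightarrow> s \<in> S \<Longrightarrow> f (conj_by y s) = L s"
  shows "L w = sum f (N w)"
proof -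
  obtain ws where ws: "set ws \<subseteq> S" "length ws = len w" "w = wprod ws"
    using reduced_word[OF assms(1)] .
  have "len (wprod ws) = length ws \<Longrightarrow> L (wprod ws) = sum f (N (wprod ws))"
    using ws(1)
  proof (induction ws rule: rev_induct)
    case Nil
    then show ?case using weight_id N_id by (simp flip: id_def)
  next
    case (snoc s ws)
    let ?w = "wprod ws"
    have ws: "set ws \<subseteq> S" "s \<in> S" "?w \<in> W" using snoc.prems wprod_in_W by auto
    have "wprod (ws @ [s]) = ?w \<circ> s" by simp
    then have "len (?w \<circ> s) = Suc (length ws)" using snoc.prems(1) by (metis length_append_singleton)
    then have l: "len ?w = length ws" "len (?w \<circ> s) = Suc (len ?w)"
      using len_snoc[OF ws(3,2)] len_le[OF ws(1)] by (auto split: if_splits)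
    have "conj_by ?w s \<notin> N ?w" using len_snoc[OF ws(3,2)] l by (auto split: if_splits)
    then have "L (?w \<circ> s) = sum f (N (?w \<circ> s))"
      using snoc.IH[OF l(1) ws(1)] weight_snoc[OF ws(3,2) l(2)] N_snoc[OF ws(3,2)]
        finite_N[OF ws(3)] f[OF ws(3,2)] by simp
    then show "L (wprod (ws @ [s])) = sum f (N (wprod (ws @ [s])))" by simp
  qed
  then show ?thesis using ws by simp
qed

end

section \<open>Reflections and pairings\<close>

lemma pairing_add: "pairing (x + y) a = pairing x a + pairing y a"
  and pairing_diff: "pairing (x - y) a = pairing x a - pairing y a"
  and pairing_minus: "pairing (- x) a = - pairing x a"
  and pairing_minus_right: "pairing x (- a) = - pairing x a"
  and pairing_scale: "pairing (c *\<^sub>R x) a = c * pairing x a"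
  and pairing_zero: "pairing 0 a = 0"
  by (simp_all add: pairing_def algebra_simps add_divide_distrib diff_divide_distrib)

lemma pairing_self: "a \<noteq> 0 \<Longrightarrow> pairing a a = 2"
  by (simp add: pairing_def)

lemma pairing_coroot: "pairing x a = x \<bullet> coroot a"
  by (simp add: pairing_def coroot_def)

lemma refl_aff_zero: "refl_aff a 0 x = x - pairing x a *\<^sub>R a"
  by (simp add: refl_aff_def)

lemma refl_aff_alt: "refl_aff a n = transl (of_int n *\<^sub>R a) \<circ> refl_aff a 0"
  by (simp add: fun_eq_iff refl_aff_def transl_def algebra_simps)

lemma refl_aff_minus: "refl_aff (- a) (- n) = refl_aff a n"
  by (simp add: fun_eq_iff refl_aff_def pairing_minus_right algebra_simps)

lemma refl_aff_minus_zero: "refl_aff (- a) 0 = refl_aff a 0"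
  using refl_aff_minus[of a 0] by simp

lemma linear_refl: "linear (refl_aff a 0)"
  by (rule linearI) (simp_all add: refl_aff_zero pairing_add pairing_scale algebra_simps)

lemma refl_aff_involution: "a \<noteq> 0 \<Longrightarrow> refl_aff a n \<circ> refl_aff a n = id"
  by (simp add: fun_eq_iff refl_aff_def pairing_diff pairing_scale pairing_self scaleR_diff_left)

lemma refl_self: "a \<noteq> 0 \<Longrightarrow> refl_aff a 0 a = - a"
  by (simp add: refl_aff_zero pairing_self algebra_simps scaleR_2)

lemma pairing_refl_self: "a \<noteq> 0 \<Longrightarrow> pairing (refl_aff a n x) a = 2 * of_int n - pairing x a"
  by (simp add: refl_aff_def pairing_diff pairing_scale pairing_self)

lemma orthogonal_refl: "a \<noteq> 0 \<Longrightarrow> orthogonal_transformation (refl_aff a 0)"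
  unfolding orthogonal_transformation_def
  by (auto simp: linear_refl refl_aff_zero pairing_def inner_diff_left inner_diff_right
      field_simps inner_commute)

lemma orthogonal_pairing: "orthogonal_transformation u \<Longrightarrow> pairing (u x) (u y) = pairing x y"
  by (simp add: pairing_def orthogonal_transformation_def)

lemma orthogonal_coroot: "orthogonal_transformation u \<Longrightarrow> coroot (u y) = u (coroot y)"
  by (simp add: coroot_def orthogonal_transformation_def linear_cmul)

lemma refl_fixed: "a \<noteq> 0 \<Longrightarrow> {x. refl_aff a n x = x} = hyp a n"
  by (auto simp: refl_aff_def hyp_def)

text \<open>Differences of values remove the affine constants. The reflection in \<open>b\<close>
  negates \<open>b\<close>, so the one in \<open>a\<close> does too, which makes \<open>b\<close> a
  multiple of \<open>a\<close>.\<close>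

lemma refl_aff_eq_imp:
  assumes "a \<noteq> 0" "b \<noteq> 0" "refl_aff a n = refl_aff b m"
  obtains c where "b = c *\<^sub>R a"
proof -
  have "refl_aff a n (b + x) - refl_aff a n x = refl_aff b m (b + x) - refl_aff b m x" for x
    using assms(3) by simp
  from this[of 0] have "b - pairing b a *\<^sub>R a = - b"
    using assms(2) by (simp add: refl_aff_def pairing_add pairing_zero pairing_self algebra_simps scaleR_2)
  then have "2 *\<^sub>R b = pairing b a *\<^sub>R a" by (simp add: scaleR_2 algebra_simps)
  then have "(1/2) *\<^sub>R (2 *\<^sub>R b) = (1/2) *\<^sub>R (pairing b a *\<^sub>R a)" by simp
  then have "b = (pairing b a / 2) *\<^sub>R a" by simp
  then show thesis using that by blast
qed

lemma refl_aff_inject_int: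
  assumes "a \<noteq> 0" "refl_aff a n = refl_aff a m" shows "n = m"
proof -
  have "refl_aff a n 0 = refl_aff a m 0" using assms by simp
  then show ?thesis using assms(1) by (simp add: refl_aff_def pairing_zero)
qed

lemma nat_combsI: "(\<And>b. b \<in> B \<Longrightarrow> \<exists>n::nat. f b = real n) \<Longrightarrow> (\<Sum>b\<in>B. f b *\<^sub>R b) \<in> nat_combs B"
proof -
  assume "\<And>b. b \<in> B \<Longrightarrow> \<exists>n::nat. f b = real n"
  then have "\<forall>b. \<exists>n::nat. b \<in> B \<longrightarrow> f b = real n" by blast
  then obtain c :: "'a \<Rightarrow> nat" where "\<And>b. b \<in> B \<Longrightarrow> f b = real (c b)" by metis
  then have "(\<Sum>b\<in>B. f b *\<^sub>R b) = (\<Sum>b\<in>B. of_nat (c b) *\<^sub>R b)"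
    by (intro sum.cong) auto
  then show ?thesis unfolding nat_combs_def by blast
qed

lemma nat_combs_add: "x \<in> nat_combs B \<Longrightarrow> y \<in> nat_combs B \<Longrightarrow> x + y \<in> nat_combs B"
proof -
  assume "x \<in> nat_combs B" "y \<in> nat_combs B"
  then obtain c d where "x = (\<Sum>b\<in>B. of_nat (c b) *\<^sub>R b)" "y = (\<Sum>b\<in>B. of_nat (d b) *\<^sub>R b)"
    unfolding nat_combs_def by auto
  then have "x + y = (\<Sum>b\<in>B. of_nat (c b + d b) *\<^sub>R b)"
    by (simp add: sum.distrib scaleR_add_left)
  then show ?thesis unfolding nat_combs_def by (intro CollectI exI[of _ "\<lambda>b. c b + d b"])
qed

lemma nat_combs_0: "0 \<in> nat_combs B"
  using nat_combsI[of B "\<lambda>_. 0"] by (auto intro: exI[of _ 0])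

lemma nat_combs_multiple:
  assumes "finite B" "b \<in> B" shows "real n *\<^sub>R b \<in> nat_combs B"
proof -
  have "(\<Sum>x\<in>B. (if x = b then real n else 0) *\<^sub>R x) = real n *\<^sub>R b"
    using assms by (simp add: if_distrib[of "\<lambda>c. c *\<^sub>R _"] cong: if_cong)
  moreover have "(\<Sum>x\<in>B. (if x = b then real n else 0) *\<^sub>R x) \<in> nat_combs B"
    by (rule nat_combsI) (metis of_nat_0)
  ultimately show ?thesis by simp
qed

lemma nat_combs_nonneg:
  assumes "x \<in> nat_combs B" "\<And>b. b \<in> B \<Longrightarrow> 0 \<le> y \<bullet> b" shows "0 \<le> y \<bullet> x"
  using assms unfolding nat_combs_def by (auto simp: inner_sum_right intro!: sum_nonneg)

lemma nat_combs_inner_pos: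
  assumes "finite B" "x \<in> nat_combs B" "x \<noteq> 0" "\<And>b. b \<in> B \<Longrightarrow> 0 < y \<bullet> b" shows "0 < y \<bullet> x"
proof -
  obtain c where c: "x = (\<Sum>b\<in>B. of_nat (c b) *\<^sub>R b)" using assms(2) unfolding nat_combs_def by blast
  then have "\<exists>b\<in>B. c b \<noteq> 0"
    using assms(3) by (metis (no_types, lifting) of_nat_0 scaleR_zero_left sum.neutral)
  then obtain b where b: "b \<in> B" "c b \<noteq> 0" by blast
  have "y \<bullet> x = (\<Sum>b\<in>B. of_nat (c b) * (y \<bullet> b))" unfolding c by (simp add: inner_sum_right)
  also have "\<dots> > 0"
    using b assms(1,4) by (intro sum_pos2[OF _ b(1)]) (auto simp: less_imp_le)
  finally show ?thesis .
qed

text \<open>Well-founded induction along a real measure, used for heights of roots and distances to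
  hyperplanes: only finitely many elements lie below a given one.\<close>

lemma finite_real_induct [consumes 2, case_names less]:
  fixes f :: "'b \<Rightarrow> real"
  assumes "finite {y. Q y \<and> f y < f x}" "Q x"
    and step: "\<And>x. Q x \<Longrightarrow> (\<And>y. Q y \<Longrightarrow> f y < f x \<Longrightarrow> P y) \<Longrightarrow> P x"
  shows "P x"
  using assms(1,2)
proof (induction "card {y. Q y \<and> f y < f x}" arbitrary: x rule: less_induct)
  case less
  have "P y" if y: "Q y" "f y < f x" for y
  proof -
    have "{z. Q z \<and> f z < f y} \<subset> {z. Q z \<and> f z < f x}" using y by auto
    then show ?thesis
      using less.hyps[OF psubset_card_mono[OF less.prems(1)] finite_subset[OF _ less.prems(1)]] y(1)
      by blast
  qed
  then show ?case using step[OF less.prems(2)] by blast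
qed

section \<open>Root systems with a base\<close>

locale root_base =
  fixes \<Phi> \<Delta> :: "'a::euclidean_space set"
  assumes root_system: "root_system \<Phi>" and simple_roots: "simple_roots \<Phi> \<Delta>"
begin

abbreviation pos ("\<Phi>\<^sub>+") where "\<Phi>\<^sub>+ \<equiv> pos_roots \<Phi> \<Delta>"

abbreviation rfl :: "'a \<Rightarrow> 'a \<Rightarrow> 'a" where "rfl a \<equiv> refl_aff a 0"

lemma finite_roots: "finite \<Phi>" and zero_not_root: "0 \<notin> \<Phi>" and span_roots: "span \<Phi> = UNIV"
  and refl_root: "a \<in> \<Phi> \<Longrightarrow> b \<in> \<Phi> \<Longrightarrow> rfl a b \<in> \<Phi>"
  and pairing_root_Ints: "a \<in> \<Phi> \<Longrightarrow> b \<in> \<Phi> \<Longrightarrow> pairing b a \<in> \<int>"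
  and reduced: "a \<in> \<Phi> \<Longrightarrow> c *\<^sub>R a \<in> \<Phi> \<Longrightarrow> c = 1 \<or> c = -1"
  using root_system unfolding root_system_def by blast+

lemma simple_root: "b \<in> \<Delta> \<Longrightarrow> b \<in> \<Phi>" and independent_simple: "independent \<Delta>"
  and pos_or_neg: "b \<in> \<Phi> \<Longrightarrow> b \<in> nat_combs \<Delta> \<or> - b \<in> nat_combs \<Delta>"
  using simple_roots unfolding simple_roots_def by blast+

lemma root_nz: "a \<in> \<Phi> \<Longrightarrow> a \<noteq> 0"
  using zero_not_root by blast

lemma minus_root: "a \<in> \<Phi> \<Longrightarrow> - a \<in> \<Phi>"
  using refl_root[of a a] refl_self root_nz by metis

lemma finite_simple: "finite \<Delta>"
  using independent_simple by (rule independent_imp_finite)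

lemma pos_root: "a \<in> \<Phi>\<^sub>+ \<Longrightarrow> a \<in> \<Phi>"
  by (simp add: pos_roots_def)

lemma pos_nz: "a \<in> \<Phi>\<^sub>+ \<Longrightarrow> a \<noteq> 0"
  using pos_root root_nz by blast

lemma finite_pos: "finite \<Phi>\<^sub>+"
  using finite_roots by (simp add: pos_roots_def)

lemma root_cases: "a \<in> \<Phi> \<Longrightarrow> a \<in> \<Phi>\<^sub>+ \<or> - a \<in> \<Phi>\<^sub>+"
  using pos_or_neg minus_root by (auto simp: pos_roots_def)

lemma simple_pos: "b \<in> \<Delta> \<Longrightarrow> b \<in> \<Phi>\<^sub>+"
  using nat_combs_multiple[OF finite_simple, of b 1] simple_root by (auto simp: pos_roots_def)

text \<open>A functional with the prescribed values exists by independence;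
  \<open>adjoint g 1\<close> is the vector representing it.\<close>

lemma dual_vector: "\<exists>x. \<forall>b\<in>\<Delta>. x \<bullet> b = \<phi> b"
proof -
  obtain g :: "'a \<Rightarrow> real" where g: "linear g" "\<forall>b\<in>\<Delta>. g b = \<phi> b"
    using linear_independent_extend[OF independent_simple] by blast
  have "adjoint g 1 \<bullet> b = g b" for b
    using adjoint_works[OF g(1), of b 1] by (simp add: inner_commute)
  then show ?thesis using g(2) by metis
qed

lemma coord_vector:
  obtains d where "\<And>b'. b' \<in> \<Delta> \<Longrightarrow> d \<bullet> b' = (if b' = b then 1 else 0)"
  using dual_vector[of "\<lambda>b'. if b' = b then 1 else 0"] by blast

text \<open>The inner product with this vector is the height of a root, the sum of its simple
  coefficients.\<close>

definition htv :: 'a where "htv = (SOME x. \<forall>b\<in>\<Delta>. x \<bullet> b = 1)"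

lemma htv_simple: "b \<in> \<Delta> \<Longrightarrow> htv \<bullet> b = 1"
  using someI_ex[OF dual_vector[of "\<lambda>_. 1"]] unfolding htv_def by blast

lemma nat_combs_ht:
  assumes "x \<in> nat_combs \<Delta>" "x \<noteq> 0" shows "htv \<bullet> x > 0"
  by (rule nat_combs_inner_pos[OF finite_simple assms]) (simp add: htv_simple)

lemma pos_ht: "a \<in> \<Phi>\<^sub>+ \<Longrightarrow> htv \<bullet> a > 0"
  using nat_combs_ht pos_nz by (auto simp: pos_roots_def)

lemma pos_not_neg: "a \<in> \<Phi>\<^sub>+ \<Longrightarrow> - a \<notin> \<Phi>\<^sub>+"
  using pos_ht[of a] pos_ht[of "- a"] by auto

lemma not_pos_iff: "a \<in> \<Phi> \<Longrightarrow> a \<notin> \<Phi>\<^sub>+ \<longleftrightarrow> - a \<in> \<Phi>\<^sub>+"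
  using root_cases pos_not_neg[of "- a"] by auto

lemma pos_proportional:
  assumes "a \<in> \<Phi>\<^sub>+" "b \<in> \<Phi>\<^sub>+" "b = c *\<^sub>R a" shows "a = b"
  using reduced[of a c] assms pos_root pos_not_neg by fastforce

text \<open>If \<open>b\<close> were the only simple root occurring in \<open>a\<close>, then
  \<open>a\<close> would be a multiple of \<open>b\<close>. The vector \<open>d\<close> reads off
  the coordinate at \<open>b'\<close>.\<close>

lemma pos_coord:
  assumes "a \<in> \<Phi>\<^sub>+" "b \<in> \<Delta>" "a \<noteq> b"
  obtains b' d where "b' \<in> \<Delta>" "b' \<noteq> b" "\<And>x. x \<in> \<Delta> \<Longrightarrow> d \<bullet> x = (if x = b' then 1 else 0)" "d \<bullet> a > 0"
proof -
  obtain c where c: "a = (\<Sum>b\<in>\<Delta>. of_nat (c b) *\<^sub>R b)"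
    using assms(1) unfolding nat_combs_def pos_roots_def by blast
  have "\<exists>b'\<in>\<Delta>. b' \<noteq> b \<and> c b' \<noteq> 0"
  proof (rule ccontr)
    assume "\<not> ?thesis"
    then have "(\<Sum>x\<in>\<Delta> - {b}. of_nat (c x) *\<^sub>R x) = 0" by (intro sum.neutral) auto
    then have "a = of_nat (c b) *\<^sub>R b"
      using c sum.remove[OF finite_simple assms(2), of "\<lambda>x. of_nat (c x) *\<^sub>R x"] by simp
    from pos_proportional[OF simple_pos[OF assms(2)] assms(1) this] show False
      using assms(3) by simp
  qed
  then obtain b' where b': "b' \<in> \<Delta>" "b' \<noteq> b" "c b' \<noteq> 0" by blast
  obtain d where d: "\<And>x. x \<in> \<Delta> \<Longrightarrow> d \<bullet> x = (if x = b' then 1 else 0)" using coord_vector by blast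
  have "d \<bullet> a = (\<Sum>x\<in>\<Delta>. real (c x) * (if x = b' then 1 else 0))"
    using c d by (simp add: inner_sum_right)
  then have "d \<bullet> a = real (c b')" using b'(1) finite_simple by (simp add: sum.delta' mult_if_delta if_distrib cong: if_cong)
  then show thesis using that[OF b'(1,2) d] b'(3) by simp
qed

text \<open>The reflection in \<open>b\<close> changes the coordinate at \<open>b\<close> only, so a
  positive coordinate elsewhere survives and excludes a negative root.\<close>

lemma simple_refl_pos:
  assumes "a \<in> \<Phi>\<^sub>+" "b \<in> \<Delta>" "a \<noteq> b" shows "rfl b a \<in> \<Phi>\<^sub>+"
proof -
  obtain b' d where d: "b' \<in> \<Delta>" "b' \<noteq> b" "\<And>x. x \<in> \<Delta> \<Longrightarrow> d \<bullet> x = (if x = b' then 1 else 0)" "d \<bullet> a > 0"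
    using pos_coord[OF assms] by blast
  have r: "rfl b a \<in> \<Phi>" using refl_root simple_root pos_root assms by blast
  have "d \<bullet> rfl b a > 0" using d assms(2) by (simp add: refl_aff_zero inner_diff_right)
  then have "- rfl b a \<notin> nat_combs \<Delta>" using nat_combs_nonneg[of "- rfl b a" \<Delta> d] d(3) by fastforce
  then show ?thesis using r pos_or_neg[OF r] by (simp add: pos_roots_def)
qed

lemma pos_descent:
  assumes "a \<in> \<Phi>\<^sub>+" obtains b where "b \<in> \<Delta>" "a \<bullet> b > 0"
proof -
  obtain c where c: "a = (\<Sum>b\<in>\<Delta>. of_nat (c b) *\<^sub>R b)"
    using assms(1) unfolding nat_combs_def pos_roots_def by blast
  have "a \<bullet> a = (\<Sum>b\<in>\<Delta>. of_nat (c b) * (a \<bullet> b))" by (subst (2) c) (simp add: inner_sum_right)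
  moreover have "a \<bullet> a > 0" using pos_nz[OF assms] by simp
  ultimately have "\<exists>b\<in>\<Delta>. of_nat (c b) * (a \<bullet> b) > 0"
    using sum_nonpos[of \<Delta> "\<lambda>b. of_nat (c b) * (a \<bullet> b)"] by fastforce
  then obtain b where "b \<in> \<Delta>" "of_nat (c b) * (a \<bullet> b) > 0" by blast
  then show thesis using that[of b] by (simp add: zero_less_mult_iff)
qed

lemma pairing_pos_iff: "a \<noteq> 0 \<Longrightarrow> pairing x a > 0 \<longleftrightarrow> x \<bullet> a > 0"
  and pairing_neg_iff: "a \<noteq> 0 \<Longrightarrow> pairing x a < 0 \<longleftrightarrow> x \<bullet> a < 0"
proof -
  assume "a \<noteq> 0"
  then have "a \<bullet> a > 0" by simp
  then show "pairing x a > 0 \<longleftrightarrow> x \<bullet> a > 0" "pairing x a < 0 \<longleftrightarrow> x \<bullet> a < 0"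
    by (auto simp: pairing_def zero_less_divide_iff divide_less_0_iff simp del: inner_gt_zero_iff)
qed

text \<open>Every positive root has positive inner product with some simple root, and reflecting in
  it lowers the height unless the root is that simple root. The induction reads this descent
  backwards.\<close>

lemma pos_induct [consumes 1, case_names simple refl]:
  assumes "a \<in> \<Phi>\<^sub>+" "\<And>b. b \<in> \<Delta> \<Longrightarrow> P b"
    and refl: "\<And>a b. a \<in> \<Phi>\<^sub>+ \<Longrightarrow> b \<in> \<Delta> \<Longrightarrow> a \<bullet> b < 0 \<Longrightarrow> P a \<Longrightarrow> P (rfl b a)"
  shows "P a"
proof (rule finite_real_induct[where Q = "\<lambda>a. a \<in> \<Phi>\<^sub>+" and f = "\<lambda>a. htv \<bullet> a"])
  show "finite {y \<in> \<Phi>\<^sub>+. htv \<bullet> y < htv \<bullet> a}" using finite_pos by simp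
  fix x assume x: "x \<in> \<Phi>\<^sub>+" "\<And>y. y \<in> \<Phi>\<^sub>+ \<Longrightarrow> htv \<bullet> y < htv \<bullet> x \<Longrightarrow> P y"
  obtain b where b: "b \<in> \<Delta>" "x \<bullet> b > 0" using pos_descent[OF x(1)] .
  have bnz: "b \<noteq> 0" using b simple_root root_nz by blast
  show "P x"
  proof (cases "x = b")
    case False
    have y: "rfl b x \<in> \<Phi>\<^sub>+" using simple_refl_pos[OF x(1) b(1) False] .
    have "htv \<bullet> rfl b x < htv \<bullet> x"
      using b bnz pairing_pos_iff[of b x] htv_simple by (simp add: refl_aff_zero inner_diff_right)
    then have "P (rfl b x)" using x(2) y by blast
    moreover have "rfl b x \<bullet> b < 0"
      using b bnz pairing_pos_iff[of b x]
        by (simp add: refl_aff_zero inner_diff_left pairing_def)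
    ultimately have "P (rfl b (rfl b x))" using refl y b by blast
    then show ?thesis using refl_aff_involution[OF bnz, of 0] by (simp add: fun_eq_iff)
  qed (use assms(2) b in simp)
qed (use assms in auto)

text \<open>In the inductive step the coroot of \<open>a\<close> gains the multiple
  \<open>- pairing b a\<close> of \<open>coroot b\<close>, which is a nonnegative integer because
  \<open>a \<bullet> b < 0\<close>.\<close>

lemma coroot_pos: "a \<in> \<Phi>\<^sub>+ \<Longrightarrow> coroot a \<in> nat_combs (coroot ` \<Delta>)"
proof (induction rule: pos_induct)
  case (simple b)
  then show ?case using nat_combs_multiple[of "coroot ` \<Delta>" "coroot b" 1] finite_simple by simp
next
  case (refl a b)
  have nz: "a \<noteq> 0" "b \<noteq> 0" using refl pos_nz simple_pos by auto
  have "pairing b a \<in> \<int>" using pairing_root_Ints refl pos_root simple_root by blast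
  then obtain k :: int where k: "pairing b a = of_int k" by (auto simp: Ints_def)
  have "pairing b a < 0" using pairing_neg_iff[OF nz(1), of b] refl by (simp add: inner_commute)
  then have k': "- pairing b a = real (nat (- k))" using k by simp
  have "coroot (rfl b a) = coroot a + (- pairing b a) *\<^sub>R coroot b"
    unfolding orthogonal_coroot[OF orthogonal_refl[OF nz(2)]]
    by (simp add: refl_aff_zero pairing_def coroot_def inner_commute)
  then show ?case
    using nat_combs_add[OF refl.IH nat_combs_multiple[of "coroot ` \<Delta>" "coroot b" "nat (- k)"]]
      finite_simple refl k' by auto
qed

lemma pairing_nonneg_pos:
  assumes "a \<in> \<Phi>\<^sub>+" "\<And>b. b \<in> \<Delta> \<Longrightarrow> pairing x b \<ge> 0" shows "pairing x a \<ge> 0"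
  using nat_combs_nonneg[OF coroot_pos[OF assms(1)], of x] assms(2) by (auto simp: pairing_coroot)

end

section \<open>The dual root system\<close>

lemma coroot_coroot: "a \<noteq> 0 \<Longrightarrow> coroot (coroot a) = a"
  by (simp add: coroot_def field_simps)

lemma coroot_nz: "a \<noteq> 0 \<Longrightarrow> coroot a \<noteq> 0"
  by (simp add: coroot_def)

lemma pairing_coroot_coroot: "x \<noteq> 0 \<Longrightarrow> y \<noteq> 0 \<Longrightarrow> pairing (coroot x) (coroot y) = pairing y x"
  by (simp add: pairing_def coroot_def field_simps inner_commute)

lemma refl_coroot: "a \<noteq> 0 \<Longrightarrow> refl_aff (coroot a) 0 = refl_aff a 0"
  by (simp add: fun_eq_iff refl_aff_zero pairing_def coroot_def field_simps)

lemma coroot_scale: "coroot (c *\<^sub>R a) = (1 / c) *\<^sub>R coroot a"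
  by (cases "c = 0") (simp_all add: coroot_def field_simps)

lemma coroot_minus: "coroot (- a) = - coroot a"
  by (simp add: coroot_def)

context root_base begin

text \<open>The non-linear wall of the fundamental alcove is given by the highest root of the dual
  system, so results on roots must be available for coroots as well.\<close>

lemma dual_root_base: "root_base (coroot ` \<Phi>) (coroot ` \<Delta>)"
proof
  have sp: "a \<in> span (coroot ` \<Phi>)" if "a \<in> \<Phi>" for a
  proof -
    have "a = ((a \<bullet> a) / 2) *\<^sub>R coroot a" using root_nz[OF that] by (simp add: coroot_def)
    then show ?thesis using that by (metis imageI span_base span_mul)
  qed
  show "root_system (coroot ` \<Phi>)"
    unfolding root_system_def
  proof (intro conjI ballI allI impI)
    show "finite (coroot ` \<Phi>)" using finite_roots by simp
    show "0 \<notin> coroot ` \<Phi>" using coroot_nz root_nz by (metis imageE)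
    show "span (coroot ` \<Phi>) = UNIV"
      using sp span_roots span_minimal[of \<Phi> "span (coroot ` \<Phi>)"] by auto
  next
    fix a b assume "a \<in> coroot ` \<Phi>" "b \<in> coroot ` \<Phi>"
    then obtain x y where xy: "a = coroot x" "b = coroot y" "x \<in> \<Phi>" "y \<in> \<Phi>" by blast
    then show "refl_aff a 0 b \<in> coroot ` \<Phi>"
      using refl_coroot root_nz orthogonal_coroot[OF orthogonal_refl[of x], of y] refl_root by (metis imageI)
    show "pairing b a \<in> \<int>"
      using xy pairing_coroot_coroot root_nz pairing_root_Ints by metis
  next
    fix a c assume "a \<in> coroot ` \<Phi>" "c *\<^sub>R a \<in> coroot ` \<Phi>"
    then obtain x y where xy: "a = coroot x" "c *\<^sub>R a = coroot y" "x \<in> \<Phi>" "y \<in> \<Phi>" by blast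
    then have "coroot (c *\<^sub>R coroot x) = y" using coroot_coroot root_nz by metis
    then have "(1 / c) *\<^sub>R x = y" using coroot_scale coroot_coroot root_nz xy by metis
    then have "1 / c = 1 \<or> 1 / c = -1" using reduced[of x "1 / c"] xy by blast
    then show "c = 1 \<or> c = - 1" by (cases "c = 0") (auto simp: divide_eq_eq)
  qed
  show "simple_roots (coroot ` \<Phi>) (coroot ` \<Delta>)"
    unfolding simple_roots_def
  proof (intro conjI ballI)
    show "coroot ` \<Delta> \<subseteq> coroot ` \<Phi>" using simple_root by blast
    show "independent (coroot ` \<Delta>)"
      unfolding dependent_def
    proof (clarify)
      fix b assume b: "b \<in> \<Delta>" "coroot b \<in> span (coroot ` \<Delta> - {coroot b})"
      obtain d where d: "\<And>b'. b' \<in> \<Delta> \<Longrightarrow> d \<bullet> b' = (if b' = b then 1 else 0)" using coord_vector by blast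
      have "coroot ` \<Delta> - {coroot b} \<subseteq> {x. d \<bullet> x = 0}" using d by (auto simp: coroot_def)
      then have "span (coroot ` \<Delta> - {coroot b}) \<subseteq> {x. d \<bullet> x = 0}"
        by (rule span_minimal) (rule subspace_hyperplane)
      then have "d \<bullet> coroot b = 0" using b by blast
      then show False using d[OF b(1)] simple_root[OF b(1)] root_nz by (simp add: coroot_def)
    qed
    fix a assume "a \<in> coroot ` \<Phi>"
    then obtain x where "a = coroot x" "x \<in> \<Phi>" by blast
    then show "a \<in> nat_combs (coroot ` \<Delta>) \<or> - a \<in> nat_combs (coroot ` \<Delta>)"
      using root_cases[of x] coroot_pos[of x] coroot_pos[of "- x"] by (auto simp: coroot_minus)
  qed
qed

text \<open>Both pairings are positive integers. If both were at least 2, then \<open>a - b\<close>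
  would have norm zero; so one of them is 1 and the corresponding reflection produces the difference
  up to sign.\<close>

lemma root_diff:
  assumes "a \<in> \<Phi>" "b \<in> \<Phi>" "a \<bullet> b > 0" "a \<noteq> b" shows "a - b \<in> \<Phi>"
proof -
  have nz: "a \<noteq> 0" "b \<noteq> 0" using assms root_nz by blast+
  obtain k l :: int where kl: "pairing a b = of_int k" "pairing b a = of_int l"
    using pairing_root_Ints assms by (metis Ints_cases)
  have pos: "k > 0" "l > 0"
    using kl pairing_pos_iff[of b a] pairing_pos_iff[of a b] nz assms(3) by (auto simp: inner_commute)
  have "k = 1 \<or> l = 1"
  proof (rule ccontr)
    assume "\<not> ?thesis"
    then have "k \<ge> 2" "l \<ge> 2" using pos by auto
    then have "of_int k * (b \<bullet> b) \<ge> 2 * (b \<bullet> b)" "of_int l * (a \<bullet> a) \<ge> 2 * (a \<bullet> a)"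
      by (intro mult_right_mono, simp_all)+
    moreover have "2 * (a \<bullet> b) = of_int k * (b \<bullet> b)" "2 * (a \<bullet> b) = of_int l * (a \<bullet> a)"
      using kl nz by (auto simp: pairing_def divide_eq_eq inner_commute)
    ultimately have "a \<bullet> b \<ge> b \<bullet> b" "a \<bullet> b \<ge> a \<bullet> a" by linarith+
    then have "(a - b) \<bullet> (a - b) \<le> 0" by (simp add: inner_diff_left inner_diff_right inner_commute)
    then show False using assms(4) by (metis inner_gt_zero_iff linorder_not_le right_minus_eq)
  qed
  then show ?thesis
  proof
    assume "k = 1"
    then show ?thesis using refl_root[OF assms(2,1)] kl by (simp add: refl_aff_zero)
  next
    assume "l = 1"
    then have "b - a \<in> \<Phi>" using refl_root[OF assms(1,2)] kl by (simp add: refl_aff_zero)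
    then show ?thesis using minus_root by fastforce
  qed
qed

end

section \<open>Irreducibility and the highest root\<close>

locale irreducible_base = root_base +
  assumes irreducible: "irreducible_root_system \<Phi>"
begin

lemma roots_nonempty: "\<Phi> \<noteq> {}"
  using irreducible unfolding irreducible_root_system_def by blast

lemma not_decomposable:
  assumes "\<Phi> = A \<union> B" "A \<inter> B = {}" "\<And>a b. a \<in> A \<Longrightarrow> b \<in> B \<Longrightarrow> a \<bullet> b = 0" "A \<noteq> {}"
  shows "B = {}"
  using irreducible assms unfolding irreducible_root_system_def by metis

text \<open>Otherwise \<open>a - b\<close> would be a root having simple coordinates of both
  signs.\<close>

lemma simple_inner_nonpos:
  assumes "a \<in> \<Delta>" "b \<in> \<Delta>" "a \<noteq> b" shows "a \<bullet> b \<le> 0"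
proof (rule ccontr)
  assume "\<not> ?thesis"
  then have r: "a - b \<in> \<Phi>" using root_diff simple_root assms by auto
  obtain d e where d: "\<And>x. x \<in> \<Delta> \<Longrightarrow> d \<bullet> x = (if x = a then 1 else 0)"
    and e: "\<And>x. x \<in> \<Delta> \<Longrightarrow> e \<bullet> x = (if x = b then 1 else 0)"
    using coord_vector by metis
  have "d \<bullet> (a - b) = 1" "e \<bullet> (a - b) = -1" using d e assms by (auto simp: inner_diff_right)
  moreover have "e \<bullet> (a - b) \<ge> 0 \<or> d \<bullet> (- (a - b)) \<ge> 0"
    using pos_or_neg[OF r]
  proof
    assume "a - b \<in> nat_combs \<Delta>"
    then have "e \<bullet> (a - b) \<ge> 0" by (rule nat_combs_nonneg) (simp add: e)
    then show ?thesis ..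
  next
    assume "- (a - b) \<in> nat_combs \<Delta>"
    then have "d \<bullet> (- (a - b)) \<ge> 0" by (rule nat_combs_nonneg) (simp add: d)
    then show ?thesis ..
  qed
  ultimately show False by (simp add: inner_diff_right)
qed

text \<open>A root reached by \<open>pos_induct\<close> stays in one of the two spans, because the
  reflecting simple root is not orthogonal to it. A splitting of the simple roots thus splits all
  roots.\<close>

lemma simple_connected:
  assumes "A \<union> B = \<Delta>" "A \<noteq> {}" "\<And>a b. a \<in> A \<Longrightarrow> b \<in> B \<Longrightarrow> a \<bullet> b = 0"
  shows "B = {}"
proof -
  have orth: "x \<bullet> y = 0" if "x \<in> span A" "y \<in> span B" for x y
  proof -
    have "A \<subseteq> {x. \<forall>b\<in>B. x \<bullet> b = 0}" using assms(3) by blast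
    then have "span A \<subseteq> {x. \<forall>b\<in>B. x \<bullet> b = 0}"
      by (rule span_minimal) (auto simp: subspace_def inner_add_left)
    then have "B \<subseteq> {y. x \<bullet> y = 0}" using that by auto
    then have "span B \<subseteq> {y. x \<bullet> y = 0}" by (rule span_minimal) (rule subspace_hyperplane)
    then show ?thesis using that by blast
  qed
  have "a \<in> span A \<or> a \<in> span B" if "a \<in> \<Phi>\<^sub>+" for a
    using that
  proof (induction rule: pos_induct)
    case (simple b)
    then show ?case using assms(1) span_base by auto
  next
    case (refl a b)
    have "b \<in> span A \<or> b \<in> span B" using refl assms(1) span_base by auto
    moreover have "a \<bullet> b \<noteq> 0" using refl by simp
    ultimately have "(a \<in> span A \<and> b \<in> span A) \<or> (a \<in> span B \<and> b \<in> span B)"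
      using refl orth inner_commute by metis
    then show ?case by (auto simp: refl_aff_zero span_diff span_mul)
  qed
  then have cover: "a \<in> span A \<or> a \<in> span B" if "a \<in> \<Phi>" for a
    using root_cases[OF that] span_neg by fastforce
  have "\<Phi> \<inter> span B = {}"
  proof (rule not_decomposable[of "\<Phi> \<inter> span A"])
    show "\<Phi> = \<Phi> \<inter> span A \<union> \<Phi> \<inter> span B" using cover by blast
    show "\<Phi> \<inter> span A \<inter> (\<Phi> \<inter> span B) = {}"
    proof -
      have "a = 0" if "a \<in> span A" "a \<in> span B" for a using orth[OF that] by simp
      then show ?thesis using root_nz by blast
    qed
    show "\<Phi> \<inter> span A \<noteq> {}" using assms(1,2) simple_root span_base by blast
  qed (use orth in auto)
  then show ?thesis using assms(1) simple_root span_base by blast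
qed

text \<open>Every root lies below a maximal one. Maximal roots are dominant, and by irreducibility
  they involve every simple root. Two distinct ones would therefore have positive inner product, and
  their difference would be a root, making them comparable.\<close>

lemma highest_root_exists:
  obtains \<theta> where "\<theta> \<in> \<Phi>" "\<And>b. b \<in> \<Phi> \<Longrightarrow> \<theta> - b \<in> nat_combs \<Delta>"
proof -
  define mx where "mx t \<longleftrightarrow> t \<in> \<Phi> \<and> (\<forall>b\<in>\<Phi>. b - t \<in> nat_combs \<Delta> \<longrightarrow> b = t)" for t
  have above: "\<exists>t. mx t \<and> t - b \<in> nat_combs \<Delta>" if b: "b \<in> \<Phi>" for b
  proof (rule finite_real_induct[where Q = "\<lambda>b. b \<in> \<Phi>" and f = "\<lambda>b. - (htv \<bullet> b)"])
    fix x assume less: "x \<in> \<Phi>" "\<And>y. y \<in> \<Phi> \<Longrightarrow> - (htv \<bullet> y) < - (htv \<bullet> x) \<Longrightarrow> \<exists>t. mx t \<and> t - y \<in> nat_combs \<Delta>"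
    show "\<exists>t. mx t \<and> t - x \<in> nat_combs \<Delta>"
    proof (cases "mx x")
      case True
      then show ?thesis using nat_combs_0 by (intro exI[of _ x]) simp
    next
      case False
      then obtain y where y: "y \<in> \<Phi>" "y - x \<in> nat_combs \<Delta>" "y \<noteq> x" using less(1) mx_def by blast
      have "htv \<bullet> (y - x) > 0" using nat_combs_ht[OF y(2)] y(3) by simp
      then have "- (htv \<bullet> y) < - (htv \<bullet> x)" by (simp add: inner_diff_right)
      then obtain t where t: "mx t" "t - y \<in> nat_combs \<Delta>" using less(2)[OF y(1)] by blast
      then show ?thesis using nat_combs_add[OF t(2) y(2)] by (intro exI[of _ t]) simp
    qed
  qed (use finite_roots b in simp_all)
  have dominant: "t \<bullet> b \<ge> 0" if t: "mx t" and b: "b \<in> \<Delta>" for t b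
  proof (rule ccontr)
    assume neg: "\<not> t \<bullet> b \<ge> 0"
    have tr: "t \<in> \<Phi>" using t mx_def by blast
    obtain k :: int where k: "pairing t b = of_int k"
      using pairing_root_Ints[OF simple_root[OF b] tr] by (auto simp: Ints_def)
    have "pairing t b < 0" using neg pairing_neg_iff[OF root_nz[OF simple_root[OF b]], of t] by simp
    then have "rfl b t - t = real (nat (- k)) *\<^sub>R b" "k < 0"
      using k by (auto simp: refl_aff_zero)
    then have "rfl b t - t \<in> nat_combs \<Delta>" "rfl b t - t \<noteq> 0"
      using nat_combs_multiple[OF finite_simple b] root_nz[OF simple_root[OF b]] by (metis, simp)
    then have "rfl b t - t \<in> nat_combs \<Delta>" "rfl b t \<noteq> t" by auto
    then show False using t refl_root[OF simple_root[OF b] tr] unfolding mx_def by blast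
  qed
  have mx_pos: "t \<in> \<Phi>\<^sub>+" if t: "mx t" for t
  proof -
    have tr: "t \<in> \<Phi>" using t mx_def by blast
    have "\<not> - t \<in> \<Phi>\<^sub>+"
    proof
      assume "- t \<in> \<Phi>\<^sub>+"
      then obtain b where "b \<in> \<Delta>" "- t \<bullet> b > 0" using pos_descent by blast
      then show False using dominant[OF t] by fastforce
    qed
    then show ?thesis using root_cases[OF tr] by blast
  qed
  have full: "\<exists>c. t = (\<Sum>b\<in>\<Delta>. of_nat (c b) *\<^sub>R b) \<and> (\<forall>b\<in>\<Delta>. c b \<noteq> (0::nat))" if t: "mx t" for t
  proof -
    obtain c where c: "t = (\<Sum>b\<in>\<Delta>. of_nat (c b) *\<^sub>R b)"
      using mx_pos[OF t] unfolding pos_roots_def nat_combs_def by blast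
    \<comment> \<open>Dominance of \<open>t\<close> and nonpositive inner products between simple
      roots make every simple root outside the support orthogonal to the support.\<close>
    have "{b \<in> \<Delta>. c b = 0} = {}"
    proof (rule simple_connected[of "{b \<in> \<Delta>. c b \<noteq> 0}"])
      show "{b \<in> \<Delta>. c b \<noteq> 0} \<noteq> {}"
      proof
        assume "{b \<in> \<Delta>. c b \<noteq> 0} = {}"
        then have "t = 0" unfolding c by (intro sum.neutral) auto
        then show False using mx_pos[OF t] pos_nz by blast
      qed
      fix a b assume ab: "a \<in> {b \<in> \<Delta>. c b \<noteq> 0}" "b \<in> {b \<in> \<Delta>. c b = 0}"
      have le: "of_nat (c x) * (x \<bullet> b) \<le> 0" if "x \<in> \<Delta>" for x
        using simple_inner_nonpos[OF that, of b] ab that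
        by (cases "x = b") (auto simp: mult_nonneg_nonpos)
      have "t \<bullet> b = (\<Sum>x\<in>\<Delta>. of_nat (c x) * (x \<bullet> b))" by (subst c) (simp add: inner_sum_left)
      then have "(\<Sum>x\<in>\<Delta>. of_nat (c x) * (x \<bullet> b)) = 0"
        using dominant[OF t, of b] ab sum_nonpos[of \<Delta> "\<lambda>x. of_nat (c x) * (x \<bullet> b)"] le by fastforce
      then have "\<forall>x\<in>\<Delta>. of_nat (c x) * (x \<bullet> b) = 0"
        using sum_nonneg_eq_0_iff[OF finite_simple, of "\<lambda>x. - (of_nat (c x) * (x \<bullet> b))"] le
        by (simp add: sum_negf)
      then show "a \<bullet> b = 0" using ab by auto
    qed auto
    then have "\<forall>b\<in>\<Delta>. c b \<noteq> 0" by auto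
    with c show ?thesis by (intro exI[of _ c] conjI)
  qed
  have unique: "t = t'" if t: "mx t" and t': "mx t'" for t t'
  proof (rule ccontr)
    assume ne: "t \<noteq> t'"
    have r: "t \<in> \<Phi>" "t' \<in> \<Phi>" using t t' mx_def by blast+
    obtain c where c: "t = (\<Sum>b\<in>\<Delta>. of_nat (c b) *\<^sub>R b)" "\<forall>b\<in>\<Delta>. c b \<noteq> (0::nat)"
      using full[OF t] by metis
    obtain b0 where b0: "b0 \<in> \<Delta>" "t' \<bullet> b0 > 0" using pos_descent[OF mx_pos[OF t']] .
    have "t' \<bullet> t = (\<Sum>x\<in>\<Delta>. of_nat (c x) * (t' \<bullet> x))" by (subst c(1)) (simp add: inner_sum_right)
    also have "\<dots> > 0"
      using b0 c(2) dominant[OF t'] finite_simple by (intro sum_pos2[of _ b0]) auto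
    finally have "t - t' \<in> \<Phi>" using root_diff[OF r _ ne] by (simp add: inner_commute)
    then have "t - t' \<in> nat_combs \<Delta> \<or> t' - t \<in> nat_combs \<Delta>" using pos_or_neg by fastforce
    then show False using t t' r ne unfolding mx_def by blast
  qed
  obtain b0 where "b0 \<in> \<Phi>" using roots_nonempty by blast
  then obtain t where t: "mx t" using above by blast
  show thesis
  proof (rule that[of t])
    show "t \<in> \<Phi>" using t mx_def by blast
    show "t - b \<in> nat_combs \<Delta>" if "b \<in> \<Phi>" for b using above[OF that] unique[OF t] by blast
  qed
qed

lemma highest_root: "highest_root \<Phi> \<Delta> \<in> \<Phi>" "b \<in> \<Phi> \<Longrightarrow> highest_root \<Phi> \<Delta> - b \<in> nat_combs \<Delta>"
proof -
  obtain \<theta> where th: "\<theta> \<in> \<Phi>" "\<And>b. b \<in> \<Phi> \<Longrightarrow> \<theta> - b \<in> nat_combs \<Delta>"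
    using highest_root_exists by blast
  have "highest_root \<Phi> \<Delta> = \<theta>"
    unfolding highest_root_def
  proof (rule the_equality)
    fix t assume t: "t \<in> \<Phi> \<and> (\<forall>b\<in>\<Phi>. t - b \<in> nat_combs \<Delta>)"
    show "t = \<theta>"
    proof (rule ccontr)
      assume "t \<noteq> \<theta>"
      then have "htv \<bullet> (t - \<theta>) > 0" "htv \<bullet> (\<theta> - t) > 0"
        using nat_combs_ht t th by auto
      then show False by (simp add: inner_diff_right)
    qed
  qed (use th in auto)
  then show "highest_root \<Phi> \<Delta> \<in> \<Phi>" "b \<in> \<Phi> \<Longrightarrow> highest_root \<Phi> \<Delta> - b \<in> nat_combs \<Delta>"
    using th by simp_all
qed

lemma dual_irreducible_base: "irreducible_base (coroot ` \<Phi>) (coroot ` \<Delta>)"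
proof -
  interpret dual: root_base "coroot ` \<Phi>" "coroot ` \<Delta>" by (rule dual_root_base)
  have "irreducible_root_system (coroot ` \<Phi>)"
    unfolding irreducible_root_system_def
  proof (intro conjI notI)
    show "root_system (coroot ` \<Phi>)" by (rule dual.root_system)
    assume "coroot ` \<Phi> = {}" then show False using roots_nonempty by blast
  next
    assume "\<exists>A B. A \<noteq> {} \<and> B \<noteq> {} \<and> coroot ` \<Phi> = A \<union> B \<and> A \<inter> B = {} \<and> (\<forall>a\<in>A. \<forall>b\<in>B. a \<bullet> b = 0)"
    then obtain A B where AB: "A \<noteq> {}" "B \<noteq> {}" "coroot ` \<Phi> = A \<union> B" "A \<inter> B = {}"
      "\<forall>a\<in>A. \<forall>b\<in>B. a \<bullet> b = 0" by (elim exE conjE)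
    have cover: "coroot a \<in> A \<or> coroot a \<in> B" if "a \<in> \<Phi>" for a
      using imageI[OF that, of coroot] AB(3) by simp
    have "\<exists>a\<in>\<Phi>. coroot a \<in> C" if "C \<noteq> {}" "C \<subseteq> A \<union> B" for C
      using that unfolding AB(3)[symmetric] by auto
    from this[OF AB(1)] this[OF AB(2)]
    obtain a b where ab: "coroot a \<in> A" "a \<in> \<Phi>" "coroot b \<in> B" "b \<in> \<Phi>" by auto
    have "{a \<in> \<Phi>. coroot a \<in> B} = {}"
    proof (rule not_decomposable[of "{a \<in> \<Phi>. coroot a \<in> A}"])
      show "\<Phi> = {a \<in> \<Phi>. coroot a \<in> A} \<union> {a \<in> \<Phi>. coroot a \<in> B}" using cover by auto
      show "{a \<in> \<Phi>. coroot a \<in> A} \<inter> {a \<in> \<Phi>. coroot a \<in> B} = {}" using AB(4) by blast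
      show "{a \<in> \<Phi>. coroot a \<in> A} \<noteq> {}" using ab by auto
      fix a b assume "a \<in> {a \<in> \<Phi>. coroot a \<in> A}" "b \<in> {a \<in> \<Phi>. coroot a \<in> B}"
      then have "a \<noteq> 0" "b \<noteq> 0" "coroot a \<bullet> coroot b = 0" using AB(5) zero_not_root by auto
      then show "a \<bullet> b = 0" by (simp add: coroot_def)
    qed
    then show False using ab by auto
  qed
  then show ?thesis by unfold_locales
qed

abbreviation \<theta> :: 'a where "\<theta> \<equiv> alpha_tilde \<Phi> \<Delta>"

lemma theta_root: "\<theta> \<in> \<Phi>"
  and theta_highest: "a \<in> \<Phi> \<Longrightarrow> coroot \<theta> - coroot a \<in> nat_combs (coroot ` \<Delta>)"
proof -
  interpret dual: irreducible_base "coroot ` \<Phi>" "coroot ` \<Delta>" by (rule dual_irreducible_base)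
  obtain t where t: "t \<in> \<Phi>" "coroot t = highest_root (coroot ` \<Phi>) (coroot ` \<Delta>)"
    using dual.highest_root(1) by (metis imageE)
  have "\<theta> = t"
    unfolding alpha_tilde_def
  proof (rule the_equality)
    fix a assume a: "a \<in> \<Phi> \<and> coroot a = highest_root (coroot ` \<Phi>) (coroot ` \<Delta>)"
    then have "coroot (coroot a) = coroot (coroot t)" using t(2) by simp
    moreover have "a \<noteq> 0" "t \<noteq> 0" using a t(1) root_nz by blast+
    ultimately show "a = t" by (simp add: coroot_coroot)
  qed (use t in simp)
  then show "\<theta> \<in> \<Phi>" "a \<in> \<Phi> \<Longrightarrow> coroot \<theta> - coroot a \<in> nat_combs (coroot ` \<Delta>)"
    using t dual.highest_root(2) by auto
qed

end

section \<open>The affine Weyl group\<close>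

lemma gen_group_involutions:
  assumes "\<And>x. x \<in> X \<Longrightarrow> x \<circ> x = id"
  shows "gen_group X = {wprod ws | ws. set ws \<subseteq> X}"
proof (intro equalityI subsetI)
  fix w assume "w \<in> gen_group X"
  then show "w \<in> {wprod ws | ws. set ws \<subseteq> X}"
  proof (induction rule: gen_group.induct)
    case one
    have "id = wprod []" "set [] \<subseteq> X" by simp_all
    then show ?case by blast
  next
    case (gen x w)
    then obtain ws where "w = wprod ws" "set ws \<subseteq> X" by blast
    then have "x \<circ> w = wprod (x # ws)" "set (x # ws) \<subseteq> X" using gen by auto
    then show ?case by blast
  next
    case (inv x w)
    then obtain ws where "w = wprod ws" "set ws \<subseteq> X" by blast
    then have "inv x \<circ> w = wprod (x # ws)" "set (x # ws) \<subseteq> X"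
      using inv(1) involution_inv[OF assms[OF inv(1)]] by auto
    then show ?case by blast
  qed
next
  fix w assume "w \<in> {wprod ws | ws. set ws \<subseteq> X}"
  then obtain ws where ws: "w = wprod ws" "set ws \<subseteq> X" by blast
  have "wprod ws \<in> gen_group X" using ws(2)
  proof (induction ws)
    case Nil
    show "wprod [] \<in> gen_group X" using gen_group.one by simp
  next
    case (Cons x ws)
    then have "x \<in> X" "wprod ws \<in> gen_group X" by auto
    then show "wprod (x # ws) \<in> gen_group X" using gen_group.gen by simp
  qed
  then show "w \<in> gen_group X" using ws by simp
qed

lemma gen_group_mono: "X \<subseteq> Y \<Longrightarrow> w \<in> gen_group X \<Longrightarrow> w \<in> gen_group Y"
  by (rotate_tac, induction rule: gen_group.induct) (auto intro: gen_group.intros)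

lemma gen_group_comp: "x \<in> gen_group X \<Longrightarrow> y \<in> gen_group X \<Longrightarrow> x \<circ> y \<in> gen_group X"
proof (induction rule: gen_group.induct)
  case one
  then show "id \<circ> y \<in> gen_group X" by simp
next
  case (gen x w)
  have "w \<circ> y \<in> gen_group X" using gen.IH[OF gen.prems] .
  then show "x \<circ> w \<circ> y \<in> gen_group X"
    using gen_group.gen[OF gen.hyps(1)] unfolding comp_assoc by blast
next
  case (inv x w)
  have "w \<circ> y \<in> gen_group X" using inv.IH[OF inv.prems] .
  then show "inv x \<circ> w \<circ> y \<in> gen_group X"
    using gen_group.inv[OF inv.hyps(1)] unfolding comp_assoc by blast
qed

lemma gen_group_base: "x \<in> X \<Longrightarrow> x \<in> gen_group X"
  using gen_group.gen[OF _ gen_group.one, of x X] by simp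

lemma same_int_interval:
  fixes x y :: real and k n :: int
  assumes "of_int k < x" "x < of_int k + 1" "of_int k < y" "y < of_int k + 1"
  shows "(x - of_int n) * (y - of_int n) > 0"
proof (cases "n \<le> k")
  case True
  then have "of_int n \<le> (of_int k :: real)" by simp
  then show ?thesis using assms by (intro mult_pos_pos) auto
next
  case False
  then have "of_int k + 1 \<le> (of_int n :: real)" by linarith
  then show ?thesis using assms by (intro mult_neg_neg) auto
qed

lemma transl_comp: "transl x \<circ> transl y = transl (x + y)"
  by (simp add: fun_eq_iff transl_def)

lemma transl_0 [simp]: "transl 0 = id"
  by (simp add: fun_eq_iff transl_def)

lemma linear_transl: "linear u \<Longrightarrow> u \<circ> transl x = transl (u x) \<circ> u"
  by (simp add: fun_eq_iff transl_def linear_add)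

lemma bij_transl: "bij (transl x)"
  by (rule o_bij[of "transl (- x)"]) (simp_all add: transl_comp)

definition lin :: "('a::euclidean_space \<Rightarrow> 'a) \<Rightarrow> 'a \<Rightarrow> 'a" where
  "lin g x = g x - g 0"

section \<open>The finite Weyl group and its extension by integral translations\<close>

context irreducible_base begin

text \<open>\<open>W0\<close> is given as a stabiliser; generators are needed for inductions. The
  two agree by \<open>W0_eq\<close>.\<close>

definition Wf :: "('a \<Rightarrow> 'a) set" where "Wf = gen_group {rfl a | a. a \<in> \<Phi>}"

lemma Wf_words: "Wf = {wprod ws | ws. set ws \<subseteq> {rfl a | a. a \<in> \<Phi>}}"
  unfolding Wf_def by (rule gen_group_involutions) (use refl_aff_involution root_nz in blast)

lemma Wa_words: "Wa \<Phi> = {wprod ws | ws. set ws \<subseteq> {refl_aff a n | a n. a \<in> \<Phi>}}"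
  unfolding Wa_def by (rule gen_group_involutions) (use refl_aff_involution root_nz in blast)

lemma refl_in_Wf: "a \<in> \<Phi> \<Longrightarrow> rfl a \<in> Wf"
  unfolding Wf_def by (rule gen_group_base) blast

lemma refl_in_Wa: "a \<in> \<Phi> \<Longrightarrow> refl_aff a n \<in> Wa \<Phi>"
  unfolding Wa_def by (rule gen_group_base) blast

lemma Wf_induct [consumes 1, case_names id refl]:
  assumes "u \<in> Wf" "P id" "\<And>a u. a \<in> \<Phi> \<Longrightarrow> u \<in> Wf \<Longrightarrow> P u \<Longrightarrow> P (rfl a \<circ> u)"
  shows "P u"
  using assms(1) unfolding Wf_def
proof (induction rule: gen_group.induct)
  case (inv x w)
  then obtain a where "x = rfl a" "a \<in> \<Phi>" by blast
  then have "inv x = rfl a" using involution_inv[OF refl_aff_involution[OF root_nz]] by blast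
  then show "P (inv x \<circ> w)" using assms(3)[of a w] inv \<open>a \<in> \<Phi>\<close> unfolding Wf_def by simp
next
  case one
  show ?case by (rule assms(2))
next
  case (gen x w)
  then obtain a where "x = rfl a" "a \<in> \<Phi>" by blast
  then show "P (x \<circ> w)" using assms(3)[of a w] gen unfolding Wf_def by simp
qed

lemma Wf_comp: "u \<in> Wf \<Longrightarrow> v \<in> Wf \<Longrightarrow> u \<circ> v \<in> Wf"
  unfolding Wf_def by (rule gen_group_comp)

lemma id_Wf: "id \<in> Wf"
  unfolding Wf_def by (rule gen_group.one)

lemma Wf_orthogonal: "u \<in> Wf \<Longrightarrow> orthogonal_transformation u"
proof (induction rule: Wf_induct)
  case id
  then show ?case using orthogonal_transformation_id by (simp add: id_def)
next
  case (refl a u)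
  then show ?case using orthogonal_transformation_compose orthogonal_refl root_nz by blast
qed

lemma Wf_root: "u \<in> Wf \<Longrightarrow> a \<in> \<Phi> \<Longrightarrow> u a \<in> \<Phi>"
  by (induction rule: Wf_induct) (auto simp: refl_root)

lemma Wf_linear: "u \<in> Wf \<Longrightarrow> linear u"
  using Wf_orthogonal orthogonal_transformation_linear by blast

lemma Wf_bij: "u \<in> Wf \<Longrightarrow> bij u"
  using Wf_orthogonal orthogonal_transformation_bij by blast

lemma Wf_inv: "u \<in> Wf \<Longrightarrow> inv u \<in> Wf"
proof (induction rule: Wf_induct)
  case id
  show "inv id \<in> Wf" using id_Wf by simp
next
  case (refl a u)
  have "inv (rfl a \<circ> u) = inv u \<circ> rfl a"
    using o_inv_distrib[OF involution_bij Wf_bij[OF refl(2)]] involution_inv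
      refl_aff_involution[OF root_nz[OF refl(1)]] by metis
  then show "inv (rfl a \<circ> u) \<in> Wf" using Wf_comp[OF refl(3) refl_in_Wf[OF refl(1)]] by simp
qed

lemma Wf_0: "u \<in> Wf \<Longrightarrow> u 0 = 0"
  using Wf_linear linear_0 by blast

definition integral :: "'a \<Rightarrow> bool" where "integral m \<longleftrightarrow> (\<forall>a\<in>\<Phi>. pairing m a \<in> \<int>)"

lemma integral_0: "integral 0"
  and integral_add: "integral x \<Longrightarrow> integral y \<Longrightarrow> integral (x + y)"
  and integral_minus: "integral x \<Longrightarrow> integral (- x)"
  and integral_int: "integral x \<Longrightarrow> integral (of_int n *\<^sub>R x)"
  and integral_root: "a \<in> \<Phi> \<Longrightarrow> integral a"
  by (simp_all add: integral_def pairing_zero pairing_add pairing_minus pairing_scale pairing_root_Ints)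

lemma integral_Wf: assumes "u \<in> Wf" "integral x" shows "integral (u x)"
  unfolding integral_def
proof
  fix a assume "a \<in> \<Phi>"
  then have "inv u a \<in> \<Phi>" using Wf_root Wf_inv assms by blast
  moreover have "pairing (u x) (u (inv u a)) = pairing x (inv u a)"
    by (rule orthogonal_pairing[OF Wf_orthogonal[OF assms(1)]])
  ultimately show "pairing (u x) a \<in> \<int>"
    using assms(2) Wf_bij[OF assms(1)] by (simp add: integral_def bij_is_surj surj_f_inv_f)
qed

text \<open>All elements of the extended affine Weyl group have this form; only integrality of the
  translation part matters for the action on the hyperplanes.\<close>

definition Ext :: "('a \<Rightarrow> 'a) set" where
  "Ext = {transl m \<circ> u | m u. u \<in> Wf \<and> integral m}"

lemma ExtI: "u \<in> Wf \<Longrightarrow> integral m \<Longrightarrow> transl m \<circ> u \<in> Ext"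
  unfolding Ext_def by blast

lemma ExtE: assumes "g \<in> Ext" obtains m u where "g = transl m \<circ> u" "u \<in> Wf" "integral m"
  using assms unfolding Ext_def by blast

lemma lin_Ext: "u \<in> Wf \<Longrightarrow> lin (transl m \<circ> u) = u"
  using Wf_0 by (simp add: fun_eq_iff lin_def transl_def)

lemma lin_Wf: "u \<in> Wf \<Longrightarrow> lin u = u"
  using Wf_0 by (simp add: fun_eq_iff lin_def)

lemma Ext_lin: "g \<in> Ext \<Longrightarrow> lin g \<in> Wf"
  using lin_Ext by (metis ExtE)

lemma Ext_form: "g \<in> Ext \<Longrightarrow> g = transl (g 0) \<circ> lin g"
  by (simp add: fun_eq_iff lin_def transl_def)

lemma Ext_integral: "g \<in> Ext \<Longrightarrow> integral (g 0)"
  using Wf_0 by (metis ExtE comp_apply transl_def add.right_neutral)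

lemma Ext_comp:
  assumes "g \<in> Ext" "h \<in> Ext" shows "g \<circ> h \<in> Ext" and "lin (g \<circ> h) = lin g \<circ> lin h"
proof -
  obtain m u where g: "g = transl m \<circ> u" "u \<in> Wf" "integral m" using ExtE[OF assms(1)] .
  obtain n v where h: "h = transl n \<circ> v" "v \<in> Wf" "integral n" using ExtE[OF assms(2)] .
  have "g \<circ> h = transl (m + u n) \<circ> (u \<circ> v)"
    using linear_transl[OF Wf_linear[OF g(2)], of n] unfolding g(1) h(1)
    by (simp add: fun_eq_iff transl_def add.assoc)
  moreover have "u \<circ> v \<in> Wf" "integral (m + u n)"
    using g h Wf_comp integral_add integral_Wf by blast+
  ultimately show "g \<circ> h \<in> Ext" "lin (g \<circ> h) = lin g \<circ> lin h"
    using ExtI lin_Ext g h by metis+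
qed

lemma Wf_Ext: "u \<in> Wf \<Longrightarrow> u \<in> Ext"
  using ExtI[OF _ integral_0] by simp

lemma Ext_bij: "g \<in> Ext \<Longrightarrow> bij g"
  using ExtE bij_transl Wf_bij bij_comp by metis

lemma Ext_inv: assumes "g \<in> Ext" shows "inv g \<in> Ext" and "lin (inv g) = inv (lin g)"
proof -
  obtain m u where g: "g = transl m \<circ> u" "u \<in> Wf" "integral m" using ExtE[OF assms(1)] .
  have "inv g = inv u \<circ> inv (transl m)" unfolding g(1)
    by (rule o_inv_distrib[OF bij_transl Wf_bij[OF g(2)]])
  also have "inv (transl m) = transl (- m)" by (rule inv_unique_comp) (simp_all add: transl_comp)
  also have "inv u \<circ> transl (- m) = transl (inv u (- m)) \<circ> inv u"
    using linear_transl Wf_linear Wf_inv g(2) by blast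
  finally have *: "inv g = transl (inv u (- m)) \<circ> inv u" .
  have "integral (inv u (- m))" using integral_Wf Wf_inv g integral_minus by blast
  then show "inv g \<in> Ext" "lin (inv g) = inv (lin g)"
    using * ExtI lin_Ext g Wf_inv by metis+
qed

lemma refl_aff_Ext: "a \<in> \<Phi> \<Longrightarrow> refl_aff a n \<in> Ext" "a \<in> \<Phi> \<Longrightarrow> lin (refl_aff a n) = rfl a"
proof -
  assume a: "a \<in> \<Phi>"
  show "refl_aff a n \<in> Ext"
    unfolding refl_aff_alt[of a n] by (rule ExtI[OF refl_in_Wf[OF a] integral_int[OF integral_root[OF a]]])
next
  assume a: "a \<in> \<Phi>"
  show "lin (refl_aff a n) = rfl a"
    unfolding refl_aff_alt[of a n] by (rule lin_Ext[OF refl_in_Wf[OF a]])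
qed

lemma Wa_Ext: "w \<in> Wa \<Phi> \<Longrightarrow> w \<in> Ext"
  unfolding Wa_def
proof (induction rule: gen_group.induct)
  case one
  then show ?case using Wf_Ext id_Wf by blast
next
  case (gen x w)
  then have "x \<in> Ext" using refl_aff_Ext(1) by blast
  then show "x \<circ> w \<in> Ext" using Ext_comp(1) gen.IH by blast
next
  case (inv x w)
  then have "inv x \<in> Ext" using refl_aff_Ext(1) Ext_inv(1) by blast
  then show "inv x \<circ> w \<in> Ext" using Ext_comp(1) inv.IH by blast
qed

text \<open>An element of the affine group that fixes 0 equals its own linear part.\<close>

lemma W0_eq: "W0 \<Phi> = Wf"
proof (intro equalityI subsetI)
  fix w assume "w \<in> W0 \<Phi>"
  then have "w \<in> Ext" "w 0 = 0" using Wa_Ext by (auto simp: W0_def)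
  then have "w = lin w" by (simp add: fun_eq_iff lin_def)
  then show "w \<in> Wf" using Ext_lin \<open>w \<in> Ext\<close> by metis
next
  fix w assume w: "w \<in> Wf"
  then have "w \<in> Wa \<Phi>" unfolding Wf_def Wa_def by (rule gen_group_mono[rotated]) blast
  then show "w \<in> W0 \<Phi>" using Wf_0[OF w] by (simp add: W0_def)
qed

lemma Wf_Wa: "u \<in> Wf \<Longrightarrow> u \<in> Wa \<Phi>"
  using W0_eq by (auto simp: W0_def)

text \<open>The amount by which \<open>g\<close> moves the labels of the hyperplanes of direction
  \<open>a\<close>. For \<open>g\<close> in \<open>Ext\<close> the pairing is an integer and the
  floor only changes its type.\<close>

definition shift :: "('a \<Rightarrow> 'a) \<Rightarrow> 'a \<Rightarrow> int" where
  "shift g a = \<lfloor>pairing (g 0) (lin g a)\<rfloor>"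

lemma Ext_pairing:
  assumes "g \<in> Ext" "a \<in> \<Phi>" shows "pairing (g x) (lin g a) = pairing x a + of_int (shift g a)"
proof -
  have u: "lin g \<in> Wf" using Ext_lin assms by blast
  have "pairing (g 0) (lin g a) \<in> \<int>"
    using Ext_integral[OF assms(1)] Wf_root[OF u assms(2)] by (simp add: integral_def)
  then have "pairing (g 0) (lin g a) = of_int (shift g a)" by (simp add: shift_def)
  moreover have "g x = lin g x + g 0" by (simp add: lin_def)
  ultimately show ?thesis using orthogonal_pairing[OF Wf_orthogonal[OF u]] by (simp add: pairing_add)
qed

lemma conj_refl_aff:
  assumes "g \<in> Ext" "a \<in> \<Phi>"
  shows "conj_by g (refl_aff a n) = refl_aff (lin g a) (n + shift g a)"
proof -
  have b: "bij g" using Ext_bij assms by blast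
  have "g (refl_aff a n x) = refl_aff (lin g a) (n + shift g a) (g x)" for x
  proof -
    have "g (refl_aff a n x) = g x - (pairing x a - of_int n) *\<^sub>R lin g a"
      using Wf_linear[OF Ext_lin[OF assms(1)]]
      by (subst (1 2) Ext_form[OF assms(1)])
         (simp add: transl_def refl_aff_def linear_diff linear_cmul)
    then show ?thesis
      using Ext_pairing[OF assms, of x] by (simp add: refl_aff_def)
  qed
  then show ?thesis
    by (simp add: conj_by_def fun_eq_iff) (metis b bij_inv_eq_iff)
qed

subsection \<open>Separating reflections\<close>

text \<open>A regular point lies on no hyperplane; such points stand for the alcoves containing
  them.\<close>

definition regular :: "'a \<Rightarrow> bool" where
  "regular x \<longleftrightarrow> (\<forall>a\<in>\<Phi>. \<forall>n::int. pairing x a \<noteq> of_int n)"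

text \<open>Separating hyperplanes are recorded by their reflections: a root and its negative then
  give the same element, and \<open>Ext\<close> acts by conjugation.\<close>

definition Sep :: "'a \<Rightarrow> 'a \<Rightarrow> ('a \<Rightarrow> 'a) set" where
  "Sep x y = {refl_aff a n | a n. a \<in> \<Phi> \<and> (pairing x a - of_int n) * (pairing y a - of_int n) < 0}"

lemma refl_aff_eq_cases:
  assumes "a \<in> \<Phi>" "b \<in> \<Phi>" "refl_aff a n = refl_aff b m"
  shows "b = a \<and> m = n \<or> b = - a \<and> m = - n"
proof -
  have nz: "a \<noteq> 0" "b \<noteq> 0" using assms root_nz by blast+
  obtain c where "b = c *\<^sub>R a" using refl_aff_eq_imp[OF nz assms(3)] .
  then have "b = a \<or> b = - a" using reduced[of a c] assms by auto
  then show ?thesis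
  proof
    assume "b = a"
    then show ?thesis using refl_aff_inject_int[OF nz(1)] assms(3) by blast
  next
    assume "b = - a"
    then have "refl_aff a n = refl_aff a (- m)" using assms(3) refl_aff_minus[of a "- m"] by simp
    then show ?thesis using refl_aff_inject_int[OF nz(1)] \<open>b = - a\<close> by fastforce
  qed
qed

lemma mem_Sep:
  assumes "a \<in> \<Phi>"
  shows "refl_aff a n \<in> Sep x y \<longleftrightarrow> (pairing x a - of_int n) * (pairing y a - of_int n) < 0"
proof
  assume "refl_aff a n \<in> Sep x y"
  then obtain b m where b: "refl_aff a n = refl_aff b m" "b \<in> \<Phi>"
      "(pairing x b - of_int m) * (pairing y b - of_int m) < 0" unfolding Sep_def by blast
  from refl_aff_eq_cases[OF assms b(2,1)]
  show "(pairing x a - of_int n) * (pairing y a - of_int n) < 0"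
    using b(3) by (auto simp: pairing_minus_right algebra_simps)
qed (use assms Sep_def in blast)

lemma SepE:
  assumes "t \<in> Sep x y"
  obtains a n where "a \<in> \<Phi>\<^sub>+" "t = refl_aff a n" "(pairing x a - of_int n) * (pairing y a - of_int n) < 0"
proof -
  obtain a n where a: "t = refl_aff a n" "a \<in> \<Phi>" using assms unfolding Sep_def by blast
  have "t = refl_aff (- a) (- n)" using a(1) refl_aff_minus[of a n] by simp
  then have "\<exists>a n. a \<in> \<Phi>\<^sub>+ \<and> t = refl_aff a n" using root_cases[OF a(2)] a(1) by blast
  then show thesis using that assms mem_Sep[OF pos_root] by blast
qed

lemma Sep_commute: "Sep x y = Sep y x"
  unfolding Sep_def by (simp add: mult.commute)

lemma Sep_image:
  assumes "g \<in> Ext" shows "Sep (g x) (g y) = conj_by g ` Sep x y"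
proof -
  have sub: "conj_by h ` Sep x y \<subseteq> Sep (h x) (h y)" if h: "h \<in> Ext" for h x y
  proof
    fix t assume "t \<in> conj_by h ` Sep x y"
    then obtain r where r: "r \<in> Sep x y" "t = conj_by h r" by blast
    obtain a n where a: "a \<in> \<Phi>\<^sub>+" "r = refl_aff a n"
      "(pairing x a - of_int n) * (pairing y a - of_int n) < 0" using SepE[OF r(1)] .
    have p: "a \<in> \<Phi>" using a pos_root by blast
    have "t = refl_aff (lin h a) (n + shift h a)" using r a conj_refl_aff[OF h p] by simp
    then show "t \<in> Sep (h x) (h y)"
      using mem_Sep[OF Wf_root[OF Ext_lin[OF h] p]] Ext_pairing[OF h p] a(3) by simp
  qed
  have b: "bij g" using Ext_bij assms by blast
  have "conj_by (inv g) ` Sep (g x) (g y) \<subseteq> Sep x y"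
    using sub[OF Ext_inv(1)[OF assms], of "g x" "g y"] b by (simp add: bij_is_inj)
  then have "conj_by g ` conj_by (inv g) ` Sep (g x) (g y) \<subseteq> conj_by g ` Sep x y" by (rule image_mono)
  then show ?thesis using sub[OF assms, of x y] b by (auto simp: image_image)
qed

lemma Sep_triangle:
  assumes "regular x" "regular y" "regular z"
  shows "Sep x z = sym_diff (Sep x y) (Sep y z)"
proof -
  have key: "refl_aff a n \<in> Sep x z \<longleftrightarrow> refl_aff a n \<in> sym_diff (Sep x y) (Sep y z)" if "a \<in> \<Phi>" for a n
  proof -
    have "pairing x a - of_int n \<noteq> 0" "pairing y a - of_int n \<noteq> 0" "pairing z a - of_int n \<noteq> 0"
      using assms that unfolding regular_def by auto
    then show ?thesis using mem_Sep[OF that] by (auto simp: mult_less_0_iff not_less_iff_gr_or_eq)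
  qed
  have form: "\<exists>a n. a \<in> \<Phi> \<and> t = refl_aff a n" if "t \<in> Sep p q" for t p q
    using that unfolding Sep_def by blast
  show ?thesis
    by (rule set_eqI) (metis form key UnE DiffD1)
qed

lemma regular_Ext: assumes "g \<in> Ext" "regular x" shows "regular (g x)"
  unfolding regular_def
proof (intro ballI allI)
  fix a n assume a: "a \<in> \<Phi>"
  have b: "bij (lin g)" using Ext_lin[OF assms(1)] Wf_bij by blast
  have i: "inv (lin g) a \<in> \<Phi>" using Ext_lin[OF assms(1)] Wf_inv Wf_root a by blast
  have "pairing (g x) a = pairing x (inv (lin g) a) + of_int (shift g (inv (lin g) a))"
    using Ext_pairing[OF assms(1) i] b by (simp add: bij_is_surj surj_f_inv_f)
  then show "pairing (g x) a \<noteq> of_int n"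
    using assms(2) i unfolding regular_def
    by (metis add_diff_cancel_right' of_int_diff)
qed

subsection \<open>The fundamental alcove\<close>

lemma dual_point:
  "\<exists>x. \<forall>b\<in>\<Delta>. pairing x b = \<phi> b"
proof -
  obtain x where x: "\<forall>b\<in>\<Delta>. x \<bullet> b = \<phi> b * (b \<bullet> b) / 2"
    using dual_vector[of "\<lambda>b. \<phi> b * (b \<bullet> b) / 2"] by blast
  have "\<forall>b\<in>\<Delta>. pairing x b = \<phi> b"
  proof
    fix b assume b: "b \<in> \<Delta>"
    then have "b \<noteq> 0" using simple_root root_nz by blast
    moreover have "x \<bullet> b = \<phi> b * (b \<bullet> b) / 2" using x b by blast
    ultimately show "pairing x b = \<phi> b" unfolding pairing_def by (metis inner_eq_zero_iff nonzero_mult_div_cancel_right nonzero_mult_div_cancel_left times_divide_eq_right zero_neq_numeral)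
  qed
  then show ?thesis by blast
qed

lemma pairing_pos_of_simple:
  assumes "a \<in> \<Phi>\<^sub>+" "\<And>b. b \<in> \<Delta> \<Longrightarrow> pairing x b > 0" shows "pairing x a > 0"
  unfolding pairing_coroot
  by (rule nat_combs_inner_pos[OF finite_imageI[OF finite_simple] coroot_pos[OF assms(1)]])
     (use assms coroot_nz pos_nz in \<open>auto simp: pairing_coroot\<close>)

lemma theta_highest_pairing:
  assumes "a \<in> \<Phi>" "\<And>b. b \<in> \<Delta> \<Longrightarrow> pairing x b \<ge> 0" shows "pairing x a \<le> pairing x \<theta>"
  using nat_combs_nonneg[OF theta_highest[OF assms(1)], of x] assms(2)
  by (auto simp: pairing_coroot inner_diff_right)

lemma theta_highest_strict:
  assumes "a \<in> \<Phi>" "a \<noteq> \<theta>" "\<And>b. b \<in> \<Delta> \<Longrightarrow> pairing x b > 0" shows "pairing x a < pairing x \<theta>"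
proof -
  have "coroot \<theta> - coroot a \<noteq> 0"
    using coroot_coroot[OF root_nz[OF assms(1)]] coroot_coroot[OF root_nz[OF theta_root]] assms(2) by auto
  then have "0 < x \<bullet> (coroot \<theta> - coroot a)"
    by (rule nat_combs_inner_pos[OF finite_imageI[OF finite_simple] theta_highest[OF assms(1)]])
       (use assms(3) in \<open>auto simp: pairing_coroot\<close>)
  then show ?thesis by (simp add: pairing_coroot inner_diff_right)
qed

text \<open>The highest coroot dominates the coroot of \<open>- \<theta>\<close>; at a point
  positive on all simple roots this prevents \<open>- \<theta>\<close> from being a positive
  root.\<close>

lemma theta_pos: "\<theta> \<in> \<Phi>\<^sub>+"
proof (rule ccontr)
  assume "\<theta> \<notin> \<Phi>\<^sub>+"
  then have n: "- \<theta> \<in> \<Phi>\<^sub>+" using not_pos_iff theta_root by blast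
  obtain x where x: "\<forall>b\<in>\<Delta>. pairing x b = 1" using dual_point[of "\<lambda>_. 1"] by auto
  then have "pairing x (- \<theta>) > 0" using pairing_pos_of_simple[OF n] by simp
  moreover have "pairing x (- \<theta>) \<le> pairing x \<theta>"
    using theta_highest_pairing[OF minus_root[OF theta_root]] x by simp
  ultimately show False by (simp add: pairing_minus_right)
qed

text \<open>Positivity on simple roots extends to positive roots since coroots are nonnegative
  combinations, and the coroot of \<open>\<theta>\<close> bounds all others from above.\<close>

lemma mem_A0: "x \<in> A0 \<Phi> \<Delta> \<longleftrightarrow> (\<forall>b\<in>\<Delta>. pairing x b > 0) \<and> pairing x \<theta> < 1"
proof
  assume "x \<in> A0 \<Phi> \<Delta>"
  then show "(\<forall>b\<in>\<Delta>. pairing x b > 0) \<and> pairing x \<theta> < 1"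
    using simple_pos theta_pos unfolding A0_def by blast
next
  assume *: "(\<forall>b\<in>\<Delta>. pairing x b > 0) \<and> pairing x \<theta> < 1"
  then have "pairing x a > 0" "pairing x a < 1" if "a \<in> \<Phi>\<^sub>+" for a
    using pairing_pos_of_simple[OF that] theta_highest_pairing[OF pos_root[OF that], of x]
    by (auto simp: less_imp_le intro: le_less_trans)
  then show "x \<in> A0 \<Phi> \<Delta>" unfolding A0_def by blast
qed

text \<open>Base point of the fundamental alcove; lengths and inversion sets are measured from
  it.\<close>

definition c0 :: 'a where "c0 = (SOME x. x \<in> A0 \<Phi> \<Delta>)"

lemma c0_A0: "c0 \<in> A0 \<Phi> \<Delta>"
proof -
  obtain x where x: "\<forall>b\<in>\<Delta>. pairing x b = 1" using dual_point[of "\<lambda>_. 1"] by auto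
  define M where "M = pairing x \<theta> + 1"
  have M: "pairing x \<theta> > 0" "M > 1"
    unfolding M_def using pairing_pos_of_simple[OF theta_pos, of x] x by auto
  have "(1 / M) *\<^sub>R x \<in> A0 \<Phi> \<Delta>"
    unfolding mem_A0 using x M by (auto simp: pairing_scale M_def)
  then show ?thesis unfolding c0_def by (rule someI)
qed

lemma A0_bounds: "x \<in> A0 \<Phi> \<Delta> \<Longrightarrow> a \<in> \<Phi>\<^sub>+ \<Longrightarrow> 0 < pairing x a \<and> pairing x a < 1"
  unfolding A0_def by blast

lemmas c0_bounds = A0_bounds[OF c0_A0]

lemma regular_posI:
  assumes "\<And>a n. a \<in> \<Phi>\<^sub>+ \<Longrightarrow> pairing x a \<noteq> of_int n" shows "regular x"
  unfolding regular_def
proof (intro ballI allI)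
  fix a and n :: int assume "a \<in> \<Phi>"
  then show "pairing x a \<noteq> of_int n"
    using root_cases[of a] assms[of a n] assms[of "- a" "- n"] by (auto simp: pairing_minus_right)
qed

lemma not_int_between: "0 < (r::real) \<Longrightarrow> r < 1 \<Longrightarrow> r \<noteq> of_int n"
  by (metis of_int_0_less_iff of_int_less_1_iff zless_imp_add1_zle add_0 linorder_not_le)

lemma A0_regular: "x \<in> A0 \<Phi> \<Delta> \<Longrightarrow> regular x"
  using A0_bounds not_int_between by (intro regular_posI) blast

lemmas c0_regular = A0_regular[OF c0_A0]

lemma A0_Sep: assumes "x \<in> A0 \<Phi> \<Delta>" "y \<in> A0 \<Phi> \<Delta>" shows "Sep x y = {}"
proof (rule ccontr)
  assume "Sep x y \<noteq> {}"
  then obtain t where "t \<in> Sep x y" by blast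
  then obtain a n where a: "a \<in> \<Phi>\<^sub>+" "(pairing x a - of_int n) * (pairing y a - of_int n) < 0"
    using SepE by metis
  have "(pairing x a - of_int n) * (pairing y a - of_int n) > 0"
    using same_int_interval[of 0 "pairing x a" "pairing y a" n] A0_bounds[OF _ a(1)] assms by simp
  then show False using a(2) by linarith
qed

lemma Sep_A0:
  assumes "x \<in> A0 \<Phi> \<Delta>" "regular y" "Sep x y = {}" shows "y \<in> A0 \<Phi> \<Delta>"
  unfolding A0_def
proof (intro CollectI ballI conjI)
  fix a assume a: "a \<in> \<Phi>\<^sub>+"
  have "refl_aff a n \<notin> Sep x y" for n using assms(3) by blast
  then have *: "(pairing x a - of_int n) * (pairing y a - of_int n) \<ge> 0" for n
    using mem_Sep[OF pos_root[OF a]] by (simp add: not_less)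
  have nz: "pairing y a \<noteq> of_int n" for n using assms(2) pos_root[OF a] by (simp add: regular_def)
  show "0 < pairing y a" using *[of 0] nz[of 0] A0_bounds[OF assms(1) a] by (simp add: zero_le_mult_iff)
  show "pairing y a < 1" using *[of 1] nz[of 1] A0_bounds[OF assms(1) a] by (simp add: zero_le_mult_iff)
qed

lemma Ext_A0_sub:
  assumes "g \<in> Ext" "x \<in> A0 \<Phi> \<Delta>" "g x \<in> A0 \<Phi> \<Delta>" shows "g ` A0 \<Phi> \<Delta> \<subseteq> A0 \<Phi> \<Delta>"
proof
  fix z assume "z \<in> g ` A0 \<Phi> \<Delta>"
  then obtain y where y: "y \<in> A0 \<Phi> \<Delta>" "z = g y" by blast
  have "Sep (g x) (g y) = {}" using Sep_image[OF assms(1)] A0_Sep[OF assms(2) y(1)] by simp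
  then show "z \<in> A0 \<Phi> \<Delta>"
    using Sep_A0[OF assms(3)] regular_Ext[OF assms(1) A0_regular[OF y(1)]] y(2) by simp
qed

lemma Ext_A0_eq:
  assumes "g \<in> Ext" "x \<in> A0 \<Phi> \<Delta>" "g x \<in> A0 \<Phi> \<Delta>" shows "g ` A0 \<Phi> \<Delta> = A0 \<Phi> \<Delta>"
proof
  have b: "bij g" using Ext_bij assms by blast
  have "inv g ` A0 \<Phi> \<Delta> \<subseteq> A0 \<Phi> \<Delta>"
    using Ext_A0_sub[OF Ext_inv(1)[OF assms(1)] assms(3)] assms(2) b by (simp add: bij_is_inj)
  then show "A0 \<Phi> \<Delta> \<subseteq> g ` A0 \<Phi> \<Delta>"
    using b by (metis image_mono image_f_inv_f bij_is_surj)
qed (rule Ext_A0_sub[OF assms])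

subsection \<open>Simple reflections\<close>

text \<open>The wall of the alcove belonging to \<open>(b, k)\<close> is \<open>hyp b k\<close>, with \<open>b\<close> pointing inwards.\<close>

definition walls :: "('a \<times> int) set" where "walls = (\<lambda>b. (b, 0)) ` \<Delta> \<union> {(- \<theta>, -1)}"

lemma Sa_walls: "Sa \<Phi> \<Delta> = (\<lambda>(b, k). refl_aff b k) ` walls"
proof -
  have "(\<lambda>(b, k). refl_aff b k) ` (\<lambda>b. (b, 0)) ` \<Delta> = S0 \<Delta>" unfolding S0_def by auto
  moreover have "refl_aff (- \<theta>) (-1) = refl_aff \<theta> 1" using refl_aff_minus[of \<theta> 1] by simp
  ultimately show ?thesis unfolding Sa_def walls_def by (simp add: image_Un)
qed

lemma wall_root: "(b, k) \<in> walls \<Longrightarrow> b \<in> \<Phi>"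
  unfolding walls_def using simple_root theta_root minus_root by auto

lemma wall_c0: "(b, k) \<in> walls \<Longrightarrow> pairing c0 b > of_int k"
  unfolding walls_def using c0_A0 mem_A0 by (auto simp: pairing_minus_right)

lemma mem_A0_walls: "x \<in> A0 \<Phi> \<Delta> \<longleftrightarrow> (\<forall>(b, k)\<in>walls. pairing x b > of_int k)"
  unfolding mem_A0 walls_def by (auto simp: pairing_minus_right)

text \<open>With \<open>k = pairing \<theta> a\<close>, the coroot of \<open>rfl \<theta> a\<close>
  is that of \<open>a\<close> minus \<open>k\<close> times that of \<open>\<theta>\<close>.
  Evaluated at \<open>x\<close>, all roots lie between the values of \<open>- \<theta>\<close> and
  \<open>\<theta>\<close>, and \<open>a\<close> lies strictly between 0 and \<open>\<theta>\<close>,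
  which leaves only two values of \<open>k\<close>.\<close>

lemma theta_pairing_01:
  assumes "a \<in> \<Phi>\<^sub>+" "a \<noteq> \<theta>" shows "pairing \<theta> a = 0 \<or> pairing \<theta> a = 1"
proof -
  interpret dual: root_base "coroot ` \<Phi>" "coroot ` \<Delta>" by (rule dual_root_base)
  have a: "a \<in> \<Phi>" "a \<noteq> 0" using assms pos_root pos_nz by blast+
  have th: "\<theta> \<in> \<Phi>" "\<theta> \<noteq> 0" using theta_root root_nz by blast+
  obtain k :: int where k: "pairing \<theta> a = of_int k" using pairing_root_Ints[OF a(1) th(1)] by (auto simp: Ints_def)
  obtain x where x: "\<And>b. b \<in> \<Delta> \<Longrightarrow> pairing x b = 1" using dual_point[of "\<lambda>_. 1"] by auto
  have lt: "pairing x a < pairing x \<theta>" "0 < pairing x a"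
    using theta_highest_strict[OF a(1) assms(2), of x] pairing_pos_of_simple[OF assms(1), of x] x by auto
  have r: "rfl \<theta> a \<in> \<Phi>" using refl_root th(1) a(1) by blast
  have c: "coroot (rfl \<theta> a) = coroot a - of_int k *\<^sub>R coroot \<theta>"
  proof -
    have "coroot (rfl \<theta> a) = coroot a - pairing (coroot a) \<theta> *\<^sub>R \<theta>"
      using orthogonal_coroot[OF orthogonal_refl[OF th(2)], of a] by (simp add: refl_aff_zero)
    also have "pairing (coroot a) \<theta> *\<^sub>R \<theta> = pairing \<theta> a *\<^sub>R coroot \<theta>"
      by (simp add: pairing_def coroot_def inner_commute)
    finally show ?thesis using k by simp
  qed
  have p: "pairing x (rfl \<theta> a) = pairing x a - of_int k * pairing x \<theta>"
    using c by (simp add: pairing_coroot inner_diff_right)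
  have "k \<ge> 0"
  proof (rule ccontr)
    assume "\<not> k \<ge> 0"
    then have "of_int k \<le> (-1 :: real)" by linarith
    then have "of_int k * pairing x \<theta> \<le> -1 * pairing x \<theta>" using lt by (intro mult_right_mono) auto
    moreover have "pairing x (rfl \<theta> a) \<le> pairing x \<theta>" using theta_highest_pairing[OF r, of x] x by simp
    ultimately show False using p lt by linarith
  qed
  moreover have "k \<le> 1"
  proof (rule ccontr)
    assume "\<not> k \<le> 1"
    then have "of_int k \<ge> (2 :: real)" by linarith
    then have "of_int k * pairing x \<theta> \<ge> 2 * pairing x \<theta>" using lt by (intro mult_right_mono) auto
    moreover have "pairing x (- rfl \<theta> a) \<le> pairing x \<theta>"
      using theta_highest_pairing[OF minus_root[OF r], of x] x by simp
    ultimately show False using p lt pairing_minus_right[of x "rfl \<theta> a"] by linarith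
  qed
  ultimately have "k = 0 \<or> k = 1" by linarith
  then show ?thesis using k by auto
qed

text \<open>A linear simple reflection permutes the other positive roots. The affine one changes
  \<open>pairing c0 a\<close> by 0 or by \<open>1 - pairing c0 \<theta>\<close>, by
  \<open>theta_pairing_01\<close>, so for \<open>a \<noteq> \<theta>\<close> the value stays between
  0 and 1.\<close>

lemma Sep_simple:
  assumes "s \<in> Sa \<Phi> \<Delta>" shows "Sep c0 (s c0) = {s}"
proof -
  have "\<exists>b k. (b, k) \<in> walls \<and> s = refl_aff b k" using assms Sa_walls by auto
  then obtain b k where b: "(b, k) \<in> walls" "s = refl_aff b k" by blast
  have bnz: "b \<noteq> 0" using wall_root[OF b(1)] root_nz by blast
  have "(pairing c0 b - of_int k) * (pairing (s c0) b - of_int k) = - (pairing c0 b - of_int k)\<^sup>2"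
    unfolding b(2) pairing_refl_self[OF bnz] by (simp add: power2_eq_square algebra_simps)
  also have "\<dots> < 0" using wall_c0[OF b(1)] by simp
  finally have 1: "s \<in> Sep c0 (s c0)" unfolding b(2) mem_Sep[OF wall_root[OF b(1)]] .
  have "t = s" if t: "t \<in> Sep c0 (s c0)" for t
  proof -
    obtain a n where a: "a \<in> \<Phi>\<^sub>+" "t = refl_aff a n"
      "(pairing c0 a - of_int n) * (pairing (s c0) a - of_int n) < 0" using SepE[OF t] .
    have ca: "0 < pairing c0 a" "pairing c0 a < 1" using c0_bounds[OF a(1)] by auto
    have far: False if "0 < pairing (s c0) a" "pairing (s c0) a < 1"
      using same_int_interval[of 0 "pairing c0 a" "pairing (s c0) a" n] ca that a(3) by simp
    show ?thesis
    proof (cases "b \<in> \<Delta> \<and> k = 0")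
      case True
      have p: "pairing (s c0) a = pairing c0 (s a)"
        using orthogonal_pairing[OF orthogonal_refl[OF bnz], of c0 "s a"] b True
          refl_aff_involution[OF bnz, of 0] by (simp add: fun_eq_iff)
      have "a = b"
      proof (rule ccontr)
        assume "a \<noteq> b"
        then have "s a \<in> \<Phi>\<^sub>+" using simple_refl_pos[OF a(1)] b True by simp
        then show False using far p c0_bounds by simp
      qed
      moreover have "n = 0"
      proof (rule ccontr)
        assume "n \<noteq> 0"
        then have "of_int n \<ge> (1::real) \<or> of_int n \<le> (-1::real)" by linarith
        moreover have "pairing (s c0) a = - pairing c0 a"
          using \<open>a = b\<close> pairing_refl_self[OF bnz, of k] b True by simp
        ultimately show False using a(3) ca
          by (auto simp: mult_less_0_iff)
      qed
      ultimately show ?thesis using a b True by simp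
    next
      case False
      then have b': "b = - \<theta>" "k = -1" using b(1) by (auto simp: walls_def)
      then have s: "s = refl_aff \<theta> 1" using b(2) refl_aff_minus[of \<theta> 1] by simp
      have tnz: "\<theta> \<noteq> 0" using theta_root root_nz by blast
      have "0 < pairing c0 \<theta>" "pairing c0 \<theta> < 1" using c0_bounds[OF theta_pos] by auto
      have p: "pairing (s c0) a = pairing c0 a - (pairing c0 \<theta> - 1) * pairing \<theta> a"
        unfolding s by (simp add: refl_aff_def pairing_diff pairing_scale)
      have "a = \<theta>"
      proof (rule ccontr)
        assume ne: "a \<noteq> \<theta>"
        consider "pairing \<theta> a = 0" | "pairing \<theta> a = 1" using theta_pairing_01[OF a(1) ne] by blast
        then show False
        proof cases
          case 1
          then show False using far p ca by simp
        next
          case 2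
          have "pairing c0 a < pairing c0 \<theta>"
            using theta_highest_strict[OF pos_root[OF a(1)] ne] c0_A0 mem_A0 by blast
          then show False using far p ca 2 \<open>pairing c0 \<theta> < 1\<close> by simp
        qed
      qed
      moreover have "n = 1"
      proof (rule ccontr)
        assume "n \<noteq> 1"
        then have "of_int n \<ge> (2::real) \<or> of_int n \<le> (0::real)" by linarith
        moreover have "pairing (s c0) a = 2 - pairing c0 a"
          using \<open>a = \<theta>\<close> pairing_refl_self[OF tnz, of 1 c0] s by simp
        ultimately show False using a(3) ca
          by (auto simp: mult_less_0_iff)
      qed
      ultimately show ?thesis using a s by simp
    qed
  qed
  then show ?thesis using 1 by blast
qed

text \<open>Otherwise \<open>a\<close> would be dominant while
  \<open>a \<bullet> \<theta> \<le> 0\<close>. Since \<open>\<theta>\<close> dominates the simple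
  roots, \<open>a\<close> would be orthogonal to all of them.\<close>

lemma descending_wall:
  assumes "a \<in> \<Phi>" shows "\<exists>b k. (b, k) \<in> walls \<and> pairing b a < 0"
proof (rule ccontr)
  assume neg: "\<not> ?thesis"
  have *: "pairing b a \<ge> 0" if "(b, k) \<in> walls" for b k using neg that by (meson linorder_not_le)
  have nz: "a \<noteq> 0" using assms root_nz by blast
  have nn: "b \<bullet> a \<ge> 0" if "pairing b a \<ge> 0" for b
    using that pairing_neg_iff[OF nz, of b] by (meson linorder_not_le)
  have pos: "a \<bullet> b \<ge> 0" if "b \<in> \<Delta>" for b
    using nn[OF *[of b 0]] that by (simp add: walls_def inner_commute)
  have th: "a \<bullet> \<theta> \<le> 0"
    using nn[OF *[of "- \<theta>" "-1"]] by (simp add: walls_def inner_commute)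
  have simple_nn: "pairing a b \<ge> 0" if "b \<in> \<Delta>" for b
    using pos[OF that] by (simp add: pairing_def)
  have "a \<bullet> b = 0" if b: "b \<in> \<Delta>" for b
  proof -
    have "pairing a b \<le> pairing a \<theta>" using theta_highest_pairing[OF simple_root[OF b], of a] simple_nn by blast
    also have "\<dots> \<le> 0" using th by (simp add: pairing_def divide_nonpos_nonneg)
    finally have "\<not> pairing a b > 0" by simp
    then show ?thesis using pairing_pos_iff[OF root_nz[OF simple_root[OF b]], of a] pos[OF b] by simp
  qed
  moreover have "\<exists>b\<in>\<Delta>. a \<bullet> b \<noteq> 0"
    using root_cases[OF assms]
  proof
    assume "a \<in> \<Phi>\<^sub>+"
    then obtain b where "b \<in> \<Delta>" "a \<bullet> b > 0" by (rule pos_descent)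
    then show ?thesis by (intro bexI[of _ b]) auto
  next
    assume "- a \<in> \<Phi>\<^sub>+"
    then obtain b where "b \<in> \<Delta>" "(- a) \<bullet> b > 0" by (rule pos_descent)
    then show ?thesis by (intro bexI[of _ b]) auto
  qed
  ultimately show False by blast
qed

lemma Sa_reflection: "s \<in> Sa \<Phi> \<Delta> \<Longrightarrow> \<exists>a n. a \<in> \<Phi> \<and> s = refl_aff a n"
proof -
  assume "s \<in> Sa \<Phi> \<Delta>"
  then obtain b k where "(b, k) \<in> walls" "s = refl_aff b k" unfolding Sa_walls by auto
  then show ?thesis using wall_root by blast
qed

lemma Sa_Wa: "s \<in> Sa \<Phi> \<Delta> \<Longrightarrow> s \<in> Wa \<Phi>"
  using Sa_reflection refl_in_Wa by blast

lemma Sa_involution: "s \<in> Sa \<Phi> \<Delta> \<Longrightarrow> s \<circ> s = id"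
  using Sa_reflection refl_aff_involution root_nz by blast

text \<open>Induction on the gap between \<open>c0\<close> and the hyperplane, with the root
  oriented so that \<open>c0\<close> is on the lower side. Reflecting \<open>c0\<close> in a
  descending wall reduces the gap, and conjugation by that wall transports the smaller gap back to
  \<open>c0\<close>. If \<open>c0\<close> is carried across, the hyperplane is the wall itself, by
  \<open>Sep_simple\<close>.\<close>

lemma reflection_conj_simple:
  assumes "a \<in> \<Phi>"
  obtains ws s where "set ws \<subseteq> Sa \<Phi> \<Delta>" "s \<in> Sa \<Phi> \<Delta>" "refl_aff a n = conj_by (wprod ws) s"
proof -
  define Q where "Q p \<longleftrightarrow> fst p \<in> \<Phi> \<and> of_int (snd p) - pairing c0 (fst p) > 0" for p :: "'a \<times> int"
  define f where "f p = of_int (snd p) - pairing c0 (fst p)" for p :: "'a \<times> int"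
  have main: "\<exists>ws s. set ws \<subseteq> Sa \<Phi> \<Delta> \<and> s \<in> Sa \<Phi> \<Delta> \<and> refl_aff (fst p) (snd p) = conj_by (wprod ws) s"
    if p: "Q p" for p
  proof (rule finite_real_induct[where Q = Q and f = f])
    \<comment> \<open>For each of the finitely many roots, a bound on the gap leaves finitely many
      labels.\<close>
    have "{y. Q y \<and> f y < f p} \<subseteq> Sigma \<Phi> (\<lambda>a. {\<lfloor>pairing c0 a\<rfloor>..\<lceil>pairing c0 a + f p\<rceil>})"
      unfolding Q_def f_def by (auto simp: floor_le_iff le_ceiling_iff)
    then show "finite {y. Q y \<and> f y < f p}" by (rule finite_subset) (simp add: finite_roots)
  next
    fix p assume p: "Q p" and IH: "\<And>y. Q y \<Longrightarrow> f y < f p \<Longrightarrow>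
       \<exists>ws s. set ws \<subseteq> Sa \<Phi> \<Delta> \<and> s \<in> Sa \<Phi> \<Delta> \<and> refl_aff (fst y) (snd y) = conj_by (wprod ws) s"
    obtain a n where an: "p = (a, n)" by (cases p)
    have a: "a \<in> \<Phi>" "of_int n - pairing c0 a > 0" using p an by (auto simp: Q_def)
    obtain b k where b: "(b, k) \<in> walls" "pairing b a < 0" using descending_wall[OF a(1)] by blast
    define s where "s = refl_aff b k"
    have s: "s \<in> Sa \<Phi> \<Delta>" unfolding s_def Sa_walls using b(1) by force
    have sE: "s \<in> Ext" using Sa_Wa[OF s] Wa_Ext by blast
    have ss: "s (s x) = x" for x using Sa_involution[OF s] by (simp add: fun_eq_iff)
    have "pairing (s c0) a = pairing c0 a - (pairing c0 b - of_int k) * pairing b a"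
      unfolding s_def by (simp add: refl_aff_def pairing_diff pairing_scale)
    moreover have "(pairing c0 b - of_int k) * pairing b a < 0"
      using wall_c0[OF b(1)] b(2) by (simp add: mult_pos_neg)
    ultimately have less: "of_int n - pairing (s c0) a < of_int n - pairing c0 a" by simp
    define y where "y = (lin s a, n + shift s a)"
    have fy: "f y = of_int n - pairing (s c0) a"
      using Ext_pairing[OF sE a(1), of "s c0"] ss by (simp add: f_def y_def)
    have ya: "lin s a \<in> \<Phi>" using Wf_root[OF Ext_lin[OF sE] a(1)] .
    have cj: "conj_by s (refl_aff a n) = refl_aff (fst y) (snd y)"
      using conj_refl_aff[OF sE a(1)] by (simp add: y_def)
    have nz: "of_int n - pairing (s c0) a \<noteq> 0"
      using regular_Ext[OF sE c0_regular] a(1) unfolding regular_def by (metis eq_iff_diff_eq_0)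
    show "\<exists>ws s. set ws \<subseteq> Sa \<Phi> \<Delta> \<and> s \<in> Sa \<Phi> \<Delta> \<and> refl_aff (fst p) (snd p) = conj_by (wprod ws) s"
    proof (cases "of_int n - pairing (s c0) a > 0")
      case True
      then have "Q y" "f y < f p" using fy ya less an by (auto simp: Q_def y_def f_def)
      then obtain ws s' where ws: "set ws \<subseteq> Sa \<Phi> \<Delta>" "s' \<in> Sa \<Phi> \<Delta>"
        "refl_aff (fst y) (snd y) = conj_by (wprod ws) s'" using IH by blast
      have bw: "bij (wprod ws)" using ws(1) Sa_involution by (intro wprod_involutions(2)) auto
      have bs: "bij s" using Ext_bij sE by blast
      have "conj_by (wprod (s # ws)) s' = conj_by s (conj_by s (refl_aff a n))"
        using conj_by_comp[OF bs bw] ws(3) cj by simp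
      also have "\<dots> = refl_aff a n"
        using conj_by_inv(2)[OF bs] involution_inv[OF Sa_involution[OF s]] by simp
      finally have "refl_aff a n = conj_by (wprod (s # ws)) s'" by simp
      then show ?thesis using ws s an by (intro exI[of _ "s # ws"] exI[of _ s']) auto
    next
      case False
      then have "(pairing c0 a - of_int n) * (pairing (s c0) a - of_int n) < 0"
        using a(2) nz by (intro mult_neg_pos) auto
      then have "refl_aff a n \<in> Sep c0 (s c0)" using mem_Sep[OF a(1)] by blast
      then have "refl_aff a n = s" using Sep_simple[OF s] by simp
      then show ?thesis using an s by (intro exI[of _ "[]"] exI[of _ s]) simp
    qed
  qed (rule p)
  have nz: "of_int n - pairing c0 a \<noteq> 0" using c0_regular assms unfolding regular_def by (metis eq_iff_diff_eq_0)
  have "Q (a, n) \<or> Q (- a, - n)"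
    using nz assms minus_root[OF assms] by (auto simp: Q_def pairing_minus_right)
  then show thesis
    using main[of "(a, n)"] main[of "(- a, - n)"] refl_aff_minus[of a n] that by auto
qed

lemma Wa_Sa_words: "Wa \<Phi> = {wprod ws | ws. set ws \<subseteq> Sa \<Phi> \<Delta>}"
proof (intro equalityI subsetI)
  fix w assume "w \<in> {wprod ws | ws. set ws \<subseteq> Sa \<Phi> \<Delta>}"
  then have "w \<in> gen_group (Sa \<Phi> \<Delta>)" using gen_group_involutions[OF Sa_involution] by simp
  moreover have "Sa \<Phi> \<Delta> \<subseteq> {refl_aff a n | a n. a \<in> \<Phi>}" using Sa_reflection by blast
  ultimately show "w \<in> Wa \<Phi>" unfolding Wa_def using gen_group_mono by blast
next
  have rv: "inv (wprod ws) = wprod (rev ws)" if "set ws \<subseteq> Sa \<Phi> \<Delta>" for ws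
    using that Sa_involution by (intro wprod_involutions(3)) auto
  have gen: "\<exists>us. set us \<subseteq> Sa \<Phi> \<Delta> \<and> refl_aff a n = wprod us" if a: "a \<in> \<Phi>" for a n
  proof -
    obtain ws s where ws: "set ws \<subseteq> Sa \<Phi> \<Delta>" "s \<in> Sa \<Phi> \<Delta>" "refl_aff a n = conj_by (wprod ws) s"
      using reflection_conj_simple[OF a] .
    have "refl_aff a n = wprod (ws @ [s] @ rev ws)" using ws rv by (simp add: conj_by_def comp_assoc)
    then show ?thesis using ws by (intro exI[of _ "ws @ [s] @ rev ws"]) auto
  qed
  fix w assume "w \<in> Wa \<Phi>"
  then obtain ws where ws: "w = wprod ws" "set ws \<subseteq> {refl_aff a n | a n. a \<in> \<Phi>}"
    unfolding Wa_words by blast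
  have "\<exists>us. set us \<subseteq> Sa \<Phi> \<Delta> \<and> wprod ws = wprod us" using ws(2)
  proof (induction ws)
    case Nil
    show "\<exists>us. set us \<subseteq> Sa \<Phi> \<Delta> \<and> wprod [] = wprod us" by (intro exI[of _ "[]"]) simp
  next
    case (Cons r ws)
    then obtain us vs where "set us \<subseteq> Sa \<Phi> \<Delta>" "wprod ws = wprod us" "set vs \<subseteq> Sa \<Phi> \<Delta>" "r = wprod vs"
      using gen by force
    then show "\<exists>us. set us \<subseteq> Sa \<Phi> \<Delta> \<and> wprod (r # ws) = wprod us"
      by (intro exI[of _ "vs @ us"]) simp
  qed
  then show "w \<in> {wprod ws | ws. set ws \<subseteq> Sa \<Phi> \<Delta>}" using ws(1) by blast
qed

lemma simple_conj:
  assumes "a \<in> \<Phi>\<^sub>+"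
  shows "\<exists>ws b. set ws \<subseteq> S0 \<Delta> \<and> b \<in> \<Delta> \<and> a = wprod ws b"
  using assms
proof (induction rule: pos_induct)
  case (simple b)
  then show ?case by (intro exI[of _ "[]"] exI[of _ b]) simp
next
  case (refl a b)
  then obtain ws d where "set ws \<subseteq> S0 \<Delta>" "d \<in> \<Delta>" "a = wprod ws d" by blast
  then show ?case using refl(2) by (intro exI[of _ "rfl b # ws"] exI[of _ d]) (auto simp: S0_def)
qed

lemma S0_involution: "s \<in> S0 \<Delta> \<Longrightarrow> s \<circ> s = id"
  unfolding S0_def using refl_aff_involution root_nz simple_root by blast

lemma S0_Sa: "s \<in> S0 \<Delta> \<Longrightarrow> s \<in> Sa \<Phi> \<Delta>"
  unfolding Sa_def by blast

lemma Wf_S0_words: "Wf = {wprod ws | ws. set ws \<subseteq> S0 \<Delta>}"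
proof -
  have eq: "gen_group (S0 \<Delta>) = {wprod ws | ws. set ws \<subseteq> S0 \<Delta>}"
    by (rule gen_group_involutions[OF S0_involution])
  have sub: "gen_group (S0 \<Delta>) \<subseteq> Wf"
    unfolding Wf_def using gen_group_mono[of "S0 \<Delta>" "{rfl a | a. a \<in> \<Phi>}"] simple_root
    unfolding S0_def by blast
  have pos: "rfl a \<in> gen_group (S0 \<Delta>)" if a: "a \<in> \<Phi>\<^sub>+" for a
  proof -
    obtain ws b where ws: "set ws \<subseteq> S0 \<Delta>" "b \<in> \<Delta>" "a = wprod ws b" using simple_conj[OF a] by blast
    let ?w = "wprod ws"
    have w: "?w \<in> gen_group (S0 \<Delta>)" using eq ws by blast
    then have wf: "?w \<in> Wf" using sub by blast
    have "inv ?w = wprod (rev ws)"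
      using ws(1) S0_involution by (intro wprod_involutions(3)) auto
    then have iw: "inv ?w \<in> gen_group (S0 \<Delta>)"
      unfolding eq using ws(1) by (intro CollectI exI[of _ "rev ws"]) simp
    have "conj_by ?w (rfl b) = rfl a"
      using conj_refl_aff[OF Wf_Ext[OF wf] simple_root[OF ws(2)], of 0] lin_Wf[OF wf] ws(3)
        Wf_0[OF wf] by (simp add: shift_def pairing_zero)
    moreover have "rfl b \<in> gen_group (S0 \<Delta>)"
      by (rule gen_group_base) (use ws(2) in \<open>auto simp: S0_def\<close>)
    ultimately show ?thesis using gen_group_comp w iw unfolding conj_by_def by metis
  qed
  have "Wf \<subseteq> gen_group (S0 \<Delta>)"
  proof
    fix u assume "u \<in> Wf"
    then show "u \<in> gen_group (S0 \<Delta>)"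
    proof (induction rule: Wf_induct)
      case id
      show ?case by (rule gen_group.one)
    next
      case (refl a u)
      have "rfl a \<in> gen_group (S0 \<Delta>)"
        using root_cases[OF refl(1)] pos[of a] pos[of "- a"] refl_aff_minus_zero[of a] by metis
      then show ?case using gen_group_comp refl by blast
    qed
  qed
  then show ?thesis using sub eq by blast
qed

definition Nrefl :: "('a \<Rightarrow> 'a) \<Rightarrow> ('a \<Rightarrow> 'a) set" where "Nrefl w = Sep c0 (w c0)"

lemma Nrefl_comp:
  assumes "x \<in> Ext" "y \<in> Ext" shows "Nrefl (x \<circ> y) = sym_diff (Nrefl x) (conj_by x ` Nrefl y)"
  unfolding Nrefl_def comp_apply Sep_image[OF assms(1), symmetric]
  by (intro Sep_triangle c0_regular regular_Ext[OF assms(1)] regular_Ext[OF assms(2)])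

sublocale aff: reflection_cocycle "Wa \<Phi>" "Sa \<Phi> \<Delta>" Nrefl
proof
  show "Wa \<Phi> = {wprod ws | ws. set ws \<subseteq> Sa \<Phi> \<Delta>}" by (rule Wa_Sa_words)
  show "s \<circ> s = id" "Nrefl s = {s}" if "s \<in> Sa \<Phi> \<Delta>" for s
    using that by (auto simp only: Nrefl_def Sa_involution Sep_simple)
  show "Nrefl (x \<circ> y) = sym_diff (Nrefl x) (conj_by x ` Nrefl y)" if "x \<in> Wa \<Phi>" "y \<in> Wa \<Phi>" for x y
    using that by (intro Nrefl_comp Wa_Ext)
qed

text \<open>The cocycle is the same as for the affine group, so the two lengths of an element of
  \<open>W0\<close> coincide.\<close>

sublocale fin: reflection_cocycle "W0 \<Phi>" "S0 \<Delta>" Nrefl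
proof
  show "W0 \<Phi> = {wprod ws | ws. set ws \<subseteq> S0 \<Delta>}" using W0_eq Wf_S0_words by simp
  show "s \<circ> s = id" "Nrefl s = {s}" if "s \<in> S0 \<Delta>" for s
    using that by (auto simp only: Nrefl_def S0_involution Sep_simple[OF S0_Sa])
  show "Nrefl (x \<circ> y) = sym_diff (Nrefl x) (conj_by x ` Nrefl y)" if "x \<in> W0 \<Phi>" "y \<in> W0 \<Phi>" for x y
    using that unfolding W0_eq by (intro Nrefl_comp Wf_Ext)
qed

end

section \<open>Weights of hyperplanes\<close>

lemma hyp_alt: "hyp a n = {x. coroot a \<bullet> x = of_int n}"
  unfolding hyp_def pairing_coroot by (simp add: inner_commute)

lemma hyp_minus: "hyp (- a) (- n) = hyp a n"
  by (auto simp: hyp_def pairing_minus_right)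

lemma affine_hyp: "affine (hyp a n)"
  unfolding hyp_alt by (rule affine_hyperplane)

lemma aff_dim_hyp: "a \<noteq> 0 \<Longrightarrow> aff_dim (hyp (a::'a::euclidean_space) n) = int DIM('a) - 1"
  unfolding hyp_alt using aff_dim_hyperplane[OF coroot_nz] by auto

lemma hyp_nonempty: assumes "a \<noteq> 0" shows "(of_int n / 2) *\<^sub>R a \<in> hyp a n"
  using assms by (simp add: hyp_def pairing_scale pairing_self)

context irreducible_base begin

text \<open>Let \<open>y\<close> be the component of \<open>b\<close> orthogonal to
  \<open>a\<close>. Moving along \<open>y\<close> stays in the hyperplane, so \<open>y\<close> is
  orthogonal to \<open>b\<close> as well and therefore zero.\<close>

lemma hyp_inject:
  assumes "a \<in> \<Phi>" "b \<in> \<Phi>" "hyp a n = hyp b m"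
  shows "b = a \<and> m = n \<or> b = - a \<and> m = - n"
proof -
  have nz: "a \<noteq> 0" "b \<noteq> 0" using assms root_nz by blast+
  define p where "p = (of_int n / 2) *\<^sub>R a"
  have p: "p \<in> hyp a n" unfolding p_def by (rule hyp_nonempty[OF nz(1)])
  define y where "y = b - ((b \<bullet> a) / (a \<bullet> a)) *\<^sub>R a"
  have ya: "y \<bullet> a = 0" using nz by (simp add: y_def inner_diff_left)
  then have "pairing y a = 0" by (simp add: pairing_def)
  then have "p + y \<in> hyp a n" using p by (simp add: hyp_def pairing_add)
  then have "p + y \<in> hyp b m" "p \<in> hyp b m" using p assms(3) by blast+
  then have "pairing y b = 0" by (simp add: hyp_def pairing_add)
  then have "y \<bullet> b = 0" using nz by (simp add: pairing_def)
  then have "y \<bullet> y = 0" using ya by (subst (2) y_def) (simp add: inner_diff_right)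
  then have b: "b = ((b \<bullet> a) / (a \<bullet> a)) *\<^sub>R a" by (simp add: y_def)
  then have "b = a \<or> b = - a" using reduced[of a "(b \<bullet> a) / (a \<bullet> a)"] assms(1,2)
    by (metis scaleR_minus1_left scaleR_one)
  moreover have "p \<in> hyp b m" using p assms(3) by blast
  then have "pairing p b = of_int m" "pairing p a = of_int n" using p by (simp_all add: hyp_def)
  ultimately show ?thesis by (auto simp: pairing_minus_right)
qed

lemma refl_aff_eq_iff_hyp:
  assumes "a \<in> \<Phi>" "b \<in> \<Phi>" shows "hyp a n = hyp b m \<longleftrightarrow> refl_aff a n = refl_aff b m"
proof
  assume "hyp a n = hyp b m"
  from hyp_inject[OF assms this] show "refl_aff a n = refl_aff b m"
    using refl_aff_minus[of a n] by (elim disjE conjE) simp_all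
next
  assume "refl_aff a n = refl_aff b m"
  from refl_aff_eq_cases[OF assms this] show "hyp a n = hyp b m"
    using hyp_minus[of a n] by (elim disjE conjE) simp_all
qed

lemma Ext_hyp:
  assumes "g \<in> Ext" "a \<in> \<Phi>" shows "g ` hyp a n = hyp (lin g a) (n + shift g a)"
proof (intro equalityI subsetI)
  fix x assume "x \<in> g ` hyp a n"
  then show "x \<in> hyp (lin g a) (n + shift g a)"
    using Ext_pairing[OF assms] by (auto simp: hyp_def)
next
  fix x assume x: "x \<in> hyp (lin g a) (n + shift g a)"
  have "x = g (inv g x)" using Ext_bij[OF assms(1)] by (simp add: bij_is_surj surj_f_inv_f)
  moreover from this have "inv g x \<in> hyp a n"
    using Ext_pairing[OF assms, of "inv g x"] x by (auto simp: hyp_def)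
  ultimately show "x \<in> g ` hyp a n" by blast
qed

subsection \<open>Faces of the fundamental alcove\<close>

text \<open>The open face of the fundamental alcove on the wall \<open>(b, k)\<close>, described by
  strict inequalities for the other walls. It supplies the faces whose types define the weight of a
  hyperplane.\<close>

definition wall_face :: "'a \<Rightarrow> int \<Rightarrow> 'a set" where
  "wall_face b k = {y \<in> hyp b k. \<forall>(b', k')\<in>walls - {(b, k)}. pairing y b' > of_int k'}"

lemma wall_faceD:
  assumes "y \<in> wall_face b k"
  shows "pairing y b = of_int k"
    and "(b', k') \<in> walls \<Longrightarrow> (b', k') \<noteq> (b, k) \<Longrightarrow> pairing y b' > of_int k'"
  using assms unfolding wall_face_def hyp_def by blast+

lemma finite_walls: "finite walls"
  unfolding walls_def using finite_simple by simp

text \<open>On a simple wall, take a point with pairing 0 at \<open>b\<close> and 1 at the other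
  simple roots, scaled down below the upper wall. On the upper wall, take pairing 1 at all simple
  roots, scaled to have pairing 1 with \<open>\<theta>\<close>.\<close>

lemma wall_face_nonempty:
  assumes "(b, k) \<in> walls" shows "wall_face b k \<noteq> {}"
proof (cases "b \<in> \<Delta> \<and> k = 0")
  case True
  obtain x where x: "\<forall>b'\<in>\<Delta>. pairing x b' = (if b' = b then 0 else 1)"
    using dual_point[of "\<lambda>b'. if b' = b then 0 else 1"] by blast
  have t: "pairing x \<theta> \<ge> 0" using pairing_nonneg_pos[OF theta_pos, of x] x by simp
  define M where "M = pairing x \<theta> + 1"
  have M: "M > 0" "pairing x \<theta> < M" using t by (auto simp: M_def)
  have "(1 / M) *\<^sub>R x \<in> wall_face b k"
    unfolding wall_face_def walls_def hyp_def using x M True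
    by (auto simp: pairing_scale pairing_minus_right split: if_splits)
  then show ?thesis by blast
next
  case False
  then have b: "b = - \<theta>" "k = -1" using assms by (auto simp: walls_def)
  obtain x where x: "\<forall>b\<in>\<Delta>. pairing x b = 1" using dual_point[of "\<lambda>_. 1"] by auto
  have t: "pairing x \<theta> > 0" using pairing_pos_of_simple[OF theta_pos, of x] x by simp
  have "(1 / pairing x \<theta>) *\<^sub>R x \<in> wall_face b k"
    unfolding wall_face_def walls_def hyp_def using x t b
    by (auto simp: pairing_scale pairing_minus_right)
  then show ?thesis by blast
qed

text \<open>If the pairing were not positive, every coefficient of \<open>coroot a\<close> away from
  \<open>coroot b\<close> would vanish, and \<open>a\<close> would be equal to
  \<open>b\<close>.\<close>

lemma pairing_pos_off_wall:
  assumes "a \<in> \<Phi>\<^sub>+" "a \<noteq> b" "b \<in> \<Delta>" "pairing y b = 0"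
    "\<And>b'. b' \<in> \<Delta> \<Longrightarrow> b' \<noteq> b \<Longrightarrow> pairing y b' > 0"
  shows "pairing y a > 0"
proof (rule ccontr)
  assume neg: "\<not> pairing y a > 0"
  interpret dual: root_base "coroot ` \<Phi>" "coroot ` \<Delta>" by (rule dual_root_base)
  obtain c where c: "coroot a = (\<Sum>x\<in>coroot ` \<Delta>. of_nat (c x) *\<^sub>R x)"
    using coroot_pos[OF assms(1)] unfolding nat_combs_def by auto
  have pos: "y \<bullet> x > 0" if "x \<in> coroot ` \<Delta>" "x \<noteq> coroot b" for x
    using that assms(5) by (auto simp: pairing_coroot)
  have yb: "y \<bullet> coroot b = 0" using assms(4) by (simp add: pairing_coroot)
  have nn: "of_nat (c x) * (y \<bullet> x) \<ge> 0" if "x \<in> coroot ` \<Delta>" for x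
    using pos[OF that] yb by (cases "x = coroot b") (auto simp: less_imp_le)
  have "pairing y a = (\<Sum>x\<in>coroot ` \<Delta>. of_nat (c x) * (y \<bullet> x))"
    unfolding pairing_coroot c by (simp add: inner_sum_right)
  moreover have "(\<Sum>x\<in>coroot ` \<Delta>. of_nat (c x) * (y \<bullet> x)) \<ge> 0" using nn by (rule sum_nonneg)
  ultimately have "(\<Sum>x\<in>coroot ` \<Delta>. of_nat (c x) * (y \<bullet> x)) = 0" using neg by linarith
  then have "\<forall>x\<in>coroot ` \<Delta>. of_nat (c x) * (y \<bullet> x) = 0"
    using sum_nonneg_eq_0_iff[OF dual.finite_simple, of "\<lambda>x. of_nat (c x) * (y \<bullet> x)"] nn by blast
  then have z: "of_nat (c x) * (y \<bullet> x) = 0" if "x \<in> coroot ` \<Delta>" for x using that by blast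
  have cx: "c x = 0" if "x \<in> coroot ` \<Delta> - {coroot b}" for x
    using z[of x] pos[of x] that by auto
  have "coroot a = of_nat (c (coroot b)) *\<^sub>R coroot b + (\<Sum>x\<in>coroot ` \<Delta> - {coroot b}. of_nat (c x) *\<^sub>R x)"
    unfolding c using assms(3) dual.finite_simple by (subst sum.remove[of _ "coroot b"]) auto
  also have "(\<Sum>x\<in>coroot ` \<Delta> - {coroot b}. of_nat (c x) *\<^sub>R x) = 0"
    using cx by (intro sum.neutral) auto
  finally have ceq: "coroot a = of_nat (c (coroot b)) *\<^sub>R coroot b" by simp
  have "coroot b \<in> dual.pos" using dual.simple_pos assms(3) by blast
  moreover have "coroot a \<in> dual.pos"
    using coroot_pos[OF assms(1)] pos_root[OF assms(1)] by (simp add: pos_roots_def)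
  ultimately have "coroot b = coroot a" using dual.pos_proportional ceq by blast
  then have "coroot (coroot b) = coroot (coroot a)" by simp
  then show False
    using assms(2) coroot_coroot[OF pos_nz[OF assms(1)]] coroot_coroot[OF root_nz[OF simple_root[OF assms(3)]]]
    by simp
qed

lemma wall_face_values:
  assumes "(b, k) \<in> walls" "y \<in> wall_face b k" "a \<in> \<Phi>\<^sub>+"
  shows "(a = b \<or> a = - b) \<or> (0 < pairing y a \<and> pairing y a < 1)"
proof -
  note yb = wall_faceD(1)[OF assms(2)] and w = wall_faceD(2)[OF assms(2)]
  show ?thesis
  proof (cases "b \<in> \<Delta> \<and> k = 0")
    case True
    have y: "pairing y b = 0" "\<And>b'. b' \<in> \<Delta> \<Longrightarrow> b' \<noteq> b \<Longrightarrow> pairing y b' > 0" "pairing y \<theta> < 1"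
      using yb w[of _ 0] w[of "- \<theta>" "-1"] True by (auto simp: walls_def pairing_minus_right)
    have "pairing y b' \<ge> 0" if "b' \<in> \<Delta>" for b' using y that by (cases "b' = b") (auto simp: less_imp_le)
    then have "pairing y a < 1"
      by (rule le_less_trans[OF theta_highest_pairing[OF pos_root[OF assms(3)]] y(3)])
    then show ?thesis using pairing_pos_off_wall[OF assms(3) _ _ y(1,2)] True by blast
  next
    case False
    then have b: "b = - \<theta>" "k = -1" using assms by (auto simp: walls_def)
    have y: "pairing y \<theta> = 1" "\<And>b'. b' \<in> \<Delta> \<Longrightarrow> pairing y b' > 0"
      using yb w[of _ 0] b by (auto simp: walls_def pairing_minus_right)
    show ?thesis
      using theta_highest_strict[OF pos_root[OF assms(3)], of y] y pairing_pos_of_simple[OF assms(3), of y] b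
      by auto
  qed
qed

text \<open>Facets are classes of equal sign patterns. On the face every positive root other than
  the one of the wall takes values strictly between 0 and 1, so the pattern is constant, and the
  pattern in turn recovers the defining inequalities.\<close>

lemma wall_face_facet:
  assumes "(b, k) \<in> walls" shows "wall_face b k \<in> facets \<Phi>"
proof -
  obtain p where p: "p \<in> wall_face b k" using wall_face_nonempty[OF assms] by blast
  let ?R = "{(x, y). \<forall>\<alpha>\<in>\<Phi>. \<forall>n::int. sgn (pairing x \<alpha> - of_int n) = sgn (pairing y \<alpha> - of_int n)}"
  have br: "b \<in> \<Phi>" using wall_root[OF assms] .
  have "wall_face b k = ?R `` {p}"
  proof (intro equalityI subsetI)
    fix y assume y: "y \<in> wall_face b k"
    have eq: "pairing p b = pairing y b" using p y by (auto simp: wall_face_def hyp_def)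
    have pos: "sgn (pairing p a - of_int n) = sgn (pairing y a - of_int n)" if a: "a \<in> \<Phi>\<^sub>+" for a n
    proof -
      consider "a = b \<or> a = - b" | "0 < pairing p a" "pairing p a < 1" "0 < pairing y a" "pairing y a < 1"
        using wall_face_values[OF assms p a] wall_face_values[OF assms y a] by blast
      then show ?thesis
      proof cases
        case 1
        then show ?thesis using eq by (auto simp: pairing_minus_right)
      next
        case 2
        then have "(pairing p a - of_int n) * (pairing y a - of_int n) > 0"
          using same_int_interval[of 0 "pairing p a" "pairing y a" n] by simp
        then show ?thesis by (auto simp: zero_less_mult_iff)
      qed
    qed
    have "sgn (pairing p a - of_int n) = sgn (pairing y a - of_int n)" if a: "a \<in> \<Phi>" for a n
    proof (cases "a \<in> \<Phi>\<^sub>+")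
      case False
      then have "- a \<in> \<Phi>\<^sub>+" using root_cases[OF a] by blast
      from pos[OF this, of "- n"] have "sgn (- (pairing p a - of_int n)) = sgn (- (pairing y a - of_int n))"
        by (simp add: pairing_minus_right algebra_simps)
      then show ?thesis unfolding sgn_minus by simp
    qed (rule pos)
    then show "y \<in> ?R `` {p}" by auto
  next
    fix y assume "y \<in> ?R `` {p}"
    then have y: "sgn (pairing p a - of_int n) = sgn (pairing y a - of_int n)" if "a \<in> \<Phi>" for a n
      using that by auto
    have "pairing y b = of_int k"
      using y[OF br, of k] p by (simp add: wall_face_def hyp_def sgn_0_0)
    moreover have "pairing y b' > of_int k'" if "(b', k') \<in> walls - {(b, k)}" for b' k'
    proof -
      have "pairing p b' - of_int k' > 0" using p that by (auto simp: wall_face_def)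
      then have "sgn (pairing y b' - of_int k') = 1" using y[OF wall_root, of b' k' k'] that by auto
      then show ?thesis by (simp add: sgn_1_pos)
    qed
    ultimately show "y \<in> wall_face b k" by (auto simp: wall_face_def hyp_def)
  qed
  then show ?thesis unfolding facets_def quotient_def by blast
qed

lemma wall_face_aff_dim:
  assumes "(b, k) \<in> walls" shows "aff_dim (wall_face b k) = int DIM('a) - 1"
proof -
  have bnz: "b \<noteq> 0" using wall_root[OF assms] root_nz by blast
  let ?T = "\<Inter>w\<in>walls - {(b, k)}. {y. coroot (fst w) \<bullet> y > of_int (snd w)}"
  have "open ?T" using finite_walls by (intro open_INT) (auto intro: open_halfspace_gt)
  moreover have "wall_face b k = hyp b k \<inter> ?T"
    unfolding wall_face_def pairing_coroot by (force simp: inner_commute)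
  ultimately have "openin (top_of_set (hyp b k)) (wall_face b k)" by (auto simp: openin_open)
  from aff_dim_openin[OF this affine_hyp wall_face_nonempty[OF assms]]
  show ?thesis using aff_dim_hyp[OF bnz] by simp
qed

text \<open>The open segment from \<open>y\<close> to \<open>c0\<close> lies in the alcove.\<close>

lemma wall_face_closure:
  assumes "(b, k) \<in> walls" shows "wall_face b k \<subseteq> closure (A0 \<Phi> \<Delta>)"
proof
  fix y assume y: "y \<in> wall_face b k"
  define f where "f t = y + t *\<^sub>R (c0 - y)" for t :: real
  have A: "f t \<in> A0 \<Phi> \<Delta>" if t: "0 < t" "t < 1" for t
    unfolding mem_A0_walls
  proof (clarify)
    fix b' k' assume w: "(b', k') \<in> walls"
    have "pairing y b' \<ge> of_int k'"
      using wall_faceD[OF y] w by (cases "(b', k') = (b, k)") (simp, meson less_imp_le)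
    moreover have "pairing c0 b' > of_int k'" using wall_c0[OF w] .
    moreover have "pairing (f t) b' - of_int k' = (1 - t) * (pairing y b' - of_int k') + t * (pairing c0 b' - of_int k')"
      by (simp add: f_def pairing_add pairing_scale pairing_diff algebra_simps)
    moreover have "(1 - t) * (pairing y b' - of_int k') \<ge> 0" "t * (pairing c0 b' - of_int k') > 0"
      using calculation(1,2) t by auto
    ultimately show "pairing (f t) b' > of_int k'" by linarith
  qed
  have "(\<lambda>n. f (inverse (real (Suc (Suc n))))) \<longlonglongrightarrow> y + 0 *\<^sub>R (c0 - y)"
    unfolding f_def by (intro tendsto_intros LIMSEQ_Suc[OF LIMSEQ_inverse_real_of_nat])
  then have "(\<lambda>n. f (inverse (real (Suc (Suc n))))) \<longlonglongrightarrow> y" by simp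
  moreover have "f (inverse (real (Suc (Suc n)))) \<in> A0 \<Phi> \<Delta>" for n
    by (rule A) (auto simp: inverse_less_1_iff)
  ultimately show "y \<in> closure (A0 \<Phi> \<Delta>)" unfolding closure_sequential
    by (intro exI[of _ "\<lambda>n. f (inverse (real (Suc (Suc n))))"] conjI allI)
qed

lemma wall_face_in_faces:
  "(b, k) \<in> walls \<Longrightarrow> wall_face b k \<in> faces \<Phi> (A0 \<Phi> \<Delta>)"
  unfolding faces_def using wall_face_facet wall_face_aff_dim wall_face_closure by blast

lemma aff_dim_Ext: assumes "g \<in> Ext" shows "aff_dim (g ` A) = aff_dim A"
proof -
  have "g ` A = (+) (g 0) ` (lin g ` A)"
    by (subst Ext_form[OF assms]) (simp add: image_comp transl_def comp_def)
  then show ?thesis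
    using aff_dim_injective_linear_image[of "lin g" A] Wf_linear Wf_bij Ext_lin[OF assms]
    by (simp add: aff_dim_translation_eq linear_conv_bounded_linear bij_is_inj)
qed

end

locale weighted_base = irreducible_base +
  fixes L :: "('a \<Rightarrow> 'a) \<Rightarrow> nat"
  assumes weight_function: "pos_weight_function \<Phi> \<Delta> L"
    and zero_weight: "0 \<in> L_weights \<Phi> \<Delta> L"
begin

lemma len_simple: "s \<in> Sa \<Phi> \<Delta> \<Longrightarrow> aff.len s = 1"
  using aff.len_card_N[OF Sa_Wa] aff.N_simple by simp

sublocale weighted_cocycle "Wa \<Phi>" "Sa \<Phi> \<Delta>" Nrefl L
proof
  have L_add: "L (w \<circ> w') = L w + L w'"
    if "w \<in> Wa \<Phi>" "w' \<in> Wa \<Phi>" "aff.len (w \<circ> w') = aff.len w + aff.len w'" for w w'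
    using weight_function that unfolding pos_weight_function_def by blast
  show "L (w \<circ> s) = L w + L s" if "w \<in> Wa \<Phi>" "s \<in> Sa \<Phi> \<Delta>" "aff.len (w \<circ> s) = Suc (aff.len w)" for w s
    using L_add[OF that(1) Sa_Wa[OF that(2)]] that(3) len_simple[OF that(2)] by simp
  show "L (s \<circ> w) = L s + L w" if "w \<in> Wa \<Phi>" "s \<in> Sa \<Phi> \<Delta>" "aff.len (s \<circ> w) = Suc (aff.len w)" for w s
    using L_add[OF Sa_Wa[OF that(2)] that(1)] that(3) len_simple[OF that(2)] by simp
  have "aff.len id = 0" using aff.len_card_N[OF aff.id_in_W] aff.N_id by simp
  then show "L id = 0" using L_add[OF aff.id_in_W aff.id_in_W] by simp
  show "L s > 0" if "s \<in> Sa \<Phi> \<Delta>" for s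
    using weight_function that unfolding pos_weight_function_def by blast
qed

text \<open>The image of a wall face witnesses the value. Conversely, any face of type
  \<open>s'\<close> in the hyperplane spans it, so the same reflection is conjugate to both
  \<open>s\<close> and \<open>s'\<close>, and \<open>weight_conj\<close> equates their
  weights.\<close>

lemma L_hyp_eq:
  assumes "a \<in> \<Phi>" "w \<in> Wa \<Phi>" "s \<in> Sa \<Phi> \<Delta>" "refl_aff a n = conj_by w s"
  shows "L_hyp \<Phi> \<Delta> L (hyp a n) = L s"
  unfolding L_hyp_def
proof (rule the_equality)
  obtain b k where b: "(b, k) \<in> walls" "s = refl_aff b k" using assms(3) unfolding Sa_walls by auto
  have bnz: "b \<noteq> 0" using wall_root[OF b(1)] root_nz by blast
  have fix_s: "wall_face b k \<subseteq> {x. s x = x}" unfolding b(2) refl_fixed[OF bnz] by (auto simp: wall_face_def)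
  then have "has_type \<Phi> \<Delta> (w ` wall_face b k) s"
    unfolding has_type_def using assms(2) wall_face_in_faces[OF b(1)] by blast
  moreover have "w ` wall_face b k \<subseteq> hyp a n"
  proof
    fix y assume "y \<in> w ` wall_face b k"
    then obtain x where x: "y = w x" "s x = x" using fix_s by blast
    have "refl_aff a n y = y"
      unfolding assms(4) x(1) conj_by_def using x(2) aff.W_bij[OF assms(2)] by (simp add: bij_is_inj)
    then show "y \<in> hyp a n" using refl_fixed[OF root_nz[OF assms(1)], of n] by blast
  qed
  ultimately show "\<exists>s'\<in>Sa \<Phi> \<Delta>. \<exists>F. has_type \<Phi> \<Delta> F s' \<and> F \<subseteq> hyp a n \<and> L s = L s'"
    using assms(3) by blast
next
  fix m assume "\<exists>s'\<in>Sa \<Phi> \<Delta>. \<exists>F. has_type \<Phi> \<Delta> F s' \<and> F \<subseteq> hyp a n \<and> m = L s'"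
  then obtain s' F where s': "s' \<in> Sa \<Phi> \<Delta>" "has_type \<Phi> \<Delta> F s'" "F \<subseteq> hyp a n" "m = L s'" by blast
  obtain w' G where w': "w' \<in> Wa \<Phi>" "G \<in> faces \<Phi> (A0 \<Phi> \<Delta>)" "G \<subseteq> {x. s' x = x}" "F = w' ` G"
    using s'(2) unfolding has_type_def by blast
  obtain b k where b: "b \<in> \<Phi>" "s' = refl_aff b k" using Sa_reflection[OF s'(1)] by blast
  have w'E: "w' \<in> Ext" using Wa_Ext w'(1) .
  define a' n' where "a' = lin w' b" and "n' = k + shift w' b"
  have a': "a' \<in> \<Phi>" unfolding a'_def using Wf_root[OF Ext_lin[OF w'E] b(1)] .
  have cj: "conj_by w' s' = refl_aff a' n'" unfolding b(2) a'_def n'_def by (rule conj_refl_aff[OF w'E b(1)])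
  have "G \<subseteq> hyp b k" using w'(3) refl_fixed[OF root_nz[OF b(1)], of k] b(2) by simp
  then have "F \<subseteq> w' ` hyp b k" unfolding w'(4) by (rule image_mono)
  then have F': "F \<subseteq> hyp a' n'" unfolding a'_def n'_def Ext_hyp[OF w'E b(1)] .
  have dimF: "aff_dim F = int DIM('a) - 1"
    using w'(2) unfolding w'(4) aff_dim_Ext[OF w'E] faces_def by blast
  have ne: "F \<noteq> {}"
  proof
    assume "F = {}"
    then have "int DIM('a) = 0" using dimF by simp
    then show False using DIM_positive[where 'a = 'a] by linarith
  qed
  \<comment> \<open>A face has the dimension of the hyperplane containing it and so determines
    it.\<close>
  have hull: "affine hull F = hyp d m'" if "d \<in> \<Phi>" "F \<subseteq> hyp d m'" for d m'
  proof (rule affine_dim_equal)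
    show "affine hull F \<subseteq> hyp d m'" by (rule hull_minimal[where S = affine, OF that(2) affine_hyp])
    show "aff_dim (affine hull F) = aff_dim (hyp d m')"
      using dimF aff_dim_hyp[OF root_nz[OF that(1)], of m'] by simp
  qed (use ne affine_hyp in auto)
  have "hyp a n = hyp a' n'" using hull[OF assms(1) s'(3)] hull[OF a' F'] by simp
  then have "conj_by w s = conj_by w' s'"
    using refl_aff_eq_iff_hyp[OF assms(1) a'] assms(4) cj by simp
  then have "s = conj_by (inv w) (conj_by w' s')"
    using aff.W_bij[OF assms(2)] by (metis conj_by_inv(1))
  then have "s = conj_by (inv w \<circ> w') s'"
    using conj_by_comp[OF bij_imp_bij_inv[OF aff.W_bij[OF assms(2)]] aff.W_bij[OF w'(1)]] by simp
  from weight_conj[OF aff.W_comp[OF aff.W_inv[OF assms(2)] w'(1)] s'(1) assms(3) this[symmetric]]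
  show "m = L s" unfolding s'(4) .
qed

section \<open>Weights of parallel hyperplanes\<close>

abbreviation Lh :: "'a \<Rightarrow> int \<Rightarrow> nat" where "Lh a n \<equiv> L_hyp \<Phi> \<Delta> L (hyp a n)"

lemma Lh_minus: "Lh (- a) (- n) = Lh a n"
  by (simp add: hyp_minus)

lemma Lh_cases:
  assumes "a \<in> \<Phi>"
  obtains w s where "w \<in> Wa \<Phi>" "s \<in> Sa \<Phi> \<Delta>" "refl_aff a n = conj_by w s" "Lh a n = L s"
proof -
  obtain ws s where ws: "set ws \<subseteq> Sa \<Phi> \<Delta>" "s \<in> Sa \<Phi> \<Delta>" "refl_aff a n = conj_by (wprod ws) s"
    using reflection_conj_simple[OF assms] .
  show thesis using that[OF aff.wprod_in_W[OF ws(1)] ws(2,3)] L_hyp_eq[OF assms aff.wprod_in_W[OF ws(1)] ws(2,3)] .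
qed

lemma Lh_pos: "a \<in> \<Phi> \<Longrightarrow> Lh a n > 0"
  by (rule Lh_cases[of a n]) (auto simp: weight_pos)

lemma Lh_Wa:
  assumes "g \<in> Wa \<Phi>" "a \<in> \<Phi>" shows "Lh (lin g a) (n + shift g a) = Lh a n"
proof -
  have g: "g \<in> Ext" using Wa_Ext assms(1) .
  obtain w s where w: "w \<in> Wa \<Phi>" "s \<in> Sa \<Phi> \<Delta>" "refl_aff a n = conj_by w s" "Lh a n = L s"
    using Lh_cases[OF assms(2)] .
  have "refl_aff (lin g a) (n + shift g a) = conj_by (g \<circ> w) s"
    using conj_refl_aff[OF g assms(2), of n] w(3) conj_by_comp[OF aff.W_bij[OF assms(1)] aff.W_bij[OF w(1)]] by simp
  then show ?thesis
    using L_hyp_eq[OF Wf_root[OF Ext_lin[OF g] assms(2)] aff.W_comp[OF assms(1) w(1)] w(2)] w(4) by simp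
qed

lemma Lh_Wf: "u \<in> Wf \<Longrightarrow> a \<in> \<Phi> \<Longrightarrow> Lh (u a) n = Lh a n"
  using Lh_Wa[OF Wf_Wa, of u a n] lin_Wf[of u] Wf_0[of u] by (simp add: shift_def pairing_zero)

lemma transl_root_Wa: assumes "b \<in> \<Phi>" shows "transl b \<in> Wa \<Phi>"
proof -
  have "refl_aff b 1 \<circ> refl_aff b 0 = transl b \<circ> (refl_aff b 0 \<circ> refl_aff b 0)"
    by (simp add: refl_aff_alt[of b 1] comp_assoc)
  also have "\<dots> = transl b" using refl_aff_involution[OF root_nz[OF assms]] by simp
  finally show ?thesis using aff.W_comp refl_in_Wa[OF assms] by metis
qed

lemma Lh_transl: assumes "a \<in> \<Phi>" "b \<in> \<Phi>" "pairing b a = of_int k" shows "Lh a (n + k) = Lh a n"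
proof -
  have l: "lin (transl b) = id" using lin_Ext[OF id_Wf, of b] by simp
  then have "shift (transl b) a = k" using assms(3) by (simp add: shift_def transl_def)
  then show ?thesis using Lh_Wa[OF transl_root_Wa[OF assms(2)] assms(1), of n] l by simp
qed

text \<open>The translation by \<open>a\<close> itself belongs to the affine Weyl group and moves
  labels by 2. Hence only \<open>Lh a 0\<close> and \<open>Lh a 1\<close> can occur.\<close>

lemma Lh_even: assumes "a \<in> \<Phi>" shows "Lh a (n + 2 * k) = Lh a n"
proof -
  have step: "Lh a (n + 2) = Lh a n" for n
    using Lh_transl[OF assms assms, of 2] pairing_self[OF root_nz[OF assms]] by simp
  show ?thesis
  proof (induction k rule: int_induct[where k = 0])
    case (step1 i)
    then show ?case using step[of "n + 2 * i"] by (simp add: algebra_simps)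
  next
    case (step2 i)
    then show ?case using step[of "n + 2 * (i - 1)"] by (simp add: algebra_simps)
  qed simp
qed

text \<open>The translation by \<open>b\<close> exchanges even and odd labels. So two different
  weights in direction \<open>a\<close> force all roots to pair evenly with
  \<open>a\<close>.\<close>

lemma Lh_odd:
  assumes "a \<in> \<Phi>" "b \<in> \<Phi>" "pairing b a = of_int k" "odd k" shows "Lh a n = Lh a 0"
proof -
  obtain m where m: "k = 2 * m + 1" using assms(4) by (rule oddE)
  have "Lh a 1 = Lh a 0"
    using Lh_transl[OF assms(1-3), of 0] Lh_even[OF assms(1), of 1 m] m by (simp add: algebra_simps)
  moreover have "n = 0 + 2 * (n div 2) \<or> n = 1 + 2 * (n div 2)" by presburger
  ultimately show ?thesis using Lh_even[OF assms(1), of 0 "n div 2"] Lh_even[OF assms(1), of 1 "n div 2"] by metis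
qed

lemma direction_hyp: assumes "a \<in> \<Phi>\<^sub>+" shows "direction \<Phi> \<Delta> (hyp a n) = a"
  unfolding direction_def
proof (rule the_equality)
  fix b assume b: "b \<in> \<Phi>\<^sub>+ \<and> (\<exists>m. hyp a n = hyp b m)"
  then obtain m where "hyp a n = hyp b m" by blast
  then have "b = a \<or> b = - a" using hyp_inject[OF pos_root[OF assms] pos_root] b by blast
  then show "b = a" using b pos_not_neg[OF assms] by blast
qed (use assms in blast)

lemma hyperplanes_pos: "hyperplanes \<Phi> = {hyp a n | a n. a \<in> \<Phi>\<^sub>+}"
proof (intro equalityI subsetI)
  fix H assume "H \<in> hyperplanes \<Phi>"
  then obtain a n where "H = hyp a n" "a \<in> \<Phi>" unfolding hyperplanes_def by blast
  then show "H \<in> {hyp a n | a n. a \<in> \<Phi>\<^sub>+}" using root_cases[of a] hyp_minus[of a n] by blast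
qed (use pos_root in \<open>auto simp: hyperplanes_def\<close>)

lemma L_root_eq: assumes "a \<in> \<Phi>\<^sub>+" shows "L_root \<Phi> \<Delta> L a = Max (range (Lh a))"
proof -
  have "{L_hyp \<Phi> \<Delta> L H | H. H \<in> hyperplanes \<Phi> \<and> direction \<Phi> \<Delta> H = a} = range (Lh a)"
    unfolding hyperplanes_pos using direction_hyp assms by auto
  then show ?thesis unfolding L_root_def by simp
qed

lemma finite_Lh: assumes "a \<in> \<Phi>" shows "finite (range (Lh a))"
proof (rule finite_subset)
  show "range (Lh a) \<subseteq> L ` Sa \<Phi> \<Delta>"
  proof
    fix m assume "m \<in> range (Lh a)"
    then obtain n where "m = Lh a n" by blast
    then show "m \<in> L ` Sa \<Phi> \<Delta>" using Lh_cases[OF assms, of n] by blast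
  qed
  show "finite (L ` Sa \<Phi> \<Delta>)" unfolding Sa_walls using finite_walls by simp
qed

text \<open>Each direction contributes at most one hyperplane through \<open>x\<close>, namely when
  the pairing is an integer.\<close>

lemma L_point_eq: "L_point \<Phi> \<Delta> L x = (\<Sum>a\<in>{a \<in> \<Phi>\<^sub>+. pairing x a \<in> \<int>}. Lh a \<lfloor>pairing x a\<rfloor>)"
proof -
  let ?A = "{a \<in> \<Phi>\<^sub>+. pairing x a \<in> \<int>}"
  have "inj_on (\<lambda>a. hyp a \<lfloor>pairing x a\<rfloor>) ?A"
  proof (rule inj_onI)
    fix a b assume ab: "a \<in> ?A" "b \<in> ?A" "hyp a \<lfloor>pairing x a\<rfloor> = hyp b \<lfloor>pairing x b\<rfloor>"
    then have "a \<in> \<Phi>\<^sub>+" "b \<in> \<Phi>\<^sub>+" by blast+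
    then show "a = b" using direction_hyp ab(3) by metis
  qed
  moreover have "(\<lambda>a. hyp a \<lfloor>pairing x a\<rfloor>) ` ?A = {H \<in> hyperplanes \<Phi>. x \<in> H}"
  proof (intro equalityI subsetI)
    fix H assume "H \<in> (\<lambda>a. hyp a \<lfloor>pairing x a\<rfloor>) ` ?A"
    then obtain a where a: "a \<in> \<Phi>\<^sub>+" "pairing x a \<in> \<int>" "H = hyp a \<lfloor>pairing x a\<rfloor>" by blast
    then have "x \<in> H" by (simp add: hyp_def)
    then show "H \<in> {H \<in> hyperplanes \<Phi>. x \<in> H}" unfolding hyperplanes_pos using a by blast
  next
    fix H assume "H \<in> {H \<in> hyperplanes \<Phi>. x \<in> H}"
    then obtain a n where a: "a \<in> \<Phi>\<^sub>+" "H = hyp a n" "pairing x a = of_int n"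
      unfolding hyperplanes_pos hyp_def by blast
    then have "a \<in> ?A" "H = hyp a \<lfloor>pairing x a\<rfloor>" by simp_all
    then show "H \<in> (\<lambda>a. hyp a \<lfloor>pairing x a\<rfloor>) ` ?A" by blast
  qed
  ultimately have "bij_betw (\<lambda>a. hyp a \<lfloor>pairing x a\<rfloor>) ?A {H \<in> hyperplanes \<Phi>. x \<in> H}"
    by (simp add: bij_betw_def)
  from sum.reindex_bij_betw[OF this, of "L_hyp \<Phi> \<Delta> L"] show ?thesis unfolding L_point_def by simp
qed

lemma L_point_0: "L_point \<Phi> \<Delta> L 0 = (\<Sum>a\<in>\<Phi>\<^sub>+. Lh a 0)"
  by (simp add: L_point_eq pairing_zero)

lemma L_point_Wa: assumes "g \<in> Wa \<Phi>" shows "L_point \<Phi> \<Delta> L (g x) = L_point \<Phi> \<Delta> L x"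
proof -
  have sub: "(`) h ` {H \<in> hyperplanes \<Phi>. y \<in> H} \<subseteq> {H \<in> hyperplanes \<Phi>. h y \<in> H}" if "h \<in> Ext" for h y
  proof
    fix H assume "H \<in> (`) h ` {H \<in> hyperplanes \<Phi>. y \<in> H}"
    then obtain a n where a: "a \<in> \<Phi>" "H = h ` hyp a n" "y \<in> hyp a n" unfolding hyperplanes_def by blast
    then have "H = hyp (lin h a) (n + shift h a)" "lin h a \<in> \<Phi>" "h y \<in> H"
      using Ext_hyp[OF that] Wf_root[OF Ext_lin[OF that]] by blast+
    then show "H \<in> {H \<in> hyperplanes \<Phi>. h y \<in> H}" unfolding hyperplanes_def by blast
  qed
  have g: "g \<in> Ext" "bij g" using Wa_Ext[OF assms] Ext_bij by blast+
  have "(`) g ` {H \<in> hyperplanes \<Phi>. x \<in> H} = {H \<in> hyperplanes \<Phi>. g x \<in> H}"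
  proof
    show "{H \<in> hyperplanes \<Phi>. g x \<in> H} \<subseteq> (`) g ` {H \<in> hyperplanes \<Phi>. x \<in> H}"
    proof
      fix H assume H: "H \<in> {H \<in> hyperplanes \<Phi>. g x \<in> H}"
      then have "inv g ` H \<in> {H \<in> hyperplanes \<Phi>. x \<in> H}"
        using sub[OF Ext_inv(1)[OF g(1)], of "g x"] g(2) by (auto simp: bij_is_inj)
      moreover have "H = g ` (inv g ` H)" using g(2) by (simp add: image_f_inv_f bij_is_surj)
      ultimately show "H \<in> (`) g ` {H \<in> hyperplanes \<Phi>. x \<in> H}" by blast
    qed
  qed (rule sub[OF g(1)])
  moreover have "inj_on ((`) g) A" for A
    using g(2) by (meson bij_is_inj inj_image_eq_iff inj_onI)
  ultimately have "bij_betw ((`) g) {H \<in> hyperplanes \<Phi>. x \<in> H} {H \<in> hyperplanes \<Phi>. g x \<in> H}"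
    by (simp add: bij_betw_def)
  from sum.reindex_bij_betw[OF this, of "L_hyp \<Phi> \<Delta> L"]
  have "L_point \<Phi> \<Delta> L (g x) = (\<Sum>H\<in>{H \<in> hyperplanes \<Phi>. x \<in> H}. L_hyp \<Phi> \<Delta> L (g ` H))"
    unfolding L_point_def by simp
  also have "\<dots> = L_point \<Phi> \<Delta> L x"
    unfolding L_point_def
  proof (rule sum.cong)
    fix H assume "H \<in> {H \<in> hyperplanes \<Phi>. x \<in> H}"
    then obtain a n where "H = hyp a n" "a \<in> \<Phi>" unfolding hyperplanes_def by blast
    then show "L_hyp \<Phi> \<Delta> L (g ` H) = L_hyp \<Phi> \<Delta> L H" using Ext_hyp[OF g(1)] Lh_Wa[OF assms] by simp
  qed simp
  finally show ?thesis .
qed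

subsection \<open>Hyperplanes through the origin have maximal weight\<close>

text \<open>Otherwise some \<open>\<alpha>\<close> satisfies \<open>L(H\<^sub>\<alpha>\<^sub>,\<^sub>1) > L(H\<^sub>\<alpha>\<^sub>,\<^sub>0)\<close> and pairs evenly with all roots. Its
  orbit then consists of mutually orthogonal roots up to sign, and half the sum of the positive roots
  in the orbit would be a point of larger weight than \<open>0\<close>.\<close>

lemma even_orbit_orthogonal:
  assumes "a \<in> \<Phi>" "b \<in> \<Phi>" "a \<bullet> a = b \<bullet> b" "pairing b a = of_int (2 * k)" "b \<noteq> a" "b \<noteq> - a"
  shows "a \<bullet> b = 0"
proof -
  have p: "a \<bullet> a > 0" using root_nz[OF assms(1)] by simp
  have ab: "a \<bullet> b = of_int k * (a \<bullet> a)"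
    using assms(4) root_nz[OF assms(1)] by (simp add: pairing_def field_simps inner_commute)
  have "(b - a) \<bullet> (b - a) > 0" "(b + a) \<bullet> (b + a) > 0"
    using assms(5,6) by (simp_all add: eq_neg_iff_add_eq_0)
  then have "(1 - of_int k) * (a \<bullet> a) > 0" "(1 + of_int k) * (a \<bullet> a) > 0"
    using ab assms(3) by (simp_all add: inner_diff_left inner_diff_right inner_add_left inner_add_right
      inner_commute algebra_simps)
  then have "1 - of_int k > (0::real)" "1 + of_int k > (0::real)" using p by (simp_all add: zero_less_mult_iff)
  then have "k = 0" by linarith
  then show ?thesis using ab by simp
qed

text \<open>By the strict Cauchy-Schwarz inequality the product of the two pairings is positive and
  less than 4. Since one factor is even, the product is 2.\<close>

lemma even_pairing_one:
  assumes "a \<in> \<Phi>" "d \<in> \<Phi>" "d \<noteq> a" "d \<noteq> - a" "pairing d a = of_int (2 * k)" "a \<bullet> d \<noteq> 0"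
  shows "pairing a d = 1 \<and> k = 1 \<or> pairing a d = -1 \<and> k = -1"
proof -
  have nz: "a \<noteq> 0" "d \<noteq> 0" using assms root_nz by blast+
  obtain m :: int where m: "pairing a d = of_int m" using pairing_root_Ints[OF assms(2,1)] by (auto simp: Ints_def)
  have prd: "pairing d a * pairing a d * ((a \<bullet> a) * (d \<bullet> d)) = 4 * (a \<bullet> d)\<^sup>2"
    using nz by (simp add: pairing_def field_simps power2_eq_square inner_commute)
  have "(a \<bullet> d)\<^sup>2 < (a \<bullet> a) * (d \<bullet> d)"
  proof -
    have "\<bar>a \<bullet> d\<bar> \<noteq> norm a * norm d"
    proof
      assume "\<bar>a \<bullet> d\<bar> = norm a * norm d"
      then have "norm a *\<^sub>R d = norm d *\<^sub>R a \<or> norm a *\<^sub>R d = - norm d *\<^sub>R a"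
        using norm_cauchy_schwarz_abs_eq[of a d] by simp
      then have "(1 / norm a) *\<^sub>R (norm a *\<^sub>R d) = (1 / norm a) *\<^sub>R (norm d *\<^sub>R a) \<or>
        (1 / norm a) *\<^sub>R (norm a *\<^sub>R d) = (1 / norm a) *\<^sub>R (- norm d *\<^sub>R a)" by metis
      then have "d = (norm d / norm a) *\<^sub>R a \<or> d = (- norm d / norm a) *\<^sub>R a"
        using nz by simp
      then show False using reduced[OF assms(1)] assms(2-4) by (metis scaleR_minus1_left scaleR_one)
    qed
    then have "\<bar>a \<bullet> d\<bar> < norm a * norm d" using Cauchy_Schwarz_ineq2[of a d] by linarith
    then have "\<bar>a \<bullet> d\<bar>\<^sup>2 < (norm a * norm d)\<^sup>2" by (intro power_strict_mono) auto
    then show ?thesis by (simp add: power_mult_distrib power2_norm_eq_inner)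
  qed
  then have "pairing d a * pairing a d * ((a \<bullet> a) * (d \<bullet> d)) < 4 * ((a \<bullet> a) * (d \<bullet> d))" using prd by simp
  moreover have pp: "(a \<bullet> a) * (d \<bullet> d) > 0" using nz by simp
  ultimately have "pairing d a * pairing a d < 4" by (simp only: mult_less_cancel_right_pos)
  then have "of_int (2 * k * m) < (4::real)" using m assms(5) by simp
  then have lt: "k * m < 2" by linarith
  have "(a \<bullet> d)\<^sup>2 > 0" using assms(6) by simp
  then have "pairing d a * pairing a d * ((a \<bullet> a) * (d \<bullet> d)) > 0" using prd by linarith
  then have "pairing d a * pairing a d > 0" using pp by (simp add: zero_less_mult_iff)
  then have "of_int (2 * k * m) > (0::real)" using m assms(5) by simp
  then have "k * m > 0" by (simp add: zero_less_mult_iff)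
  then have "k * m = 1" using lt by linarith
  then have "k = 1 \<and> m = 1 \<or> k = -1 \<and> m = -1" using zmult_eq_1_iff by auto
  then show ?thesis using m by auto
qed

lemma Lh_le_zero: assumes "a \<in> \<Phi>" shows "Lh a n \<le> Lh a 0"
proof (rule ccontr)
  assume bad: "\<not> Lh a n \<le> Lh a 0"
  have "n = 0 + 2 * (n div 2) \<or> n = 1 + 2 * (n div 2)" by presburger
  then have "Lh a n = Lh a 0 \<or> Lh a n = Lh a 1"
    using Lh_even[OF assms, of 0 "n div 2"] Lh_even[OF assms, of 1 "n div 2"] by metis
  then have bad1: "Lh a 0 < Lh a 1" using bad by auto
  define Orb where "Orb = (\<lambda>u. u a) ` Wf"
  have Orb_root: "x \<in> \<Phi>" and Orb_L: "Lh x m = Lh a m" and Orb_len: "x \<bullet> x = a \<bullet> a" if "x \<in> Orb" for x m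
    using that Wf_root[OF _ assms] Lh_Wf[OF _ assms] Wf_orthogonal
    unfolding Orb_def orthogonal_transformation_def by auto
  have Orb_Wf: "u x \<in> Orb" if x: "x \<in> Orb" and u: "u \<in> Wf" for x u
  proof -
    obtain v where v: "x = v a" "v \<in> Wf" using x unfolding Orb_def by blast
    then have "u x = (u \<circ> v) a" "u \<circ> v \<in> Wf" using Wf_comp[OF u] by simp_all
    then show ?thesis unfolding Orb_def by (rule image_eqI)
  qed
  have a_Orb: "a \<in> Orb" unfolding Orb_def using id_Wf by (intro image_eqI[of _ _ id]) simp_all
  have Orb_minus: "- x \<in> Orb" if "x \<in> Orb" for x
    using Orb_Wf[OF that refl_in_Wf[OF Orb_root[OF that]]] refl_self root_nz Orb_root[OF that] by metis
  have even_pair: "\<exists>k. pairing d x = of_int (2 * k)" if x: "x \<in> Orb" and d: "d \<in> \<Phi>" for x d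
  proof -
    obtain k :: int where k: "pairing d x = of_int k"
      using pairing_root_Ints[OF Orb_root[OF x] d] by (auto simp: Ints_def)
    have "even k"
      using Lh_odd[OF Orb_root[OF x] d k, of 1] Orb_L[OF x] bad1 by auto
    then show ?thesis using k by (auto elim!: evenE)
  qed
  have orth: "x \<bullet> y = 0" if xy: "x \<in> Orb" "y \<in> Orb" "y \<noteq> x" "y \<noteq> - x" for x y
  proof -
    obtain k where k: "pairing y x = of_int (2 * k)" using even_pair[OF xy(1) Orb_root[OF xy(2)]] by blast
    have "x \<bullet> x = y \<bullet> y" using Orb_len[OF xy(1)] Orb_len[OF xy(2)] by simp
    from even_orbit_orthogonal[OF Orb_root[OF xy(1)] Orb_root[OF xy(2)] this k xy(3,4)]
    show ?thesis .
  qed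
  define Op where "Op = Orb \<inter> \<Phi>\<^sub>+"
  have fOp: "finite Op" unfolding Op_def using finite_pos by blast
  \<comment> \<open>The halving makes every root of \<open>Op\<close> pair to exactly 1 with
    \<open>y\<close>, which puts \<open>y\<close> on the heavier hyperplane in each of these
    directions.\<close>
  define y where "y = (1/2) *\<^sub>R (\<Sum>x\<in>Op. x)"
  have py: "pairing y d = (\<Sum>x\<in>Op. pairing x d) / 2" for d
    unfolding y_def pairing_coroot by (simp add: inner_sum_left)
  have Op_cases: "x \<in> Op \<or> - x \<in> Op" if "x \<in> Orb" for x
    using that root_cases[OF Orb_root[OF that]] Orb_minus[OF that] unfolding Op_def by blast
  have y_Op: "pairing y x = 1" if x: "x \<in> Op" for x
  proof -
    have "pairing z x = 0" if z: "z \<in> Op - {x}" for z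
    proof -
      have "z \<noteq> - x" using z x pos_not_neg unfolding Op_def by blast
      then have "x \<bullet> z = 0" using orth[of x z] z x unfolding Op_def by blast
      then show ?thesis by (simp add: pairing_def inner_commute)
    qed
    then have "(\<Sum>z\<in>Op. pairing z x) = (\<Sum>z\<in>{x}. pairing z x)"
      using fOp x by (intro sum.mono_neutral_right) auto
    then show ?thesis using py[of x] pairing_self[OF pos_nz] x unfolding Op_def by simp
  qed
  have main: "pairing y d \<in> \<int> \<and> Lh d 0 \<le> Lh d \<lfloor>pairing y d\<rfloor>" if d: "d \<in> \<Phi>\<^sub>+" for d
  proof (cases "d \<in> Op")
    case True
    then have "d \<in> Orb" by (simp add: Op_def)
    then show ?thesis using y_Op[OF True] Orb_L[of d 0] Orb_L[of d 1] bad1 by simp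
  next
    case dOp: False
    have dr: "d \<in> \<Phi>" "d \<noteq> 0" using d pos_root pos_nz by blast+
    have dOrb: "d \<notin> Orb" using dOp d unfolding Op_def by blast
    show ?thesis
    proof (cases "\<forall>x\<in>Op. pairing x d = 0")
      case True
      then show ?thesis using py[of d] by simp
    next
      case False
      then obtain p1 where p1: "p1 \<in> Op" "pairing p1 d \<noteq> 0" by blast
      have p1': "p1 \<in> Orb" "p1 \<in> \<Phi>" using p1 Orb_root unfolding Op_def by blast+
      have ne: "d \<noteq> x" "d \<noteq> - x" if "x \<in> Orb" for x using dOrb that Orb_minus by blast+
      have inn: "p1 \<bullet> d \<noteq> 0" using p1(2) by (simp add: pairing_def)
      obtain k where k: "pairing d p1 = of_int (2 * k)" using even_pair[OF p1'(1) dr(1)] by blast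
      have one: "pairing p1 d = 1 \<or> pairing p1 d = -1"
        using even_pairing_one[OF p1'(2) dr(1) ne[OF p1'(1)] k inn] by blast
      then obtain m where m: "pairing p1 d = of_int m" "odd m" "m = 1 \<or> m = -1"
        by (metis of_int_1 of_int_minus odd_one even_minus)
      have L_const: "Lh d j = Lh d 0" for j using Lh_odd[OF dr(1) p1'(2) m(1,2)] .
      \<comment> \<open>Up to sign, \<open>p1\<close> and its mirror image \<open>o2\<close> are the
        only orbit roots not orthogonal to \<open>d\<close>. Each contributes 1 or -1 to the sum, so
        half of it is an integer; and the odd pairing with \<open>p1\<close> makes all hyperplanes
        of direction \<open>d\<close> equally heavy.\<close>
      define o2 where "o2 = rfl d p1"
      have o2: "o2 \<in> Orb" unfolding o2_def using Orb_Wf[OF p1'(1) refl_in_Wf[OF dr(1)]] .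
      have o2_eq: "o2 = p1 - of_int m *\<^sub>R d" unfolding o2_def by (simp add: refl_aff_zero m(1))
      have o2_d: "pairing o2 d = - of_int m"
        unfolding o2_def using pairing_refl_self[OF dr(2), of 0 p1] m(1) by simp
      obtain p2 where p2: "p2 \<in> Op" "p2 = o2 \<or> p2 = - o2" using Op_cases[OF o2] by blast
      have p2_d: "pairing p2 d = 1 \<or> pairing p2 d = -1"
        using p2(2) o2_d m(3) by (auto simp: pairing_minus)
      have o2_ne: "o2 \<noteq> p1" "o2 \<noteq> - p1"
      proof -
        show "o2 \<noteq> p1" using o2_d m by auto
        show "o2 \<noteq> - p1"
        proof
          assume "o2 = - p1"
          then have "of_int m *\<^sub>R d = 2 *\<^sub>R p1" using o2_eq by (simp add: scaleR_2 algebra_simps)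
          then have "d = 2 *\<^sub>R p1 \<or> d = (- 2) *\<^sub>R p1"
            using m(3) by (auto simp: minus_equation_iff[of d])
          then show False using reduced[OF p1'(2), of 2] reduced[OF p1'(2), of "-2"] dr(1) by auto
        qed
      qed
      then have p12: "p1 \<noteq> p2" using p2(2) by auto
      have other: "pairing x d = 0" if x: "x \<in> Op - {p1, p2}" for x
      proof -
        have xO: "x \<in> Orb" "x \<noteq> - p1" "x \<noteq> - p2"
          using x p1(1) p2(1) pos_not_neg unfolding Op_def by blast+
        have "p1 \<bullet> x = 0" using orth[OF p1'(1) xO(1)] x xO by blast
        moreover have "p2 \<bullet> x = 0" using orth[of p2 x] p2(1) xO x unfolding Op_def by blast
        then have "o2 \<bullet> x = 0" using p2(2) by auto
        ultimately have "of_int m * (d \<bullet> x) = 0"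
          using o2_eq by (simp add: inner_diff_left)
        then have "d \<bullet> x = 0" using m(3) by auto
        then show ?thesis by (simp add: pairing_def inner_commute)
      qed
      have "(\<Sum>x\<in>Op. pairing x d) = (\<Sum>x\<in>{p1, p2}. pairing x d)"
        using fOp p1(1) p2(1) other by (intro sum.mono_neutral_right) auto
      also have "\<dots> = pairing p1 d + pairing p2 d" using p12 by simp
      finally have "pairing y d = 0 \<or> pairing y d = 1 \<or> pairing y d = -1"
        using py[of d] one p2_d by auto
      then have "pairing y d \<in> \<int>" by auto
      then show ?thesis using L_const[of "\<lfloor>pairing y d\<rfloor>"] by simp
    qed
  qed
  have "L_point \<Phi> \<Delta> L 0 < L_point \<Phi> \<Delta> L y"
  proof -
    have "{d \<in> \<Phi>\<^sub>+. pairing y d \<in> \<int>} = \<Phi>\<^sub>+" using main by blast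
    then have Ly: "L_point \<Phi> \<Delta> L y = (\<Sum>d\<in>\<Phi>\<^sub>+. Lh d \<lfloor>pairing y d\<rfloor>)" by (simp add: L_point_eq)
    obtain x where x: "x \<in> Op" using Op_cases[OF a_Orb] by blast
    have "Lh x 0 < Lh x \<lfloor>pairing y x\<rfloor>"
      using y_Op[OF x] Orb_L[of x 0] Orb_L[of x 1] bad1 x unfolding Op_def by simp
    then show ?thesis unfolding Ly L_point_0
      using main finite_pos x unfolding Op_def by (intro sum_strict_mono_ex1) auto
  qed
  moreover have "L_point \<Phi> \<Delta> L y \<le> L_point \<Phi> \<Delta> L 0" using zero_weight by (simp add: L_weights_def)
  ultimately show False by simp
qed

lemma L_root_Lh: assumes "a \<in> \<Phi>\<^sub>+" shows "L_root \<Phi> \<Delta> L a = Lh a 0"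
  unfolding L_root_eq[OF assms]
  using Lh_le_zero[OF pos_root[OF assms]] finite_Lh[OF pos_root[OF assms]] by (intro Max_eqI) auto

text \<open>Each direction contributes at most its weight at 0, and a non-integral pairing loses one
  direction altogether.\<close>

lemma L_weights_integral: assumes "x \<in> L_weights \<Phi> \<Delta> L" shows "integral x"
proof -
  have pos: "pairing x a \<in> \<int>" if a: "a \<in> \<Phi>\<^sub>+" for a
  proof (rule ccontr)
    assume "pairing x a \<notin> \<int>"
    then have sub: "{d \<in> \<Phi>\<^sub>+. pairing x d \<in> \<int>} \<subseteq> \<Phi>\<^sub>+ - {a}" by blast
    have "L_point \<Phi> \<Delta> L x \<le> (\<Sum>d\<in>{d \<in> \<Phi>\<^sub>+. pairing x d \<in> \<int>}. Lh d 0)"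
      unfolding L_point_eq using Lh_le_zero pos_root by (intro sum_mono) blast
    also have "\<dots> \<le> (\<Sum>d\<in>\<Phi>\<^sub>+ - {a}. Lh d 0)" using sub finite_pos by (intro sum_mono2) auto
    also have "\<dots> < Lh a 0 + (\<Sum>d\<in>\<Phi>\<^sub>+ - {a}. Lh d 0)" using Lh_pos[OF pos_root[OF a]] by simp
    also have "\<dots> = L_point \<Phi> \<Delta> L 0" unfolding L_point_0 using sum.remove[OF finite_pos a, of "\<lambda>d. Lh d 0"] by simp
    also have "\<dots> \<le> L_point \<Phi> \<Delta> L x" using assms by (simp add: L_weights_def)
    finally show False by simp
  qed
  show ?thesis
    unfolding integral_def
  proof
    fix a assume "a \<in> \<Phi>"
    then consider "a \<in> \<Phi>\<^sub>+" | "- a \<in> \<Phi>\<^sub>+" using root_cases by blast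
    then show "pairing x a \<in> \<int>"
    proof cases
      case 2
      from pos[OF 2] show ?thesis by (simp add: pairing_minus_right)
    qed (rule pos)
  qed
qed

lemma We_Ext: "g \<in> We \<Phi> \<Delta> L \<Longrightarrow> g \<in> Ext"
  unfolding We_def W0_eq using ExtI L_weights_integral by blast

lemma We_iff: "g \<in> We \<Phi> \<Delta> L \<longleftrightarrow> g \<in> Ext \<and> g 0 \<in> L_weights \<Phi> \<Delta> L"
proof
  assume g: "g \<in> We \<Phi> \<Delta> L"
  then obtain m u where "g = transl m \<circ> u" "m \<in> L_weights \<Phi> \<Delta> L" "u \<in> Wf" unfolding We_def W0_eq by blast
  moreover from this have "g 0 = m" using Wf_0 by (simp add: transl_def)
  ultimately show "g \<in> Ext \<and> g 0 \<in> L_weights \<Phi> \<Delta> L" using We_Ext[OF g] by simp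
next
  assume "g \<in> Ext \<and> g 0 \<in> L_weights \<Phi> \<Delta> L"
  then show "g \<in> We \<Phi> \<Delta> L" unfolding We_def W0_eq using Ext_form Ext_lin by blast
qed

lemma L_weights_Wa: "g \<in> Wa \<Phi> \<Longrightarrow> x \<in> L_weights \<Phi> \<Delta> L \<Longrightarrow> g x \<in> L_weights \<Phi> \<Delta> L"
  unfolding L_weights_def by (simp add: L_point_Wa)

end

context irreducible_base begin

section \<open>Alcoves and the extended group\<close>

lemma finite_Sep: "finite (Sep x y)"
proof -
  let ?I = "\<lambda>a. {\<lfloor>min (pairing x a) (pairing y a)\<rfloor>..\<lceil>max (pairing x a) (pairing y a)\<rceil>}"
  have "Sep x y \<subseteq> (\<lambda>(a, n). refl_aff a n) ` Sigma \<Phi> ?I"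
  proof
    fix t assume "t \<in> Sep x y"
    then obtain a n where t: "t = refl_aff a n" "a \<in> \<Phi>"
      "(pairing x a - of_int n) * (pairing y a - of_int n) < 0" unfolding Sep_def by blast
    have "min (pairing x a) (pairing y a) < of_int n" "of_int n < max (pairing x a) (pairing y a)"
      using t(3) by (auto simp: mult_less_0_iff)
    then have "\<lfloor>min (pairing x a) (pairing y a)\<rfloor> \<le> n" "n \<le> \<lceil>max (pairing x a) (pairing y a)\<rceil>"
      by linarith+
    then show "t \<in> (\<lambda>(a, n). refl_aff a n) ` Sigma \<Phi> ?I" using t(1,2) by force
  qed
  then show ?thesis by (rule finite_subset) (simp add: finite_roots)
qed

lemma Sep_same_left:
  assumes "regular p" "regular q" "regular y" "Sep p q = {}" shows "Sep p y = Sep q y"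
  using Sep_triangle[OF assms(1-3)] assms(4) by simp

lemma Sep_same_right:
  assumes "regular p" "regular q" "regular y" "Sep p q = {}" shows "Sep y p = Sep y q"
  using Sep_same_left[OF assms] by (simp add: Sep_commute)

lemma Ext_c0_regular: "g \<in> Ext \<Longrightarrow> regular (g c0)"
  using regular_Ext c0_regular by blast

text \<open>Reflecting in a violated wall removes that wall from the finitely many hyperplanes
  separating \<open>y\<close> from \<open>c0\<close>.\<close>

lemma to_alcove: "regular y \<Longrightarrow> \<exists>g\<in>Wa \<Phi>. g y \<in> A0 \<Phi> \<Delta>"
proof (induction "card (Sep c0 y)" arbitrary: y rule: less_induct)
  case less
  show ?case
  proof (cases "y \<in> A0 \<Phi> \<Delta>")
    case True
    then show ?thesis using aff.id_in_W by (intro bexI[of _ id]) simp_all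
  next
    case False
    then obtain b k where b: "(b, k) \<in> walls" "\<not> pairing y b > of_int k" unfolding mem_A0_walls by auto
    have yb: "pairing y b < of_int k"
      using b(2) less.prems wall_root[OF b(1)] unfolding regular_def by (meson linorder_neqE)
    define s where "s = refl_aff b k"
    have s: "s \<in> Sa \<Phi> \<Delta>" unfolding s_def Sa_walls using b(1) by force
    have sW: "s \<in> Wa \<Phi>" "s \<in> Ext" using Sa_Wa[OF s] Wa_Ext by blast+
    have "s \<in> Sep c0 y"
      unfolding s_def mem_Sep[OF wall_root[OF b(1)]] using wall_c0[OF b(1)] yb by (intro mult_pos_neg) auto
    have "Sep (s c0) y = sym_diff (Sep (s c0) c0) (Sep c0 y)"
      by (rule Sep_triangle[OF Ext_c0_regular[OF sW(2)] c0_regular less.prems])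
    also have "Sep (s c0) c0 = {s}" using Sep_simple[OF s] Sep_commute[of c0 "s c0"] by simp
    also have "sym_diff {s} (Sep c0 y) = Sep c0 y - {s}" using \<open>s \<in> Sep c0 y\<close> by auto
    finally have "card (Sep (s c0) y) < card (Sep c0 y)"
      using card_Diff1_less[OF finite_Sep \<open>s \<in> Sep c0 y\<close>] by simp
    moreover have "Sep c0 (s y) = conj_by s ` Sep (s c0) y"
      using Sep_image[OF sW(2), of "s c0" y] Sa_involution[OF s] by (simp add: fun_eq_iff)
    then have "card (Sep c0 (s y)) \<le> card (Sep (s c0) y)" by (simp add: card_image_le finite_Sep)
    ultimately have "card (Sep c0 (s y)) < card (Sep c0 y)" by linarith
    then obtain g where g: "g \<in> Wa \<Phi>" "g (s y) \<in> A0 \<Phi> \<Delta>"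
      using less.hyps[OF _ regular_Ext[OF sW(2) less.prems]] by blast
    then show ?thesis using aff.W_comp[OF g(1) sW(1)] by (intro bexI[of _ "g \<circ> s"]) simp_all
  qed
qed

lemma transl_Wa: assumes "h \<in> Wa \<Phi>" shows "transl (h 0) \<in> Wa \<Phi>"
proof -
  have h: "h \<in> Ext" using Wa_Ext assms .
  have l: "lin h \<in> Wf" "bij (lin h)" using Ext_lin[OF h] Wf_bij by blast+
  have "h \<circ> inv (lin h) = transl (h 0) \<circ> (lin h \<circ> inv (lin h))"
    by (subst (1) Ext_form[OF h]) (simp add: comp_assoc)
  also have "lin h \<circ> inv (lin h) = id" using l(2) by (simp add: bij_is_surj surj_iff[THEN iffD1])
  also have "transl (h 0) \<circ> id = transl (h 0)" by simp
  finally show ?thesis using aff.W_comp[OF assms Wf_Wa[OF Wf_inv[OF l(1)]]] by metis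
qed

lemma Ext_side:
  assumes "g \<in> Ext" "x \<in> A0 \<Phi> \<Delta>" "a \<in> \<Phi>"
  shows "(pairing (g x) a - of_int n) * (pairing (g c0) a - of_int n) > 0"
proof -
  have "Sep (g x) (g c0) = {}" using Sep_image[OF assms(1)] A0_Sep[OF assms(2) c0_A0] by simp
  then have "\<not> (pairing (g x) a - of_int n) * (pairing (g c0) a - of_int n) < 0"
    using mem_Sep[OF assms(3), of n "g x" "g c0"] by blast
  moreover have "pairing (g x) a \<noteq> of_int n" "pairing (g c0) a \<noteq> of_int n"
    using regular_Ext[OF assms(1)] A0_regular[OF assms(2)] c0_regular assms(3) unfolding regular_def by blast+
  ultimately show ?thesis by (simp add: not_less less_le)
qed

lemma alcove_in_chamber:
  assumes "g \<in> Ext" shows "g ` A0 \<Phi> \<Delta> \<subseteq> chamber \<Phi> \<Delta> \<longleftrightarrow> g c0 \<in> chamber \<Phi> \<Delta>"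
proof
  assume c: "g c0 \<in> chamber \<Phi> \<Delta>"
  show "g ` A0 \<Phi> \<Delta> \<subseteq> chamber \<Phi> \<Delta>"
    unfolding chamber_def
  proof (intro subsetI CollectI ballI)
    fix z a assume z: "z \<in> g ` A0 \<Phi> \<Delta>" and a: "a \<in> \<Phi>\<^sub>+"
    obtain x where x: "z = g x" "x \<in> A0 \<Phi> \<Delta>" using z by blast
    have "pairing (g c0) a > 0" using c a unfolding chamber_def by blast
    then show "0 < pairing z a"
      using Ext_side[OF assms x(2) pos_root[OF a], of 0] x(1) by (simp add: zero_less_mult_iff)
  qed
qed (use c0_A0 in blast)

subsection \<open>Inversions and the longest element\<close>

text \<open>The inverse of \<open>u\<close> appears so that these are the directions of the
  hyperplanes separating \<open>c0\<close> from \<open>u c0\<close>.\<close>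

definition invset :: "('a \<Rightarrow> 'a) \<Rightarrow> 'a set" where
  "invset u = {a \<in> \<Phi>\<^sub>+. inv u a \<notin> \<Phi>\<^sub>+}"

lemma finite_invset: "finite (invset u)"
  unfolding invset_def using finite_pos by simp

lemma pairing_Wf_inv:
  assumes "u \<in> Wf" shows "pairing (u x) a = pairing x (inv u a)"
  using orthogonal_pairing[OF Wf_orthogonal[OF assms], of x "inv u a"] Wf_bij[OF assms]
  by (simp add: bij_is_surj surj_f_inv_f)

lemma c0_sign:
  assumes "a \<in> \<Phi>" shows "a \<in> \<Phi>\<^sub>+ \<longleftrightarrow> pairing c0 a > 0" and "\<bar>pairing c0 a\<bar> < 1"
proof -
  consider "a \<in> \<Phi>\<^sub>+" | "- a \<in> \<Phi>\<^sub>+" using root_cases[OF assms] by blast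
  then have "(a \<in> \<Phi>\<^sub>+ \<longleftrightarrow> pairing c0 a > 0) \<and> \<bar>pairing c0 a\<bar> < 1"
  proof cases
    case 1
    then show ?thesis using c0_bounds[OF 1] by auto
  next
    case 2
    then show ?thesis using c0_bounds[OF 2] pos_not_neg[OF 2] by (auto simp: pairing_minus_right)
  qed
  then show "a \<in> \<Phi>\<^sub>+ \<longleftrightarrow> pairing c0 a > 0" "\<bar>pairing c0 a\<bar> < 1" by blast+
qed

text \<open>All pairings of \<open>c0\<close> and \<open>u c0\<close> with roots have absolute value
  below 1, so only hyperplanes through 0 can separate these points.\<close>

lemma Nrefl_Wf: assumes "u \<in> Wf" shows "Nrefl u = rfl ` invset u"
proof (intro equalityI subsetI)
  fix t assume "t \<in> Nrefl u"
  then obtain a n where a: "a \<in> \<Phi>\<^sub>+" "t = refl_aff a n"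
    "(pairing c0 a - of_int n) * (pairing (u c0) a - of_int n) < 0" unfolding Nrefl_def by (rule SepE)
  have i: "inv u a \<in> \<Phi>" using Wf_root[OF Wf_inv[OF assms] pos_root[OF a(1)]] .
  have b: "0 < pairing c0 a" "pairing c0 a < 1" "\<bar>pairing (u c0) a\<bar> < 1"
    using c0_bounds[OF a(1)] c0_sign(2)[OF i] pairing_Wf_inv[OF assms] by auto
  have "n = 0"
  proof (rule ccontr)
    assume "n \<noteq> 0"
    then have "of_int n \<ge> (1::real) \<or> of_int n \<le> (-1::real)" by linarith
    then have "(pairing c0 a - of_int n) * (pairing (u c0) a - of_int n) > 0"
      using b by (auto intro: mult_pos_pos mult_neg_neg)
    then show False using a(3) by linarith
  qed
  then have "pairing (u c0) a < 0" using a(3) b by (simp add: mult_less_0_iff)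
  then have "inv u a \<notin> \<Phi>\<^sub>+" using c0_sign(1)[OF i] pairing_Wf_inv[OF assms, of c0 a] by simp
  then show "t \<in> rfl ` invset u" using a(1,2) \<open>n = 0\<close> by (simp add: invset_def)
next
  fix t assume "t \<in> rfl ` invset u"
  then obtain a where a: "a \<in> \<Phi>\<^sub>+" "inv u a \<notin> \<Phi>\<^sub>+" "t = rfl a" unfolding invset_def by blast
  have i: "inv u a \<in> \<Phi>" using Wf_root[OF Wf_inv[OF assms] pos_root[OF a(1)]] .
  have "- inv u a \<in> \<Phi>\<^sub>+" using a(2) not_pos_iff[OF i] by blast
  then have "pairing (u c0) a < 0"
    using c0_bounds pairing_Wf_inv[OF assms, of c0 a] by (fastforce simp: pairing_minus_right)
  then show "t \<in> Nrefl u"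
    unfolding Nrefl_def a(3) mem_Sep[OF pos_root[OF a(1)]] using c0_bounds[OF a(1)] by (simp add: mult_pos_neg)
qed

lemma inj_rfl: "inj_on rfl \<Phi>\<^sub>+"
proof (rule inj_onI)
  fix a b assume ab: "a \<in> \<Phi>\<^sub>+" "b \<in> \<Phi>\<^sub>+" "rfl a = rfl b"
  from refl_aff_eq_cases[OF pos_root[OF ab(1)] pos_root[OF ab(2)] ab(3)]
  show "a = b" using ab(2) pos_not_neg[OF ab(1)] by auto
qed

lemma rfl_mem_Nrefl:
  assumes "u \<in> Wf" "a \<in> \<Phi>\<^sub>+" shows "rfl a \<in> Nrefl u \<longleftrightarrow> inv u a \<notin> \<Phi>\<^sub>+"
proof
  assume "rfl a \<in> Nrefl u"
  then obtain b where b: "b \<in> invset u" "rfl a = rfl b" using Nrefl_Wf[OF assms(1)] by blast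
  then have "a = b" using inj_onD[OF inj_rfl b(2) assms(2)] unfolding invset_def by blast
  then show "inv u a \<notin> \<Phi>\<^sub>+" using b unfolding invset_def by blast
next
  assume "inv u a \<notin> \<Phi>\<^sub>+"
  then show "rfl a \<in> Nrefl u" using Nrefl_Wf[OF assms(1)] assms(2) unfolding invset_def by blast
qed

lemma rfl_reflection: assumes "a \<in> \<Phi>" shows "rfl a \<in> fin.reflections"
proof -
  have pos: "rfl a \<in> fin.reflections" if a: "a \<in> \<Phi>\<^sub>+" for a
  proof -
    obtain ws b where ws: "set ws \<subseteq> S0 \<Delta>" "b \<in> \<Delta>" "a = wprod ws b" using simple_conj[OF a] by blast
    have w: "wprod ws \<in> Wf" using fin.wprod_in_W[OF ws(1)] W0_eq by simp
    have "conj_by (wprod ws) (rfl b) = rfl a"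
      using conj_refl_aff[OF Wf_Ext[OF w] simple_root[OF ws(2)], of 0] lin_Wf[OF w] ws(3)
        Wf_0[OF w] by (simp add: shift_def pairing_zero)
    moreover have "rfl b \<in> S0 \<Delta>" unfolding S0_def using ws(2) by blast
    ultimately show ?thesis using fin.conj_reflection[OF fin.wprod_in_W[OF ws(1)]] by metis
  qed
  show ?thesis using root_cases[OF assms] pos[of a] pos[of "- a"] refl_aff_minus_zero[of a] by metis
qed

lemma fin_len: "u \<in> Wf \<Longrightarrow> fin.len u = card (Nrefl u)"
  using fin.len_card_N W0_eq by simp

lemma aff_len: "w \<in> Wa \<Phi> \<Longrightarrow> aff.len w = card (Nrefl w)"
  by (rule aff.len_card_N)

text \<open>A simple reflection missing from \<open>Nrefl w\<close> would lengthen \<open>w\<close>.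
  So \<open>w\<close> carries \<open>c0\<close> to the negative side of every simple root, hence of
  every positive root.\<close>

lemma longest_pairing:
  assumes "w \<in> W0 \<Phi>" "\<forall>u\<in>W0 \<Phi>. fin.len u \<le> fin.len w" "a \<in> \<Phi>\<^sub>+"
  shows "pairing (w c0) a < 0"
proof -
  have wf: "w \<in> Wf" using assms(1) W0_eq by simp
  have simple: "pairing (- w c0) b > 0" if b: "b \<in> \<Delta>" for b
  proof -
    have r: "rfl b \<in> fin.reflections" by (rule rfl_reflection[OF simple_root[OF b]])
    have "rfl b \<in> Nrefl w"
    proof (rule ccontr)
      assume "rfl b \<notin> Nrefl w"
      from fin.len_mult_greater[OF assms(1) r this] show False
        using assms(2) fin.W_comp[OF fin.reflection_in_W[OF r] assms(1)] by fastforce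
    qed
    then have "inv w b \<notin> \<Phi>\<^sub>+" using rfl_mem_Nrefl[OF wf simple_pos[OF b]] by blast
    moreover have i: "inv w b \<in> \<Phi>" using Wf_root[OF Wf_inv[OF wf] simple_root[OF b]] .
    ultimately have "- inv w b \<in> \<Phi>\<^sub>+" using not_pos_iff by blast
    then show ?thesis
      using c0_bounds pairing_Wf_inv[OF wf, of c0 b] by (fastforce simp: pairing_minus_right pairing_minus)
  qed
  from pairing_pos_of_simple[OF assms(3) simple] show ?thesis by (simp add: pairing_minus)
qed

text \<open>Lengths are bounded by the number of positive roots, so a maximum exists. It is unique
  because every maximal element inverts all positive roots, and \<open>Nrefl\<close> determines the
  element.\<close>

lemma longest_props:
  "longest \<Phi> \<Delta> \<in> W0 \<Phi> \<and> (\<forall>u\<in>W0 \<Phi>. fin.len u \<le> fin.len (longest \<Phi> \<Delta>))"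
  unfolding longest_def
proof (rule theI'[where P = "\<lambda>w. w \<in> W0 \<Phi> \<and> (\<forall>u\<in>W0 \<Phi>. fin.len u \<le> fin.len w)"])
  have bound: "fin.len u \<le> card \<Phi>\<^sub>+" if u: "u \<in> W0 \<Phi>" for u
  proof -
    have wf: "u \<in> Wf" using u W0_eq by simp
    have "fin.len u \<le> card (invset u)"
      using fin_len[OF wf] Nrefl_Wf[OF wf] card_image_le[OF finite_invset] by metis
    also have "\<dots> \<le> card \<Phi>\<^sub>+" by (rule card_mono[OF finite_pos]) (auto simp: invset_def)
    finally show ?thesis .
  qed
  have "\<exists>w. w \<in> W0 \<Phi> \<and> (\<forall>u. u \<in> W0 \<Phi> \<longrightarrow> fin.len u \<le> fin.len w)"
    by (rule ex_has_greatest_nat[of _ id "\<lambda>w. fin.len w" "card \<Phi>\<^sub>+ + 1"])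
       (use fin.id_in_W bound in \<open>auto simp: less_Suc_eq_le\<close>)
  then obtain w where w: "w \<in> W0 \<Phi>" "\<forall>u\<in>W0 \<Phi>. fin.len u \<le> fin.len w" by blast
  have all: "Nrefl x = rfl ` \<Phi>\<^sub>+" if x: "x \<in> W0 \<Phi>" "\<forall>u\<in>W0 \<Phi>. fin.len u \<le> fin.len x" for x
  proof -
    have wf: "x \<in> Wf" using x W0_eq by simp
    have "inv x a \<notin> \<Phi>\<^sub>+" if a: "a \<in> \<Phi>\<^sub>+" for a
      using longest_pairing[OF x a] pairing_Wf_inv[OF wf, of c0 a]
        c0_sign(1)[OF Wf_root[OF Wf_inv[OF wf] pos_root[OF a]]] by simp
    then have "invset x = \<Phi>\<^sub>+" unfolding invset_def by blast
    then show ?thesis using Nrefl_Wf[OF wf] by simp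
  qed
  show "\<exists>!w. w \<in> W0 \<Phi> \<and> (\<forall>u\<in>W0 \<Phi>. fin.len u \<le> fin.len w)"
  proof (rule ex1I[of _ w])
    fix x assume x: "x \<in> W0 \<Phi> \<and> (\<forall>u\<in>W0 \<Phi>. fin.len u \<le> fin.len x)"
    show "x = w" using fin.N_injective[of x w] all[of x] all[OF w] x w(1) by blast
  qed (use w in blast)
qed

text \<open>A point of the opposite alcove \<open>- A\<^sub>0 = w\<^sub>0 A\<^sub>0\<close>. Multiplying paths by \<open>w\<^sub>0\<close> from the left
  amounts to measuring lengths from this alcove.\<close>

definition c1 :: 'a where "c1 = inv (longest \<Phi> \<Delta>) c0"

lemma longest_Wf: "longest \<Phi> \<Delta> \<in> Wf"
  using longest_props W0_eq by blast

lemma longest_c1: "longest \<Phi> \<Delta> c1 = c0"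
  unfolding c1_def using Wf_bij[OF longest_Wf] by (simp add: bij_is_surj surj_f_inv_f)

lemma c1_regular: "regular c1"
  unfolding c1_def using regular_Ext[OF Wf_Ext[OF Wf_inv[OF longest_Wf]] c0_regular] .

lemma c1_bounds:
  assumes "a \<in> \<Phi>\<^sub>+" shows "-1 < pairing c1 a \<and> pairing c1 a < 0"
proof -
  have w: "inv (longest \<Phi> \<Delta>) \<in> Wf" using Wf_inv longest_Wf by blast
  have "fin.len (inv (longest \<Phi> \<Delta>)) = fin.len (longest \<Phi> \<Delta>)" using fin.len_inv longest_props by blast
  then have "pairing c1 a < 0"
    unfolding c1_def using longest_pairing[OF _ _ assms] longest_props fin.W_inv by simp
  moreover have "\<bar>pairing c1 a\<bar> < 1"
    unfolding c1_def pairing_Wf_inv[OF w] by (rule c0_sign(2)[OF Wf_root[OF Wf_inv[OF w] pos_root[OF assms]]])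
  ultimately show ?thesis by linarith
qed

end

context weighted_base begin

abbreviation wt :: "'a \<Rightarrow> nat" where "wt a \<equiv> Lh a 0"

lemma wt_minus: "wt (- a) = wt a"
  using Lh_minus[of a 0] by simp

lemma wt_pos: "a \<in> \<Phi> \<Longrightarrow> wt a > 0"
  by (rule Lh_pos)

lemma wt_Wf: "u \<in> Wf \<Longrightarrow> a \<in> \<Phi> \<Longrightarrow> wt (u a) = wt a"
  by (rule Lh_Wf)

text \<open>An instance of \<open>weight_sum_N\<close>: the weight of the fixed hyperplane extends
  \<open>L\<close> to all reflections.\<close>

lemma weight_Wf: assumes "u \<in> Wf" shows "L u = sum wt (invset u)"
proof -
  have "L u = (\<Sum>t\<in>Nrefl u. L_hyp \<Phi> \<Delta> L {x. t x = x})"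
  proof (rule weight_sum_N[OF Wf_Wa[OF assms]])
    fix y s assume ys: "y \<in> Wa \<Phi>" "s \<in> Sa \<Phi> \<Delta>"
    obtain b k where b: "b \<in> \<Phi>" "s = refl_aff b k" using Sa_reflection[OF ys(2)] by blast
    have yE: "y \<in> Ext" using Wa_Ext ys(1) .
    have c: "conj_by y s = refl_aff (lin y b) (k + shift y b)" unfolding b(2) by (rule conj_refl_aff[OF yE b(1)])
    have r: "lin y b \<in> \<Phi>" using Wf_root[OF Ext_lin[OF yE] b(1)] .
    show "L_hyp \<Phi> \<Delta> L {x. conj_by y s x = x} = L s"
      unfolding c refl_fixed[OF root_nz[OF r]] by (rule L_hyp_eq[OF r ys c[symmetric]])
  qed
  also have "\<dots> = (\<Sum>a\<in>invset u. L_hyp \<Phi> \<Delta> L {x. rfl a x = x})"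
    unfolding Nrefl_Wf[OF assms]
    by (rule sum.reindex_cong[OF _ refl refl]) (rule inj_on_subset[OF inj_rfl], auto simp: invset_def)
  also have "\<dots> = sum wt (invset u)"
    by (rule sum.cong) (auto simp: invset_def refl_fixed pos_nz)
  finally show ?thesis .
qed

lemma sum_wt_mono: "A \<subseteq> B \<Longrightarrow> B \<subseteq> \<Phi>\<^sub>+ \<Longrightarrow> sum wt A \<le> sum wt B"
  using finite_subset[OF _ finite_pos] by (intro sum_mono2) auto

text \<open>Positivity of the weights lets equal potentials be turned into equal sets of
  directions.\<close>

lemma sum_wt_eq:
  assumes "A \<subseteq> B" "B \<subseteq> \<Phi>\<^sub>+" "sum wt A = sum wt B" shows "A = B"
proof (rule ccontr)
  assume "A \<noteq> B"
  then obtain b where b: "b \<in> B" "b \<notin> A" using assms(1) by blast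
  have "sum wt A < sum wt B"
    using b assms finite_subset[OF assms(2) finite_pos] wt_pos[OF pos_root[of b]]
    by (intro sum_strict_mono2) auto
  then show False using assms(3) by simp
qed

lemma invset_pos: "invset u \<subseteq> \<Phi>\<^sub>+"
  by (auto simp: invset_def)

text \<open>Right multiplication by \<open>rfl b\<close> is left multiplication by
  \<open>rfl a\<close> with \<open>a = - u b\<close>, an inversion of \<open>u\<close>. The letter
  lost in \<open>weight_reflect\<close> is conjugate to \<open>rfl a\<close>, so its weight is
  \<open>wt b\<close>.\<close>

lemma weight_drop:
  assumes "u \<in> Wf" "b \<in> \<Phi>\<^sub>+" "u b \<notin> \<Phi>\<^sub>+"
  shows "L (u \<circ> rfl b) + wt b \<le> L u"
    and "L (u \<circ> rfl b) + wt b = L u \<longleftrightarrow> fin.len u = Suc (fin.len (u \<circ> rfl b))"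
    and "fin.len (u \<circ> rfl b) < fin.len u"
proof -
  define a where "a = - u b"
  have br: "b \<in> \<Phi>" using pos_root assms(2) .
  have ub: "u b \<in> \<Phi>" using Wf_root[OF assms(1) br] .
  have a: "a \<in> \<Phi>\<^sub>+" "a \<in> \<Phi>" using not_pos_iff[OF ub] assms(3) minus_root[OF ub] unfolding a_def by blast+
  have iu: "linear (inv u)" using Wf_linear Wf_inv assms(1) by blast
  have "inv u a = - b"
    unfolding a_def using linear_neg[OF iu] Wf_bij[OF assms(1)] by (simp add: bij_is_inj)
  then have t: "rfl a \<in> Nrefl u" using rfl_mem_Nrefl[OF assms(1) a(1)] pos_not_neg[OF assms(2)] by simp
  have "conj_by u (rfl b) = rfl a"
    using conj_refl_aff[OF Wf_Ext[OF assms(1)] br, of 0] lin_Wf[OF assms(1)] Wf_0[OF assms(1)]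
      refl_aff_minus_zero[of "u b"] by (simp add: shift_def pairing_zero a_def)
  then have comp: "rfl a \<circ> u = u \<circ> rfl b" using conj_by_comp_right[OF Wf_bij[OF assms(1)], of "rfl b"] by simp
  have ubW: "u \<circ> rfl b \<in> Wf" using Wf_comp[OF assms(1) refl_in_Wf[OF br]] .
  obtain y s where ys: "y \<in> Wa \<Phi>" "s \<in> Sa \<Phi> \<Delta>" "rfl a = conj_by y s" "L (rfl a \<circ> u) + L s \<le> L u"
    "L (rfl a \<circ> u) + L s = L u \<longleftrightarrow> aff.len u = Suc (aff.len (rfl a \<circ> u))"
    by (rule weight_reflect[OF Wf_Wa[OF assms(1)] t])
  have "L s = wt b"
    using L_hyp_eq[OF a(2) ys(1-3)] wt_minus[of "u b"] wt_Wf[OF assms(1) br] by (simp add: a_def)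
  moreover have "fin.len u = aff.len u" "fin.len (u \<circ> rfl b) = aff.len (u \<circ> rfl b)"
    using fin_len[OF assms(1)] aff_len[OF Wf_Wa[OF assms(1)]] fin_len[OF ubW] aff_len[OF Wf_Wa[OF ubW]] by simp_all
  ultimately show "L (u \<circ> rfl b) + wt b \<le> L u"
    "L (u \<circ> rfl b) + wt b = L u \<longleftrightarrow> fin.len u = Suc (fin.len (u \<circ> rfl b))"
    using ys(4,5) unfolding comp by simp_all
  show "fin.len (u \<circ> rfl b) < fin.len u"
    using fin.len_mult_less[of u "rfl a"] t assms(1) W0_eq unfolding comp by simp
qed

subsection \<open>Length and Bruhat order on the extended group\<close>

lemma Pi_stab_Ext: "a \<in> Pi_stab \<Phi> \<Delta> L \<Longrightarrow> a \<in> Ext"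
  unfolding Pi_stab_def using We_Ext by blast

lemma Pi_stab_A0: "a \<in> Pi_stab \<Phi> \<Delta> L \<Longrightarrow> x \<in> A0 \<Phi> \<Delta> \<Longrightarrow> a x \<in> A0 \<Phi> \<Delta>"
  unfolding Pi_stab_def by blast

lemma We_Wa_right:
  assumes "x \<in> We \<Phi> \<Delta> L" "h \<in> Wa \<Phi>" shows "x \<circ> h \<in> We \<Phi> \<Delta> L"
proof -
  have x: "x \<in> Ext" "x 0 \<in> L_weights \<Phi> \<Delta> L" using assms(1) We_iff by blast+
  have u: "lin x \<in> Wa \<Phi>" using Wf_Wa[OF Ext_lin[OF x(1)]] .
  have "(x \<circ> h) 0 = x 0 + (lin x \<circ> h) 0"
    using Ext_form[OF x(1)] by (simp add: lin_def)
  also have "\<dots> = transl ((lin x \<circ> h) 0) (x 0)" by (simp add: transl_def add.commute)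
  finally have "(x \<circ> h) 0 \<in> L_weights \<Phi> \<Delta> L"
    using L_weights_Wa[OF transl_Wa[OF aff.W_comp[OF u assms(2)]] x(2)] by simp
  then show ?thesis using We_iff Ext_comp(1)[OF x(1) Wa_Ext[OF assms(2)]] by blast
qed

lemma We_Wa_left:
  assumes "x \<in> We \<Phi> \<Delta> L" "h \<in> Wa \<Phi>" shows "h \<circ> x \<in> We \<Phi> \<Delta> L"
  using assms We_iff[of x] We_iff[of "h \<circ> x"] L_weights_Wa Ext_comp(1)[OF Wa_Ext] by simp

text \<open>Some \<open>g\<close> in \<open>Wa\<close> moves \<open>inv x c0\<close> into the
  fundamental alcove; then \<open>x \<circ> inv g\<close> sends a point of that alcove into it and
  so stabilises it.\<close>

lemma We_decomp:
  assumes "x \<in> We \<Phi> \<Delta> L" obtains a w where "a \<in> Pi_stab \<Phi> \<Delta> L" "w \<in> Wa \<Phi>" "x = a \<circ> w"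
proof -
  have x: "x \<in> Ext" "bij x" using We_Ext[OF assms] Ext_bij by blast+
  have "regular (inv x c0)" using regular_Ext[OF Ext_inv(1)[OF x(1)] c0_regular] .
  then obtain g where g: "g \<in> Wa \<Phi>" "g (inv x c0) \<in> A0 \<Phi> \<Delta>" using to_alcove by blast
  define a where "a = x \<circ> inv g"
  have bg: "bij g" using aff.W_bij[OF g(1)] .
  have aW: "a \<in> We \<Phi> \<Delta> L" unfolding a_def by (rule We_Wa_right[OF assms aff.W_inv[OF g(1)]])
  have "a (g (inv x c0)) = c0" unfolding a_def using bg x(2) by (simp add: bij_is_inj bij_is_surj surj_f_inv_f)
  then have "a ` A0 \<Phi> \<Delta> = A0 \<Phi> \<Delta>" using Ext_A0_eq[OF We_Ext[OF aW] g(2)] c0_A0 by simp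
  then have "a \<in> Pi_stab \<Phi> \<Delta> L" using aW unfolding Pi_stab_def by blast
  moreover have "x = a \<circ> g" unfolding a_def comp_assoc using bg by (simp add: bij_is_inj)
  ultimately show thesis using that g(1) by blast
qed

lemma Sep_Pi_left:
  assumes "a \<in> Pi_stab \<Phi> \<Delta> L" "regular y" shows "Sep (a c0) y = Sep c0 y"
  using Sep_same_left[OF Ext_c0_regular[OF Pi_stab_Ext[OF assms(1)]] c0_regular assms(2)]
    A0_Sep[OF Pi_stab_A0[OF assms(1) c0_A0] c0_A0] by blast

lemma Pi_Sep_image:
  assumes "a \<in> Pi_stab \<Phi> \<Delta> L" "w \<in> Wa \<Phi>"
  shows "conj_by a ` Nrefl w = Sep c0 ((a \<circ> w) c0)"
proof -
  have "conj_by a ` Nrefl w = Sep (a c0) (a (w c0))"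
    unfolding Nrefl_def using Sep_image[OF Pi_stab_Ext[OF assms(1)]] by simp
  also have "\<dots> = Sep c0 (a (w c0))"
    by (rule Sep_Pi_left[OF assms(1) regular_Ext[OF Pi_stab_Ext[OF assms(1)] Ext_c0_regular[OF Wa_Ext[OF assms(2)]]]])
  finally show ?thesis by simp
qed

text \<open>The factor in \<open>Pi_stab\<close> preserves the fundamental alcove, so conjugation by
  it turns the descent criterion of the affine part into the same criterion for \<open>x\<close>,
  whichever decomposition is used.\<close>

lemma bruhat_less_e_snoc:
  assumes "x \<in> We \<Phi> \<Delta> L" "s \<in> Sa \<Phi> \<Delta>"
  shows "bruhat_less_e \<Phi> \<Delta> L (x \<circ> s) x \<longleftrightarrow> conj_by x s \<in> Sep c0 (x c0)"
proof -
  have key: "aff.bless (w \<circ> s) w \<longleftrightarrow> conj_by x s \<in> Sep c0 (x c0)"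
    if aw: "a \<in> Pi_stab \<Phi> \<Delta> L" "w \<in> Wa \<Phi>" "x = a \<circ> w" for a w
  proof -
    have ba: "bij a" using Ext_bij[OF Pi_stab_Ext[OF aw(1)]] .
    have "conj_by x s = conj_by a (conj_by w s)"
      unfolding aw(3) by (rule conj_by_comp[OF ba aff.W_bij[OF aw(2)]])
    then have "conj_by x s \<in> conj_by a ` Nrefl w \<longleftrightarrow> conj_by w s \<in> Nrefl w"
      using inj_image_mem_iff[OF inj_conj_by[OF ba]] by simp
    then show ?thesis
      unfolding Pi_Sep_image[OF aw(1,2)] aw(3)[symmetric] using aff.bless_snoc[OF aw(2) assms(2)] by simp
  qed
  show ?thesis
  proof
    assume "bruhat_less_e \<Phi> \<Delta> L (x \<circ> s) x"
    then obtain a w w' where aw: "a \<in> Pi_stab \<Phi> \<Delta> L" "w \<in> Wa \<Phi>" "w' \<in> Wa \<Phi>" "x \<circ> s = a \<circ> w" "x = a \<circ> w'"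
      "aff.bless w w'" unfolding bruhat_less_e_def by blast
    have "a \<circ> w = a \<circ> (w' \<circ> s)" using aw(4,5) by (simp add: comp_assoc)
    then have "w = w' \<circ> s" using fun.inj_map_strong[of w "w' \<circ> s" a a] Ext_bij[OF Pi_stab_Ext[OF aw(1)]]
      by (metis bij_is_inj comp_assoc id_comp inv_o_cancel)
    then show "conj_by x s \<in> Sep c0 (x c0)" using key[OF aw(1,3,5)] aw(6) by simp
  next
    assume c: "conj_by x s \<in> Sep c0 (x c0)"
    obtain a w where aw: "a \<in> Pi_stab \<Phi> \<Delta> L" "w \<in> Wa \<Phi>" "x = a \<circ> w" by (rule We_decomp[OF assms(1)])
    have "aff.bless (w \<circ> s) w" using key[OF aw] c by blast
    moreover have "x \<circ> s = a \<circ> (w \<circ> s)" using aw(3) by (simp add: comp_assoc)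
    ultimately show "bruhat_less_e \<Phi> \<Delta> L (x \<circ> s) x"
      unfolding bruhat_less_e_def using aw aff.W_comp[OF aw(2) Sa_Wa[OF assms(2)]] by blast
  qed
qed

text \<open>Here the stabiliser of the alcove stands on the right, while \<open>length_e\<close> has
  it on the left. Both give the number of hyperplanes separating the fundamental alcove from its
  image.\<close>

lemma length_e_eq:
  assumes "w \<in> Wa \<Phi>" "a \<in> Pi_stab \<Phi> \<Delta> L" shows "length_e \<Phi> \<Delta> L (w \<circ> a) = aff.len w"
proof -
  have aW: "a \<in> We \<Phi> \<Delta> L" using assms(2) unfolding Pi_stab_def by blast
  have x: "w \<circ> a \<in> We \<Phi> \<Delta> L" by (rule We_Wa_left[OF aW assms(1)])
  have "Sep (w c0) ((w \<circ> a) c0) = {}"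
    using Sep_image[OF Wa_Ext[OF assms(1)], of c0 "a c0"] A0_Sep[OF c0_A0 Pi_stab_A0[OF assms(2) c0_A0]] by simp
  then have N: "Nrefl w = Sep c0 ((w \<circ> a) c0)"
    unfolding Nrefl_def
    by (rule Sep_same_right[OF Ext_c0_regular[OF Wa_Ext[OF assms(1)]] Ext_c0_regular[OF We_Ext[OF x]] c0_regular])
  have uniq: "aff.len w' = aff.len w"
    if a': "a' \<in> Pi_stab \<Phi> \<Delta> L" "w' \<in> Wa \<Phi>" "w \<circ> a = a' \<circ> w'" for a' w'
  proof -
    have "conj_by a' ` Nrefl w' = Nrefl w" using Pi_Sep_image[OF a'(1,2)] N a'(3) by simp
    then have "card (Nrefl w') = card (Nrefl w)"
      using card_image[OF inj_on_subset[OF inj_conj_by[OF Ext_bij[OF Pi_stab_Ext[OF a'(1)]]] subset_UNIV]] by metis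
    then show ?thesis using aff_len a'(2) assms(1) by simp
  qed
  obtain a' w' where a': "a' \<in> Pi_stab \<Phi> \<Delta> L" "w' \<in> Wa \<Phi>" "w \<circ> a = a' \<circ> w'" by (rule We_decomp[OF x])
  show ?thesis
    unfolding length_e_def
  proof (rule the_equality)
    show "\<exists>a'\<in>Pi_stab \<Phi> \<Delta> L. \<exists>w'\<in>Wa \<Phi>. w \<circ> a = a' \<circ> w' \<and> aff.len w = aff.len w'"
      using a' uniq[OF a'] by (intro bexI[of _ a'] bexI[of _ w']) simp_all
    fix m assume "\<exists>a'\<in>Pi_stab \<Phi> \<Delta> L. \<exists>w'\<in>Wa \<Phi>. w \<circ> a = a' \<circ> w' \<and> m = aff.len w'"
    then obtain a2 w2 where "a2 \<in> Pi_stab \<Phi> \<Delta> L" "w2 \<in> Wa \<Phi>" "w \<circ> a = a2 \<circ> w2" "m = aff.len w2" by blast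
    then show "m = aff.len w" using uniq by metis
  qed
qed

end

section \<open>The folding inequality\<close>

context weighted_base begin

text \<open>The point \<open>c1\<close> stands for the opposite alcove, \<open>y\<close> for the end
  of the remaining path. Both signs of a root are kept, so reflecting needs no normalisation;
  \<open>pdir\<close> picks the positive representatives.\<close>

definition bdir :: "'a \<Rightarrow> 'a \<Rightarrow> 'a set" where
  "bdir x y = {a \<in> \<Phi>. \<exists>m. refl_aff a m \<in> Sep x c1 \<and> refl_aff a m \<in> Sep x y}"

definition pdir :: "'a \<Rightarrow> 'a \<Rightarrow> 'a set" where "pdir x y = bdir x y \<inter> \<Phi>\<^sub>+"

definition potential :: "'a \<Rightarrow> 'a \<Rightarrow> nat" where "potential x y = sum wt (pdir x y)"

lemma pdir_pos: "pdir x y \<subseteq> \<Phi>\<^sub>+"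
  unfolding pdir_def by blast

lemma bdir_minus: "a \<in> bdir x y \<Longrightarrow> - a \<in> bdir x y"
proof -
  assume "a \<in> bdir x y"
  then obtain m where m: "a \<in> \<Phi>" "refl_aff a m \<in> Sep x c1" "refl_aff a m \<in> Sep x y"
    unfolding bdir_def by blast
  then have "refl_aff (- a) (- m) \<in> Sep x c1 \<and> refl_aff (- a) (- m) \<in> Sep x y"
    using refl_aff_minus[of a m] by simp
  then show ?thesis unfolding bdir_def using minus_root[OF m(1)] by blast
qed

text \<open>A membership in \<open>bdir\<close> with chosen orientation: \<open>x\<close> on the
  lower side of the hyperplane, \<open>c1\<close> and \<open>y\<close> on the upper side.\<close>

definition below :: "'a \<Rightarrow> 'a \<Rightarrow> 'a \<Rightarrow> int \<Rightarrow> bool" where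
  "below x y a m \<longleftrightarrow> a \<in> \<Phi> \<and> pairing x a < of_int m \<and> pairing c1 a > of_int m \<and> pairing y a > of_int m"

lemma below_bdir: "below x y a m \<Longrightarrow> a \<in> bdir x y"
  unfolding below_def bdir_def using mem_Sep[of a m x c1] mem_Sep[of a m x y]
  by (auto simp: mult_neg_pos intro!: exI[of _ m])

lemma bdir_below: assumes "a \<in> bdir x y" shows "\<exists>m. below x y a m \<or> below x y (- a) m"
proof -
  obtain m where m: "a \<in> \<Phi>" "refl_aff a m \<in> Sep x c1" "refl_aff a m \<in> Sep x y"
    using assms unfolding bdir_def by blast
  have *: "(pairing x a - of_int m) * (pairing c1 a - of_int m) < 0"
    "(pairing x a - of_int m) * (pairing y a - of_int m) < 0"
    using m(2,3) mem_Sep[OF m(1)] by blast+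
  show ?thesis
  proof (cases "pairing x a < of_int m")
    case True
    then have "below x y a m" using * m(1) unfolding below_def by (auto simp: mult_less_0_iff)
    then show ?thesis by blast
  next
    case False
    then have "below x y (- a) (- m)"
      using * minus_root[OF m(1)] unfolding below_def by (auto simp: mult_less_0_iff pairing_minus_right)
    then show ?thesis by blast
  qed
qed

text \<open>If \<open>x\<close> were more than one unit away, the next parallel hyperplane would
  also separate \<open>x\<close> from its mirror image.\<close>

lemma adjacent_near:
  assumes "regular x" "a \<in> \<Phi>" "pairing x a > of_int M" "Sep x (refl_aff a M x) = {refl_aff a M}"
  shows "pairing x a < of_int M + 1"
proof (rule ccontr)
  have nz: "a \<noteq> 0" using assms(2) root_nz by blast
  assume "\<not> ?thesis"
  then have "pairing x a > of_int (M + 1)"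
    using assms(1,2) unfolding regular_def by (metis linorder_neqE_linordered_idom of_int_1 of_int_add)
  then have "(pairing x a - of_int (M + 1)) * (pairing (refl_aff a M x) a - of_int (M + 1)) < 0"
    using pairing_refl_self[OF nz, of M x] assms(3) by (intro mult_pos_neg) auto
  then have "refl_aff a (M + 1) \<in> Sep x (refl_aff a M x)" using mem_Sep[OF assms(2)] by blast
  then show False using assms(4) refl_aff_inject_int[OF nz] by fastforce
qed

end

text \<open>One fold at the hyperplane with root \<open>a\<close> and label \<open>M\<close>:
  \<open>x\<close> lies in the current alcove, \<open>y\<close> at the end of the remaining path.
  The alcove of \<open>x\<close> borders the hyperplane, and both \<open>c1\<close> and
  \<open>y\<close> lie beyond it.\<close>

locale fold = weighted_base +
  fixes x y a :: 'a and M :: int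
  assumes x_regular: "regular x" and y_regular: "regular y" and a_root: "a \<in> \<Phi>"
    and x_side: "pairing x a > of_int M" and y_side: "pairing y a < of_int M"
    and c1_side: "pairing c1 a < of_int M"
    and adjacent: "Sep x (refl_aff a M x) = {refl_aff a M}"
begin

abbreviation r :: "'a \<Rightarrow> 'a" where "r \<equiv> refl_aff a M"

abbreviation h :: "'a \<Rightarrow> real" where "h z \<equiv> pairing z a - of_int M"

lemma anz: "a \<noteq> 0"
  using a_root root_nz by blast

lemma r_Ext: "r \<in> Ext" "lin r = rfl a"
  using refl_aff_Ext[OF a_root] by blast+

lemma h_r: "h (r z) = - h z"
  using pairing_refl_self[OF anz, of M z] by simp

text \<open>This midpoint is fixed by the fold, and it lies on the same side as \<open>x\<close> of
  every hyperplane except the folding one, so signs at \<open>x\<close> survive the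
  reflection.\<close>

definition x0 :: 'a where "x0 = (1/2) *\<^sub>R (x + r x)"

lemma h_x0: "h x0 = 0"
  using h_r[of x] by (simp add: x0_def pairing_scale pairing_add)

lemma r_x0: "r x0 = x0"
  using h_x0 by (simp add: refl_aff_def)

lemma x0_side:
  assumes "d \<in> \<Phi>" "refl_aff d m \<noteq> r"
  shows "pairing x0 d < of_int m \<longleftrightarrow> pairing x d < of_int m"
proof -
  have "refl_aff d m \<notin> Sep x (r x)" using adjacent assms(2) by simp
  then have "\<not> (pairing x d - of_int m) * (pairing (r x) d - of_int m) < 0"
    using mem_Sep[OF assms(1)] by blast
  moreover have "pairing x d \<noteq> of_int m" "pairing (r x) d \<noteq> of_int m"
    using x_regular regular_Ext[OF r_Ext(1) x_regular] assms(1) unfolding regular_def by blast+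
  moreover have "pairing x0 d = (pairing x d + pairing (r x) d) / 2"
    by (simp add: x0_def pairing_scale pairing_add)
  ultimately show ?thesis by (auto simp: not_less zero_le_mult_iff)
qed

lemma r_pairing: "pairing (r z) d = pairing z d - h z * pairing a d"
  by (simp add: refl_aff_def pairing_diff pairing_scale)

lemma r_pairing':
  assumes "d \<in> \<Phi>" shows "pairing (r z) d = pairing z (rfl a d) + of_int (shift r (rfl a d))"
proof -
  have "rfl a (rfl a d) = d" using refl_aff_involution[OF anz, of 0] by (simp add: fun_eq_iff)
  then show ?thesis
    using Ext_pairing[OF r_Ext(1) refl_root[OF a_root assms], of z] r_Ext(2) by simp
qed

lemma rfl_ne: assumes "d \<noteq> a" "d \<noteq> - a" shows "rfl a d \<noteq> a" "rfl a d \<noteq> - a"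
proof -
  have i: "rfl a (rfl a d) = d" using refl_aff_involution[OF anz, of 0] by (simp add: fun_eq_iff)
  have "rfl a a = - a" "rfl a (- a) = a"
    using refl_self[OF anz] linear_neg[OF linear_refl, of a a] by simp_all
  then show "rfl a d \<noteq> a" "rfl a d \<noteq> - a" using i assms by metis+
qed

lemma ne_r: "d \<in> \<Phi> \<Longrightarrow> d \<noteq> a \<Longrightarrow> d \<noteq> - a \<Longrightarrow> refl_aff d m \<noteq> r"
  using refl_aff_eq_cases[OF a_root, of d M m] by metis

text \<open>Let \<open>F\<close> be the affine function of \<open>(d, m)\<close> and
  \<open>F'\<close> that of \<open>(d', m')\<close>, so that \<open>F' z = F (r z)\<close> and
  \<open>F' z = F z - h z * pairing a d\<close>. At \<open>x\<close> both are negative, via the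
  fixed point \<open>x0\<close>, and \<open>F'\<close> is positive at \<open>y\<close>. Since
  \<open>h\<close> is negative at \<open>y\<close> and at \<open>c1\<close>, the sign of
  \<open>pairing a d\<close> decides whether \<open>F\<close> is positive at \<open>y\<close> too,
  or \<open>F'\<close> at \<open>c1\<close>.\<close>

lemma reflect_below:
  assumes "below x (r y) d m" "d \<noteq> a" "d \<noteq> - a"
  defines "d' \<equiv> rfl a d" and "m' \<equiv> m - shift r (rfl a d)"
  shows "\<And>z. pairing z d' - of_int m' = pairing (r z) d - of_int m"
    and "\<And>z. pairing z d' - of_int m' = (pairing z d - of_int m) - h z * pairing a d"
    and "d' \<in> \<Phi>" and "pairing x d' < of_int m'" and "pairing y d' > of_int m'"
    and "pairing a d \<le> 0 \<Longrightarrow> below x y d m"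
    and "pairing a d \<ge> 0 \<Longrightarrow> below x y d' m'"
proof -
  have d: "d \<in> \<Phi>" and xd: "pairing x d < of_int m" and cd: "pairing c1 d > of_int m"
    and yd: "pairing (r y) d > of_int m" using assms(1) unfolding below_def by blast+
  show f: "pairing z d' - of_int m' = pairing (r z) d - of_int m" for z
    unfolding d'_def m'_def r_pairing'[OF d] by simp
  show g: "pairing z d' - of_int m' = (pairing z d - of_int m) - h z * pairing a d" for z
    unfolding f r_pairing by simp
  show d': "d' \<in> \<Phi>" unfolding d'_def by (rule refl_root[OF a_root d])
  have d'ne: "d' \<noteq> a" "d' \<noteq> - a" unfolding d'_def using rfl_ne[OF assms(2,3)] by blast+
  have "pairing x0 d < of_int m" using x0_side[OF d ne_r[OF d assms(2,3)]] xd by blast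
  then have "pairing x0 d' < of_int m'" using f[of x0] r_x0 by simp
  then show xd': "pairing x d' < of_int m'" using x0_side[OF d' ne_r[OF d' d'ne]] by blast
  show yd': "pairing y d' > of_int m'" using f[of y] yd by simp
  show "below x y d m" if k: "pairing a d \<le> 0"
  proof -
    have "h y * pairing a d \<ge> 0" using y_side k by (intro mult_nonpos_nonpos) auto
    then have "pairing y d > of_int m" using g[of y] yd' by linarith
    then show ?thesis using d xd cd unfolding below_def by blast
  qed
  show "below x y d' m'" if k: "pairing a d \<ge> 0"
  proof -
    have "h c1 * pairing a d \<le> 0" using c1_side k by (intro mult_nonpos_nonneg) auto
    then have "pairing c1 d' > of_int m'" using g[of c1] cd by linarith
    then show ?thesis using d' xd' yd' unfolding below_def by blast
  qed
qed

lemma a_bdir: "a \<in> bdir x y"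
proof -
  have "below x y (- a) (- M)"
    unfolding below_def using minus_root[OF a_root] x_side y_side c1_side by (simp add: pairing_minus_right)
  from bdir_minus[OF below_bdir[OF this]] show ?thesis by simp
qed

lemma x_near: "pairing x a < of_int M + 1"
  by (rule adjacent_near[OF x_regular a_root x_side adjacent])

text \<open>As \<open>x\<close> lies within one unit above the folding hyperplane, parallels
  separating it from \<open>c1\<close> have label at most \<open>M\<close>; the folded end point is
  on the same side of these as \<open>x\<close>.\<close>

lemma a_not_bdir_r: "a \<notin> bdir x (r y)"
proof
  assume "a \<in> bdir x (r y)"
  then obtain m where m: "refl_aff a m \<in> Sep x c1" "refl_aff a m \<in> Sep x (r y)"
    unfolding bdir_def by blast
  have *: "(pairing x a - of_int m) * (pairing c1 a - of_int m) < 0"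
    "(pairing x a - of_int m) * (pairing (r y) a - of_int m) < 0"
    using m mem_Sep[OF a_root] by blast+
  have ry: "pairing (r y) a > of_int M" using h_r[of y] y_side by simp
  have "of_int m < pairing x a"
  proof (rule ccontr)
    assume "\<not> ?thesis"
    then have "pairing x a < of_int m" "of_int m < pairing c1 a" using *(1) by (auto simp: mult_less_0_iff)
    then show False using c1_side x_side by linarith
  qed
  then have "m \<le> M" using x_near by linarith
  then have "(of_int m :: real) \<le> of_int M" by simp
  then have "pairing (r y) a - of_int m > 0" using ry by linarith
  then show False using *(2) \<open>of_int m < pairing x a\<close> by (auto simp: mult_less_0_iff)
qed

lemma bdir_r_ne: assumes "d \<in> bdir x (r y)" shows "d \<noteq> a" "d \<noteq> - a"
  using assms a_not_bdir_r bdir_minus[of "- a"] by auto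

text \<open>After orienting the direction, the two signs of the pairing with \<open>a\<close> are
  the two alternatives of \<open>reflect_below\<close>.\<close>

lemma bdir_r_single:
  assumes "d \<in> bdir x (r y)" shows "d \<in> bdir x y \<or> rfl a d \<in> bdir x y"
proof -
  have *: "e \<in> bdir x y \<or> rfl a e \<in> bdir x y" if e: "below x (r y) e m" "e \<in> bdir x (r y)" for e m
  proof (cases "pairing a e \<le> 0")
    case True
    then show ?thesis using reflect_below(6)[OF e(1) bdir_r_ne[OF e(2)]] below_bdir by blast
  next
    case False
    then have "pairing a e \<ge> 0" by linarith
    from reflect_below(7)[OF e(1) bdir_r_ne[OF e(2)] this] show ?thesis using below_bdir by blast
  qed
  obtain m where "below x (r y) d m \<or> below x (r y) (- d) m" using bdir_below[OF assms] by blast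
  then show ?thesis
  proof
    assume "below x (r y) d m"
    then show ?thesis using * assms by blast
  next
    assume "below x (r y) (- d) m"
    then have "- d \<in> bdir x y \<or> rfl a (- d) \<in> bdir x y" using * bdir_minus[OF assms] by blast
    then show ?thesis
      using bdir_minus[of "- d"] bdir_minus[of "rfl a (- d)"] linear_neg[OF linear_refl, of a d] by auto
  qed
qed

text \<open>Two parallel hyperplanes with root \<open>rfl a d\<close> are available: one separates
  \<open>x\<close> from \<open>c1\<close>, the other \<open>x\<close> from \<open>y\<close>. The one
  with the smaller label does both.\<close>

lemma below_pair:
  assumes "below x (r y) d m" "below x (r y) (rfl a d) m2" "d \<noteq> a" "d \<noteq> - a"
  shows "rfl a d \<in> bdir x y"
proof -
  define d' m' where "d' = rfl a d" and "m' = m - shift r (rfl a d)"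
  note R = reflect_below[OF assms(1,3,4), folded d'_def m'_def]
  have d2: "pairing x d' < of_int m2" "pairing c1 d' > of_int m2"
    using assms(2) unfolding below_def d'_def by blast+
  show ?thesis
  proof (cases "m2 \<le> m'")
    case True
    then have "(of_int m2 :: real) \<le> of_int m'" by simp
    then have "below x y d' m2" using R(3,5) d2 unfolding below_def by linarith
    then show ?thesis using below_bdir d'_def by blast
  next
    case False
    then have "(of_int m' :: real) \<le> of_int m2" by simp
    then have "below x y d' m'" using R(3,4,5) d2 unfolding below_def by linarith
    then show ?thesis using below_bdir d'_def by blast
  qed
qed

text \<open>The position of \<open>x\<close> forces \<open>m' + m2 > 0\<close>, while that of
  \<open>c1\<close> or of \<open>r y\<close>, depending on the sign of \<open>pairing a d\<close>,
  forces the opposite.\<close>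

lemma below_opposite:
  assumes "below x (r y) d m" "below x (r y) (- rfl a d) m2" "d \<noteq> a" "d \<noteq> - a"
  shows False
proof -
  define d' m' where "d' = rfl a d" and "m' = m - shift r (rfl a d)"
  note R = reflect_below[OF assms(1,3,4), folded d'_def m'_def]
  have d2: "pairing x (- d') < of_int m2" "pairing c1 (- d') > of_int m2" "pairing (r y) (- d') > of_int m2"
    using assms(2) unfolding below_def d'_def by blast+
  have d1: "pairing c1 d > of_int m" "pairing (r y) d > of_int m" using assms(1) unfolding below_def by blast+
  have xs: "pairing x d' < of_int m'" "- pairing x d' < of_int m2" using R(4) d2(1) by (simp_all add: pairing_minus_right)
  then have sum: "of_int m' + of_int m2 > (0::real)" by linarith
  show False
  proof (cases "pairing a d \<ge> 0")
    case True
    have "below x y d' m'" by (rule R(7)[OF True])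
    then have "pairing c1 d' > of_int m'" unfolding below_def by blast
    then show False using d2(2) sum by (simp add: pairing_minus_right)
  next
    case False
    have "h (r y) * pairing a d \<le> 0" using h_r[of y] y_side False by (intro mult_nonneg_nonpos) auto
    then have "pairing (r y) d' > of_int m'" using R(2)[of "r y"] d1(2) by linarith
    then show False using d2(3) sum by (simp add: pairing_minus_right)
  qed
qed

lemma bdir_r_pair:
  assumes "d \<in> bdir x (r y)" "rfl a d \<in> bdir x (r y)" shows "rfl a d \<in> bdir x y"
proof -
  have *: "rfl a e \<in> bdir x y" if e: "below x (r y) e m" "e \<in> bdir x (r y)" "rfl a e \<in> bdir x (r y)" for e m
  proof -
    note ne = bdir_r_ne[OF e(2)]
    obtain m2 where "below x (r y) (rfl a e) m2 \<or> below x (r y) (- rfl a e) m2" using bdir_below[OF e(3)] by blast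
    then show ?thesis using below_pair[OF e(1) _ ne] below_opposite[OF e(1) _ ne] by blast
  qed
  have n: "rfl a (- d) = - rfl a d" by (rule linear_neg[OF linear_refl])
  obtain m where "below x (r y) d m \<or> below x (r y) (- d) m" using bdir_below[OF assms(1)] by blast
  then show ?thesis
  proof
    assume "below x (r y) d m"
    then show ?thesis using * assms by blast
  next
    assume "below x (r y) (- d) m"
    then have "rfl a (- d) \<in> bdir x y" using *[of "- d" m] bdir_minus[OF assms(1)] bdir_minus[OF assms(2)] n by simp
    then show ?thesis using bdir_minus[of "rfl a (- d)"] n by simp
  qed
qed

text \<open>A weight-preserving injection sends the directions after the fold to those before it and
  misses the direction of \<open>a\<close>.\<close>

lemma potential_fold: "potential x (r y) + wt a \<le> potential x y"
proof -
  define a' where "a' = (if a \<in> \<Phi>\<^sub>+ then a else - a)"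
  define \<sigma> where "\<sigma> d = (if rfl a d \<in> \<Phi>\<^sub>+ then rfl a d else - rfl a d)" for d
  \<comment> \<open>Directions present before the fold are kept; the others are replaced by their
    mirror images, which were present by \<open>bdir_r_single\<close>.\<close>
  define j where "j d = (if d \<in> pdir x y then d else \<sigma> d)" for d
  have inv: "rfl a (rfl a d) = d" for d using refl_aff_involution[OF anz, of 0] by (simp add: fun_eq_iff)
  have neg: "rfl a (- d) = - rfl a d" for d by (rule linear_neg[OF linear_refl])
  have \<sigma>_pos: "\<sigma> d \<in> \<Phi>\<^sub>+" if "d \<in> \<Phi>\<^sub>+" for d
    unfolding \<sigma>_def using root_cases[OF refl_root[OF a_root pos_root[OF that]]] by auto
  have \<sigma>\<sigma>: "\<sigma> (\<sigma> d) = d" if "d \<in> \<Phi>\<^sub>+" for d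
    unfolding \<sigma>_def using that inv neg pos_not_neg[OF that] by auto
  have \<sigma>_bdir: "\<sigma> d \<in> bdir x z \<longleftrightarrow> rfl a d \<in> bdir x z" for d z
    unfolding \<sigma>_def using bdir_minus[of "rfl a d" x z] bdir_minus[of "- rfl a d" x z] by auto
  have wt_\<sigma>: "wt (\<sigma> d) = wt d" if "d \<in> \<Phi>\<^sub>+" for d
    unfolding \<sigma>_def using wt_Wf[OF refl_in_Wf[OF a_root] pos_root[OF that]] wt_minus by simp
  have wt_j: "wt (j d) = wt d" if "d \<in> \<Phi>\<^sub>+" for d unfolding j_def using wt_\<sigma>[OF that] by simp
  have a': "a' \<in> \<Phi>\<^sub>+" "a' \<in> pdir x y" "wt a' = wt a" "a' = a \<or> a' = - a"
    unfolding a'_def pdir_def using root_cases[OF a_root] a_bdir bdir_minus[OF a_bdir] wt_minus by auto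
  let ?X = "pdir x (r y)"
  have Xb: "d \<in> bdir x (r y)" "d \<in> \<Phi>\<^sub>+" if "d \<in> ?X" for d using that unfolding pdir_def by blast+
  have j_in: "j d \<in> pdir x y" if d: "d \<in> ?X" for d
  proof (cases "d \<in> pdir x y")
    case False
    then have "d \<notin> bdir x y" using Xb[OF d] unfolding pdir_def by blast
    then have "rfl a d \<in> bdir x y" using bdir_r_single[OF Xb(1)[OF d]] by blast
    then have "\<sigma> d \<in> pdir x y" unfolding pdir_def using \<sigma>_bdir \<sigma>_pos[OF Xb(2)[OF d]] by blast
    then show ?thesis unfolding j_def using False by simp
  qed (simp add: j_def)
  have j_ne: "j d \<noteq> a'" if d: "d \<in> ?X" for d
  proof -
    note ne = bdir_r_ne[OF Xb(1)[OF d]]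
    have "rfl a d \<noteq> a" "rfl a d \<noteq> - a" using rfl_ne[OF ne] by blast+
    then have "\<sigma> d \<noteq> a" "\<sigma> d \<noteq> - a" unfolding \<sigma>_def by (auto simp: minus_equation_iff)
    then show ?thesis using ne a'(4) unfolding j_def by auto
  qed
  have inj: "inj_on j ?X"
  proof -
    \<comment> \<open>Such a collision puts \<open>e\<close> and its mirror image both into
      \<open>bdir x (r y)\<close>; then \<open>bdir_r_pair\<close> puts \<open>e\<close> into
      \<open>bdir x y\<close>, contrary to its choice.\<close>
    have case1: "d = e" if de: "d \<in> ?X" "e \<in> ?X" "d \<in> pdir x y" "e \<notin> pdir x y" "d = \<sigma> e" for d e
    proof -
      have "\<sigma> e \<in> bdir x (r y)" using Xb(1)[OF de(1)] de(5) by simp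
      then have r1: "rfl a e \<in> bdir x (r y)" using \<sigma>_bdir by blast
      have "rfl a (rfl a e) \<in> bdir x y"
        using bdir_r_pair[OF r1] Xb(1)[OF de(2)] inv by simp
      then show ?thesis using de(4) Xb[OF de(2)] inv unfolding pdir_def by simp
    qed
    show ?thesis
    proof (rule inj_onI)
      fix d e assume de: "d \<in> ?X" "e \<in> ?X" "j d = j e"
      consider "d \<in> pdir x y" "e \<in> pdir x y" | "d \<in> pdir x y" "e \<notin> pdir x y"
        | "d \<notin> pdir x y" "e \<in> pdir x y" | "d \<notin> pdir x y" "e \<notin> pdir x y" by blast
      then show "d = e"
      proof cases
        case 1
        then show ?thesis using de(3) by (simp add: j_def)
      next
        case 2
        then have "d = \<sigma> e" using de(3) by (simp add: j_def)
        from case1[OF de(1,2) 2 this] show ?thesis .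
      next
        case 3
        then have "e = \<sigma> d" using de(3) by (simp add: j_def)
        from case1[OF de(2,1) 3(2,1) this] show ?thesis by (rule sym)
      next
        case 4
        then have "\<sigma> d = \<sigma> e" using de(3) by (simp add: j_def)
        then have "\<sigma> (\<sigma> d) = \<sigma> (\<sigma> e)" by (rule arg_cong)
        then show ?thesis unfolding \<sigma>\<sigma>[OF Xb(2)[OF de(1)]] \<sigma>\<sigma>[OF Xb(2)[OF de(2)]] .
      qed
    qed
  qed
  have "potential x (r y) = (\<Sum>d\<in>?X. wt (j d))"
    unfolding potential_def by (rule sum.cong) (use wt_j Xb in auto)
  also have "\<dots> = sum wt (j ` ?X)" using sum.reindex[OF inj, of wt] by simp
  also have "\<dots> \<le> sum wt (pdir x y - {a'})"
    by (rule sum_wt_mono) (use j_in j_ne pdir_pos in blast)+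
  finally have "potential x (r y) + wt a' \<le> sum wt (pdir x y - {a'}) + wt a'" by simp
  also have "\<dots> = potential x y"
    unfolding potential_def using sum.remove[OF finite_subset[OF pdir_pos finite_pos] a'(2), of wt] by simp
  finally show ?thesis using a'(3) by simp
qed

end

section \<open>Reduced expressions of dominant translations\<close>

locale reduced_translation = weighted_base +
  fixes \<tau> :: 'a and s :: "nat \<Rightarrow> 'a \<Rightarrow> 'a" and n :: nat and a :: "'a \<Rightarrow> 'a"
  assumes tau: "\<tau> \<in> dominant_weights \<Phi> \<Delta> L" and expr: "reduced_expr \<Phi> \<Delta> L (transl \<tau>) s n a"
begin

definition pre :: "nat \<Rightarrow> 'a \<Rightarrow> 'a" where "pre k = wprod (map s [1..<Suc k])"

text \<open>The reflection in the hyperplane that the unfolded path crosses at step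
  \<open>k\<close>, hence the prefix of length \<open>k - 1\<close>.\<close>

definition wall :: "nat \<Rightarrow> 'a \<Rightarrow> 'a" where "wall k = conj_by (pre (k - 1)) (s k)"

abbreviation \<beta> :: "nat \<Rightarrow> 'a" where "\<beta> \<equiv> beta \<Phi> \<Delta> s"

lemma s_Sa: "k \<in> {1..n} \<Longrightarrow> s k \<in> Sa \<Phi> \<Delta>"
  using expr unfolding reduced_expr_def by blast

lemma a_Pi: "a \<in> Pi_stab \<Phi> \<Delta> L"
  and transl_pre: "transl \<tau> = pre n \<circ> a"
  and length_tau: "length_e \<Phi> \<Delta> L (transl \<tau>) = n"
  using expr unfolding reduced_expr_def pre_def by blast+

lemma pre_0: "pre 0 = id"
  by (simp add: pre_def)

lemma pre_Suc: "pre (Suc k) = pre k \<circ> s (Suc k)"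
  by (simp add: pre_def)

lemma word_Sa: "k \<le> n \<Longrightarrow> set (map s [1..<Suc k]) \<subseteq> Sa \<Phi> \<Delta>"
  using s_Sa by auto

lemma pre_Wa: "k \<le> n \<Longrightarrow> pre k \<in> Wa \<Phi>"
  unfolding pre_def by (rule aff.wprod_in_W[OF word_Sa])

lemma pre_Ext: "k \<le> n \<Longrightarrow> pre k \<in> Ext"
  using pre_Wa Wa_Ext by blast

lemma len_pre_n: "aff.len (pre n) = n"
  using length_e_eq[OF pre_Wa[OF le_refl] a_Pi] transl_pre length_tau by simp

text \<open>A letter raises the length by at most one, and the full word attains \<open>n\<close>,
  so no prefix can fall short.\<close>

lemma len_pre: assumes "k \<le> n" shows "aff.len (pre k) = k"
proof -
  have le: "aff.len (pre j) \<le> j" if "j \<le> n" for j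
    unfolding pre_def using aff.len_le[OF word_Sa[OF that]]
    unfolding length_map length_upt diff_Suc_Suc diff_zero One_nat_def .
  have "n \<le> aff.len (pre j) + (n - j)" if "j \<le> n" for j
    using that
  proof (induction rule: inc_induct)
    case base
    then show ?case using len_pre_n by simp
  next
    case (step j)
    have "aff.len (pre (Suc j)) \<le> Suc (aff.len (pre j))"
      using aff.len_snoc[OF pre_Wa s_Sa, of j "Suc j"] step(2) unfolding pre_Suc by (auto split: if_splits)
    then show ?case using step by linarith
  qed
  then show ?thesis using le assms by fastforce
qed

lemma wall_new: assumes "k < n" shows "wall (Suc k) \<notin> Nrefl (pre k)"
  and "Nrefl (pre (Suc k)) = insert (wall (Suc k)) (Nrefl (pre k))"
proof -
  have k: "pre k \<in> Wa \<Phi>" "s (Suc k) \<in> Sa \<Phi> \<Delta>" using assms pre_Wa s_Sa by simp_all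
  have "aff.len (pre k \<circ> s (Suc k)) = Suc (aff.len (pre k))"
    using len_pre[of k] len_pre[of "Suc k"] assms pre_Suc[of k] by simp
  then have "conj_by (pre k) (s (Suc k)) \<notin> Nrefl (pre k)"
    using aff.len_snoc[OF k] by (auto split: if_splits)
  then show "wall (Suc k) \<notin> Nrefl (pre k)"
    "Nrefl (pre (Suc k)) = insert (wall (Suc k)) (Nrefl (pre k))"
    using aff.N_snoc[OF k] unfolding wall_def pre_Suc by simp_all
qed

lemma Nrefl_pre_mono: assumes "k \<le> m" "m \<le> n" shows "Nrefl (pre k) \<subseteq> Nrefl (pre m)"
  using assms
proof (induction rule: dec_induct)
  case (step j)
  then show ?case using wall_new(2)[of j] by auto
qed simp

lemma wall_in_n: "k < n \<Longrightarrow> wall (Suc k) \<in> Nrefl (pre n)"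
  using Nrefl_pre_mono[of "Suc k" n] wall_new(2)[of k] by auto

text \<open>A point of the alcove translated by \<open>\<tau>\<close>, since \<open>a\<close>
  stabilises the fundamental alcove.\<close>

definition target :: 'a where "target = pre n c0"

lemma target_pairing: assumes "b \<in> \<Phi>\<^sub>+" shows "pairing target b > 0"
proof -
  have ba: "bij a" using Ext_bij[OF Pi_stab_Ext[OF a_Pi]] .
  have "inv a c0 \<in> A0 \<Phi> \<Delta>"
  proof -
    have "c0 \<in> a ` A0 \<Phi> \<Delta>" using a_Pi c0_A0 unfolding Pi_stab_def by simp
    then show ?thesis using ba by (auto simp: bij_is_inj)
  qed
  moreover have "target = \<tau> + inv a c0"
    using fun_cong[OF transl_pre, of "inv a c0"] ba
    by (simp add: target_def transl_def bij_is_surj surj_f_inv_f)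
  moreover have "pairing \<tau> b \<ge> 0" using tau assms unfolding dominant_weights_def by blast
  ultimately show ?thesis using A0_bounds[OF _ assms] by (simp add: pairing_add add_nonneg_pos)
qed

lemma pre_regular: "k \<le> n \<Longrightarrow> regular (pre k c0)"
  using Ext_c0_regular pre_Ext by blast

lemma Sep_pre: assumes "k \<le> n" shows "Sep (pre k c0) target = Nrefl (pre n) - Nrefl (pre k)"
proof -
  have "Sep (pre k c0) target = sym_diff (Sep (pre k c0) c0) (Sep c0 target)"
    unfolding target_def by (rule Sep_triangle[OF pre_regular[OF assms] c0_regular pre_regular[OF le_refl]])
  also have "Sep (pre k c0) c0 = Nrefl (pre k)" unfolding Nrefl_def by (rule Sep_commute)
  also have "Sep c0 target = Nrefl (pre n)" unfolding Nrefl_def target_def ..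
  finally show ?thesis using Nrefl_pre_mono[OF assms le_refl] by auto
qed

text \<open>A reduced path from the fundamental alcove to a dominant one crosses hyperplanes of
  positive roots upwards, at labels at least 1, and each only once.\<close>

lemma pre_Sep_sides:
  assumes "k \<le> n" "b \<in> \<Phi>\<^sub>+" "refl_aff b m \<in> Sep (pre k c0) target"
  shows "pairing (pre k c0) b < of_int m" "of_int m < pairing target b" "m \<ge> 1"
proof -
  have br: "b \<in> \<Phi>" using pos_root assms(2) .
  have "refl_aff b m \<in> Sep c0 (pre n c0)" "refl_aff b m \<notin> Sep c0 (pre k c0)"
    using assms(3) unfolding Sep_pre[OF assms(1)] Nrefl_def by blast+
  then have n: "(pairing c0 b - of_int m) * (pairing target b - of_int m) < 0"
    and k: "\<not> (pairing c0 b - of_int m) * (pairing (pre k c0) b - of_int m) < 0"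
    unfolding target_def using mem_Sep[OF br] by blast+
  have c: "0 < pairing c0 b" "pairing c0 b < 1" using c0_bounds[OF assms(2)] by auto
  have t: "pairing target b > 0" using target_pairing[OF assms(2)] .
  show m: "m \<ge> 1"
  proof (rule ccontr)
    assume "\<not> m \<ge> 1"
    then have "(of_int m :: real) \<le> 0" by simp
    then have "(pairing c0 b - of_int m) * (pairing target b - of_int m) > 0" using c t by (intro mult_pos_pos) auto
    then show False using n by linarith
  qed
  then have "(of_int m :: real) \<ge> 1" by simp
  then have cm: "pairing c0 b - of_int m < 0" using c by linarith
  then show "of_int m < pairing target b" using n by (simp add: mult_less_0_iff)
  have "pairing (pre k c0) b \<noteq> of_int m" using pre_regular[OF assms(1)] br unfolding regular_def by blast
  then show "pairing (pre k c0) b < of_int m" using k cm by (auto simp: mult_less_0_iff)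
qed

text \<open>Makes the description in \<open>crossing\<close> definite: consecutive alcoves are
  separated by exactly one hyperplane. The label is positive, so its conversion to a natural number
  loses nothing.\<close>

lemma wall_data:
  assumes "k < n"
  obtains N where "\<beta> (Suc k) \<in> \<Phi>\<^sub>+" "wall (Suc k) = refl_aff (\<beta> (Suc k)) N" "N \<ge> 1"
    "pairing (pre k c0) (\<beta> (Suc k)) < of_int N" "pairing (pre (Suc k) c0) (\<beta> (Suc k)) > of_int N"
proof -
  have k: "k \<le> n" "Suc k \<le> n" using assms by simp_all
  have pk: "pre k \<in> Ext" "pre (Suc k) \<in> Ext" using pre_Ext k by blast+
  have "wall (Suc k) \<in> Sep (pre k c0) target" using Sep_pre[OF k(1)] wall_in_n[OF assms] wall_new(1)[OF assms] by blast
  then obtain b m where b: "b \<in> \<Phi>\<^sub>+" "wall (Suc k) = refl_aff b m" by (rule SepE)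
  have br: "b \<in> \<Phi>" using pos_root b(1) .
  have "refl_aff b m \<in> Sep (pre k c0) target" using \<open>wall (Suc k) \<in> Sep (pre k c0) target\<close> b(2) by simp
  note sides = pre_Sep_sides[OF k(1) b(1) this]
  have swap: "Sep (pre k c0) (pre (Suc k) c0) = {refl_aff b m}"
    using Sep_image[OF pk(1), of c0 "s (Suc k) c0"] Sep_simple[OF s_Sa, of "Suc k"] assms b(2)
    unfolding pre_Suc wall_def by simp
  then have "refl_aff b m \<in> Sep (pre k c0) (pre (Suc k) c0)" by simp
  then have S: "(pairing (pre k c0) b - of_int m) * (pairing (pre (Suc k) c0) b - of_int m) < 0"
    using mem_Sep[OF br] by blast
  then have sk: "pairing (pre (Suc k) c0) b > of_int m" using sides(1) by (simp add: mult_less_0_iff)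
  have "crossing \<Phi> \<Delta> s (Suc k) = (b, nat m)"
    unfolding crossing_def
  proof (rule the_equality)
    have lo: "pairing z b < of_int m" if z: "z \<in> pre k ` A0 \<Phi> \<Delta>" for z
    proof -
      obtain w where w: "z = pre k w" "w \<in> A0 \<Phi> \<Delta>" using z by blast
      show ?thesis using Ext_side[OF pk(1) w(2) br, of m] w(1) sides(1) by (simp add: zero_less_mult_iff)
    qed
    have hi: "pairing z b > of_int m" if z: "z \<in> pre (Suc k) ` A0 \<Phi> \<Delta>" for z
    proof -
      obtain w where w: "z = pre (Suc k) w" "w \<in> A0 \<Phi> \<Delta>" using z by blast
      show ?thesis using Ext_side[OF pk(2) w(2) br, of m] w(1) sk by (simp add: zero_less_mult_iff)
    qed
    have "int (nat m) = m" using sides(3) by simp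
    then show "fst (b, nat m) \<in> \<Phi>\<^sub>+ \<and> separates (fst (b, nat m)) (int (snd (b, nat m)))
        (wprod (map s [1..<Suc k]) ` A0 \<Phi> \<Delta>) (wprod (map s [1..<Suc (Suc k)]) ` A0 \<Phi> \<Delta>)"
      unfolding separates_def pre_def[symmetric] fst_conv snd_conv using b(1) lo hi by auto
  next
    fix p assume p: "fst p \<in> \<Phi>\<^sub>+ \<and> separates (fst p) (int (snd p))
        (wprod (map s [1..<Suc k]) ` A0 \<Phi> \<Delta>) (wprod (map s [1..<Suc (Suc k)]) ` A0 \<Phi> \<Delta>)"
    have "pre k c0 \<in> pre k ` A0 \<Phi> \<Delta>" "pre (Suc k) c0 \<in> pre (Suc k) ` A0 \<Phi> \<Delta>" using c0_A0 by blast+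
    then have "(pairing (pre k c0) (fst p) - of_int (int (snd p))) * (pairing (pre (Suc k) c0) (fst p) - of_int (int (snd p))) < 0"
      using p unfolding separates_def pre_def[symmetric] by (fastforce intro: mult_neg_pos mult_pos_neg)
    then have "refl_aff (fst p) (int (snd p)) \<in> Sep (pre k c0) (pre (Suc k) c0)"
      using mem_Sep[OF pos_root] p by blast
    then have "refl_aff b m = refl_aff (fst p) (int (snd p))" using swap by simp
    from refl_aff_eq_cases[OF br pos_root this] p have "fst p = b \<and> int (snd p) = m"
      using pos_not_neg[OF b(1)] by auto
    then show "p = (b, nat m)" by (auto simp: prod_eq_iff)
  qed
  then have "\<beta> (Suc k) = b" by (simp add: beta_def)
  then show thesis using that[of m] b sides sk by simp
qed

lemma beta_pos: "k \<in> {1..n} \<Longrightarrow> \<beta> k \<in> \<Phi>\<^sub>+"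
proof -
  assume "k \<in> {1..n}"
  then have "k - 1 < n" "Suc (k - 1) = k" by auto
  then show ?thesis using wall_data[of "k - 1"] by metis
qed

text \<open>The letter weighs as much as the hyperplane crossed, which is at most as heavy as its
  parallel through 0.\<close>

lemma L_letter: assumes "k < n" shows "L (s (Suc k)) \<le> wt (\<beta> (Suc k))"
proof -
  obtain N where N: "\<beta> (Suc k) \<in> \<Phi>\<^sub>+" "wall (Suc k) = refl_aff (\<beta> (Suc k)) N" by (rule wall_data[OF assms])
  have k: "k \<le> n" "Suc k \<in> {1..n}" using assms by simp_all
  have "refl_aff (\<beta> (Suc k)) N = conj_by (pre k) (s (Suc k))" using N(2) by (simp add: wall_def)
  from L_hyp_eq[OF pos_root[OF N(1)] pre_Wa[OF k(1)] s_Sa[OF k(2)] this] show ?thesis using Lh_le_zero[OF pos_root[OF N(1)], of N] by simp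
qed

end

section \<open>The degree of a product of \<open>\<xi>\<close>'s\<close>

text \<open>The leading coefficient 1 is carried along so that leading terms cannot cancel in
  products.\<close>

definition monic_degree :: "laurent \<Rightarrow> int \<Rightarrow> bool" where
  "monic_degree p d \<longleftrightarrow> (\<exists>q. p = Poly_Mapping.single d 1 + q \<and> (\<forall>k\<in>Poly_Mapping.keys q. k < d))"

lemma monic_degree_mult:
  assumes "monic_degree p d" "monic_degree p' d'" shows "monic_degree (p * p') (d + d')"
proof -
  let ?x = "\<lambda>k. Poly_Mapping.single k (1::int)"
  obtain q where q: "p = ?x d + q" "\<And>k. k \<in> Poly_Mapping.keys q \<Longrightarrow> k < d"
    using assms(1) unfolding monic_degree_def by blast
  obtain q' where q': "p' = ?x d' + q'" "\<And>k. k \<in> Poly_Mapping.keys q' \<Longrightarrow> k < d'"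
    using assms(2) unfolding monic_degree_def by blast
  define r where "r = ?x d * q' + q * ?x d' + q * q'"
  have "p * p' = ?x (d + d') + r"
    unfolding q(1) q'(1) r_def by (simp add: distrib_left distrib_right mult_single)
  moreover have "k < d + d'" if k: "k \<in> Poly_Mapping.keys r" for k
  proof -
    have "k \<in> Poly_Mapping.keys (?x d * q') \<union> Poly_Mapping.keys (q * ?x d') \<union> Poly_Mapping.keys (q * q')"
      using k Poly_Mapping.keys_add[of "?x d * q' + q * ?x d'" "q * q'"]
        Poly_Mapping.keys_add[of "?x d * q'" "q * ?x d'"] unfolding r_def by blast
    then consider "k \<in> {a + b | a b. a \<in> Poly_Mapping.keys (?x d) \<and> b \<in> Poly_Mapping.keys q'}"
      | "k \<in> {a + b | a b. a \<in> Poly_Mapping.keys q \<and> b \<in> Poly_Mapping.keys (?x d')}"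
      | "k \<in> {a + b | a b. a \<in> Poly_Mapping.keys q \<and> b \<in> Poly_Mapping.keys q'}"
      using keys_mult[of "?x d" q'] keys_mult[of q "?x d'"] keys_mult[of q q'] by blast
    then show ?thesis
    proof cases
      case 1
      then show ?thesis using q'(2) by auto
    next
      case 2
      then show ?thesis using q(2) by auto
    next
      case 3
      then show ?thesis using q(2) q'(2) by (auto intro: add_strict_mono)
    qed
  qed
  ultimately show ?thesis unfolding monic_degree_def by blast
qed

lemma monic_degree_xi: assumes "l > 0" shows "monic_degree (xi l) (int l)"
proof -
  have "xi l = Poly_Mapping.single (int l) 1 + Poly_Mapping.single (- int l) (- 1)"
    unfolding xi_def by (simp add: single_uminus)
  then show ?thesis unfolding monic_degree_def using assms
    by (intro exI[of _ "Poly_Mapping.single (- int l) (- 1)"]) simp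
qed

lemma laurent_degree_monic: assumes "monic_degree p d" shows "laurent_degree p = d"
proof -
  obtain q where q: "p = Poly_Mapping.single d 1 + q" "\<And>k. k \<in> Poly_Mapping.keys q \<Longrightarrow> k < d"
    using assms unfolding monic_degree_def by blast
  have "Poly_Mapping.lookup q d = 0" using q(2)[of d] by (auto simp: in_keys_iff)
  then have "d \<in> Poly_Mapping.keys p" unfolding q(1) by (simp add: in_keys_iff lookup_add)
  moreover have "k \<le> d" if "k \<in> Poly_Mapping.keys p" for k
    using that Poly_Mapping.keys_add[of "Poly_Mapping.single d (1::int)" q] q(2)[of k] unfolding q(1) by auto
  ultimately show ?thesis unfolding laurent_degree_def by (intro Max_eqI) auto
qed

lemma laurent_degree_xi_set:
  assumes "finite J" "\<And>j. j \<in> J \<Longrightarrow> L (s j) > 0"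
  shows "laurent_degree (xi_set L s J) = int (\<Sum>j\<in>J. L (s j))"
proof -
  have "monic_degree (xi_set L s J) (int (\<Sum>j\<in>J. L (s j)))"
    using assms
  proof (induction J rule: finite_induct)
    case empty
    show ?case unfolding monic_degree_def xi_set_def by (intro exI[of _ 0]) (simp add: single_one)
  next
    case (insert j J)
    then show ?case
      using monic_degree_mult[OF monic_degree_xi, of "L (s j)" "xi_set L s J"] by (simp add: xi_set_def)
  qed
  then show ?thesis by (rule laurent_degree_monic)
qed

section \<open>Folded paths\<close>

locale folded_path = reduced_translation +
  fixes lam :: 'a and v :: "'a \<Rightarrow> 'a" and J :: "nat set"
  assumes lam: "lam \<in> dominant_weights \<Phi> \<Delta> L" and v: "v \<in> Wf" and J: "J \<subseteq> {1..n}"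
begin

text \<open>Unlike \<open>subword\<close>, this has no final factor \<open>a\<close>; the alcoves
  reached are the same because \<open>a\<close> stabilises the fundamental alcove.\<close>

definition sub :: "nat \<Rightarrow> 'a \<Rightarrow> 'a" where "sub k = wprod (map s (filter (\<lambda>r. r \<notin> J) [1..<Suc k]))"

definition f :: "nat \<Rightarrow> 'a \<Rightarrow> 'a" where "f k = transl lam \<circ> v \<circ> sub k"

text \<open>The folded path up to step \<open>k\<close> followed by the rest of the unfolded one is the image of the
  unfolded path under \<open>g k\<close>.\<close>

definition g :: "nat \<Rightarrow> 'a \<Rightarrow> 'a" where "g k = f k \<circ> inv (pre k)"

definition u :: "nat \<Rightarrow> 'a \<Rightarrow> 'a" where "u k = lin (g k)"

definition A :: "nat \<Rightarrow> 'a" where "A k = f k c0"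

text \<open>The end of the path if no further fold is made after step \<open>k\<close>.\<close>

definition E :: "nat \<Rightarrow> 'a" where "E k = g k target"

text \<open>The wall between the alcove of \<open>A k\<close> and the one that step
  \<open>Suc k\<close> would reach without folding.\<close>

definition fold_refl :: "nat \<Rightarrow> 'a \<Rightarrow> 'a" where "fold_refl k = conj_by (f k) (s (Suc k))"

lemma sub_0: "sub 0 = id"
  by (simp add: sub_def)

lemma sub_Suc: "sub (Suc k) = (if Suc k \<in> J then sub k else sub k \<circ> s (Suc k))"
  by (simp add: sub_def)

lemma sub_Wa: "k \<le> n \<Longrightarrow> sub k \<in> Wa \<Phi>"
  unfolding sub_def by (rule aff.wprod_in_W) (use s_Sa in auto)

lemma lam_weight: "lam \<in> L_weights \<Phi> \<Delta> L" and lam_dominant: "b \<in> \<Phi>\<^sub>+ \<Longrightarrow> pairing lam b \<ge> 0"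
  using lam unfolding dominant_weights_def by blast+

lemma lam_integral: "integral lam"
  using L_weights_integral lam_weight by blast

lemma start_Ext: "transl lam \<circ> v \<in> Ext" "lin (transl lam \<circ> v) = v"
  using ExtI[OF v lam_integral] lin_Ext[OF v] by blast+

lemma f_Ext: "k \<le> n \<Longrightarrow> f k \<in> Ext"
  unfolding f_def by (rule Ext_comp(1)[OF start_Ext(1) Wa_Ext[OF sub_Wa]])

lemma g_Ext: "k \<le> n \<Longrightarrow> g k \<in> Ext"
  unfolding g_def by (rule Ext_comp(1)[OF f_Ext Ext_inv(1)[OF pre_Ext]])

lemma u_Wf: "k \<le> n \<Longrightarrow> u k \<in> Wf"
  unfolding u_def by (rule Ext_lin[OF g_Ext])

lemma g_0: "g 0 = transl lam \<circ> v"
  by (simp add: g_def f_def sub_0 pre_0)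

lemma u_0: "u 0 = v"
  unfolding u_def g_0 by (rule start_Ext(2))

lemma g_pre: "k \<le> n \<Longrightarrow> g k (pre k x) = f k x"
  unfolding g_def using Ext_bij[OF pre_Ext] by (simp add: bij_is_inj)

lemma A_g: "k \<le> n \<Longrightarrow> A k = g k (pre k c0)"
  unfolding A_def by (rule g_pre[symmetric])

lemma letter: assumes "k < n"
  shows "s (Suc k) \<in> Sa \<Phi> \<Delta>" "bij (s (Suc k))" "inv (s (Suc k)) = s (Suc k)" "s (Suc k) \<circ> s (Suc k) = id"
proof -
  show S: "s (Suc k) \<in> Sa \<Phi> \<Delta>" using s_Sa assms by simp
  show i: "s (Suc k) \<circ> s (Suc k) = id" by (rule Sa_involution[OF S])
  show "bij (s (Suc k))" "inv (s (Suc k)) = s (Suc k)"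
    using involution_bij[OF i] involution_inv[OF i] by blast+
qed

lemma inv_pre_Suc: assumes "k < n" shows "inv (pre (Suc k)) = s (Suc k) \<circ> inv (pre k)"
  unfolding pre_Suc using o_inv_distrib[OF Ext_bij[OF pre_Ext] letter(2)[OF assms], of k] letter(3)[OF assms] assms
  by simp

text \<open>The same letter extends the folded and the unfolded prefix, so it cancels and the end of
  the path does not move.\<close>

lemma g_out: assumes "k < n" "Suc k \<notin> J" shows "g (Suc k) = g k" "f (Suc k) = f k \<circ> s (Suc k)"
proof -
  show f: "f (Suc k) = f k \<circ> s (Suc k)" unfolding f_def sub_Suc using assms(2) by (simp add: comp_assoc)
  have "g (Suc k) = f k \<circ> (s (Suc k) \<circ> s (Suc k)) \<circ> inv (pre k)"
    unfolding g_def f inv_pre_Suc[OF assms(1)] by (simp add: comp_assoc)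
  then show "g (Suc k) = g k" unfolding letter(4)[OF assms(1)] g_def by simp
qed

lemma f_in: "Suc k \<in> J \<Longrightarrow> f (Suc k) = f k"
  unfolding f_def sub_Suc by simp

lemma g_in: assumes "k < n" "Suc k \<in> J" shows "g (Suc k) = g k \<circ> wall (Suc k)"
proof -
  have b: "bij (pre k)" using Ext_bij[OF pre_Ext] assms(1) by simp
  have "g k \<circ> wall (Suc k) = f k \<circ> (inv (pre k) \<circ> pre k) \<circ> s (Suc k) \<circ> inv (pre k)"
    unfolding g_def wall_def conj_by_def by (simp add: comp_assoc)
  also have "inv (pre k) \<circ> pre k = id" using b by (simp add: bij_is_inj)
  finally show ?thesis
    unfolding g_def[of "Suc k"] f_in[OF assms(2)] inv_pre_Suc[OF assms(1)] comp_id comp_assoc by (rule sym)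
qed

lemma A_in: "Suc k \<in> J \<Longrightarrow> A (Suc k) = A k"
  unfolding A_def by (simp add: f_in)

lemma fold_refl_wall: assumes "k < n" shows "fold_refl k = conj_by (g k) (wall (Suc k))"
proof -
  have b: "bij (pre k)" "bij (g k)" using Ext_bij[OF pre_Ext] Ext_bij[OF g_Ext] assms by simp_all
  have "g k \<circ> pre k = f k" unfolding g_def comp_assoc using b(1) by (simp add: bij_is_inj)
  then show ?thesis unfolding fold_refl_def wall_def using conj_by_comp[OF b(2,1)] by simp
qed

lemma fold_refl_Sep: assumes "k < n" shows "Sep (A k) (f k (s (Suc k) c0)) = {fold_refl k}"
  using Sep_image[OF f_Ext, of k c0 "s (Suc k) c0"] Sep_simple[OF letter(1)[OF assms]] assms
  unfolding A_def fold_refl_def by simp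

lemma fold_refl_A: assumes "k < n" shows "fold_refl k (A k) = f k (s (Suc k) c0)"
  unfolding fold_refl_def A_def conj_by_def using Ext_bij[OF f_Ext, of k] assms by (simp add: bij_is_inj)

lemma regular_A: "k \<le> n \<Longrightarrow> regular (A k)"
  unfolding A_def by (rule Ext_c0_regular[OF f_Ext])

lemma regular_E: "k \<le> n \<Longrightarrow> regular (E k)"
  unfolding E_def target_def by (rule regular_Ext[OF g_Ext pre_regular]) simp_all

text \<open>This is \<open>wall_data\<close> transported by \<open>g k\<close>: the unfolded path
  crosses in direction \<open>\<beta> (Suc k)\<close> upwards, so the folded one is about to cross
  upwards in direction \<open>u k (\<beta> (Suc k))\<close>, whatever the sign of that root.\<close>

lemma fold_data:
  assumes "k < n"
  obtains M where "\<beta> (Suc k) \<in> \<Phi>\<^sub>+" "u k (\<beta> (Suc k)) \<in> \<Phi>" "fold_refl k = refl_aff (u k (\<beta> (Suc k))) M"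
    "pairing (A k) (u k (\<beta> (Suc k))) < of_int M" "pairing (E k) (u k (\<beta> (Suc k))) > of_int M"
    "u (Suc k) = (if Suc k \<in> J then u k \<circ> rfl (\<beta> (Suc k)) else u k)"
proof -
  have k: "k \<le> n" using assms by simp
  let ?b = "\<beta> (Suc k)"
  obtain N where N: "?b \<in> \<Phi>\<^sub>+" "wall (Suc k) = refl_aff ?b N" "pairing (pre k c0) ?b < of_int N"
    by (rule wall_data[OF assms])
  have b: "?b \<in> \<Phi>" using pos_root N(1) .
  have gE: "g k \<in> Ext" using g_Ext k .
  have ub: "u k ?b \<in> \<Phi>" unfolding u_def using Wf_root[OF Ext_lin[OF gE] b] .
  have "wall (Suc k) \<in> Sep (pre k c0) target"
    using Sep_pre[OF k] wall_in_n[OF assms] wall_new(1)[OF assms] by blast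
  then have T: "of_int N < pairing target ?b" using pre_Sep_sides(2)[OF k N(1)] N(2) by simp
  have r: "fold_refl k = refl_aff (u k ?b) (N + shift (g k) ?b)"
    unfolding fold_refl_wall[OF assms] N(2) u_def by (rule conj_refl_aff[OF gE b])
  have p: "pairing (A k) (u k ?b) < of_int (N + shift (g k) ?b)"
    "pairing (E k) (u k ?b) > of_int (N + shift (g k) ?b)"
    using N(3) T Ext_pairing[OF gE b] unfolding A_g[OF k] E_def u_def by simp_all
  have "u (Suc k) = (if Suc k \<in> J then u k \<circ> rfl ?b else u k)"
  proof (cases "Suc k \<in> J")
    case True
    then show ?thesis
      unfolding u_def g_in[OF assms True] N(2) Ext_comp(2)[OF gE refl_aff_Ext(1)[OF b]] refl_aff_Ext(2)[OF b]
      by simp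
  next
    case False
    then show ?thesis unfolding u_def g_out(1)[OF assms False] by simp
  qed
  then show thesis using that N(1) ub r p by blast
qed

lemma E_in: assumes "k < n" "Suc k \<in> J" shows "E (Suc k) = fold_refl k (E k)"
  unfolding E_def g_in[OF assms] fold_refl_wall[OF assms(1)] conj_by_def
  using Ext_bij[OF g_Ext, of k] assms(1) by (simp add: bij_is_inj)

lemma E_out: "k < n \<Longrightarrow> Suc k \<notin> J \<Longrightarrow> E (Suc k) = E k"
  unfolding E_def by (simp add: g_out)

lemma fold_refl_AE: assumes "k < n" shows "fold_refl k \<in> Sep (A k) (E k)"
proof -
  obtain M where "u k (\<beta> (Suc k)) \<in> \<Phi>" "fold_refl k = refl_aff (u k (\<beta> (Suc k))) M"
    "pairing (A k) (u k (\<beta> (Suc k))) < of_int M" "pairing (E k) (u k (\<beta> (Suc k))) > of_int M"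
    by (rule fold_data[OF assms])
  then show ?thesis using mem_Sep by (simp add: mult_neg_pos)
qed

abbreviation pot :: "nat \<Rightarrow> nat" where "pot k \<equiv> potential (A k) (E k)"

lemma A_out_Sep: assumes "k < n" "Suc k \<notin> J" shows "Sep (A k) (A (Suc k)) = {fold_refl k}"
  using fold_refl_Sep[OF assms(1)] g_out(2)[OF assms] unfolding A_def by simp

text \<open>The crossed hyperplane separated \<open>A k\<close> from \<open>E k\<close> and no
  longer does so afterwards; all other hyperplanes keep their position relative to the three
  points.\<close>

lemma pdir_out:
  assumes "k < n" "Suc k \<notin> J" shows "pdir (A (Suc k)) (E (Suc k)) \<subseteq> pdir (A k) (E k)"
proof -
  have k: "k \<le> n" "Suc k \<le> n" using assms(1) by simp_all
  note rA = regular_A[OF k(1)] regular_A[OF k(2)]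
  have 1: "Sep (A k) z = sym_diff {fold_refl k} (Sep (A (Suc k)) z)" if "regular z" for z
    using Sep_triangle[OF rA that] A_out_Sep[OF assms] by simp
  have 2: "t \<in> Sep (A k) z" if "regular z" "t \<in> Sep (A (Suc k)) z" "t \<noteq> fold_refl k" for t z
    using 1[OF that(1)] that(2,3) by simp
  have 3: "fold_refl k \<notin> Sep (A (Suc k)) (E k)"
    using 1[OF regular_E[OF k(1)]] fold_refl_AE[OF assms(1)] by auto
  have "bdir (A (Suc k)) (E k) \<subseteq> bdir (A k) (E k)"
  proof
    fix b assume "b \<in> bdir (A (Suc k)) (E k)"
    then obtain m where m: "b \<in> \<Phi>" "refl_aff b m \<in> Sep (A (Suc k)) c1" "refl_aff b m \<in> Sep (A (Suc k)) (E k)"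
      unfolding bdir_def by blast
    then have "refl_aff b m \<noteq> fold_refl k" using 3 by metis
    then show "b \<in> bdir (A k) (E k)"
      unfolding bdir_def using 2[OF c1_regular m(2)] 2[OF regular_E[OF k(1)] m(3)] m(1) by blast
  qed
  then show ?thesis unfolding pdir_def E_out[OF assms] by blast
qed

lemma pot_out: "k < n \<Longrightarrow> Suc k \<notin> J \<Longrightarrow> pot (Suc k) \<le> pot k"
  unfolding potential_def by (rule sum_wt_mono[OF pdir_out pdir_pos])

text \<open>The step would move towards the opposite alcove. After multiplication by the longest
  element this is the Bruhat descent in \<open>I_set\<close>, see
  \<open>fold_positive_iff\<close>.\<close>

definition fold_positive :: "nat \<Rightarrow> bool" where "fold_positive k \<longleftrightarrow> fold_refl k \<in> Sep c1 (A k)"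

lemma pot_in:
  assumes "k < n" "Suc k \<in> J" "fold_positive k" shows "pot (Suc k) + wt (\<beta> (Suc k)) \<le> pot k"
proof -
  have k: "k \<le> n" using assms(1) by simp
  let ?b = "\<beta> (Suc k)"
  obtain M where M: "?b \<in> \<Phi>\<^sub>+" "u k ?b \<in> \<Phi>" "fold_refl k = refl_aff (u k ?b) M"
    "pairing (A k) (u k ?b) < of_int M" "pairing (E k) (u k ?b) > of_int M"
    by (rule fold_data[OF assms(1)])
  have r: "refl_aff (- u k ?b) (- M) = fold_refl k" using M(3) refl_aff_minus by simp
  have "(pairing c1 (u k ?b) - of_int M) * (pairing (A k) (u k ?b) - of_int M) < 0"
    using assms(3) mem_Sep[OF M(2)] unfolding fold_positive_def M(3) by blast
  then have c1: "pairing c1 (u k ?b) > of_int M" using M(4) by (simp add: mult_less_0_iff)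
  \<comment> \<open>The locale expects \<open>A k\<close> above the folding hyperplane, whence the
    sign change of root and label.\<close>
  interpret fold \<Phi> \<Delta> L "A k" "E k" "- u k ?b" "- M"
  proof unfold_locales
    show "Sep (A k) (refl_aff (- u k ?b) (- M) (A k)) = {refl_aff (- u k ?b) (- M)}"
      unfolding r fold_refl_A[OF assms(1)] by (rule fold_refl_Sep[OF assms(1)])
  qed (use regular_A[OF k] regular_E[OF k] minus_root[OF M(2)] M(4,5) c1 in \<open>simp_all add: pairing_minus_right\<close>)
  have "pot (Suc k) = potential (A k) (refl_aff (- u k ?b) (- M) (E k))"
    unfolding A_in[OF assms(2)] E_in[OF assms(1,2)] r ..
  moreover have "wt (- u k ?b) = wt ?b"
    using wt_minus wt_Wf[OF u_Wf[OF k] pos_root[OF M(1)]] by simp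
  ultimately show ?thesis using potential_fold by simp
qed

text \<open>A hyperplane of direction \<open>c\<close> with \<open>c1\<close> on one side has label
  at least 0 here, with \<open>A k\<close> above and hence \<open>E k\<close> below it. Pulled back
  by \<open>g k\<close>, the unfolded path descends in direction \<open>inv (u k) c\<close>, which
  is impossible for a positive root. The bound -1 rather than 0 admits the initial alcove, which
  touches \<open>lam\<close> but may lie outside the chamber.\<close>

lemma pdir_bound:
  assumes "k \<le> n" "\<And>c. c \<in> \<Phi>\<^sub>+ \<Longrightarrow> pairing (A k) c > -1"
  shows "pdir (A k) (E k) \<subseteq> invset (u k)"
    and "c \<in> pdir (A k) (E k) \<Longrightarrow> pairing (A k) c > 0"
proof -
  have *: "pairing (A k) c > 0 \<and> c \<in> invset (u k)" if c: "c \<in> pdir (A k) (E k)" for c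
  proof -
    obtain m where m: "c \<in> \<Phi>\<^sub>+" "refl_aff c m \<in> Sep (A k) c1" "refl_aff c m \<in> Sep (A k) (E k)"
      using c unfolding pdir_def bdir_def by blast
    have cr: "c \<in> \<Phi>" using pos_root m(1) .
    have p: "(pairing (A k) c - of_int m) * (pairing c1 c - of_int m) < 0"
      "(pairing (A k) c - of_int m) * (pairing (E k) c - of_int m) < 0"
      using m(2,3) mem_Sep[OF cr] by blast+
    have b: "-1 < pairing c1 c" "pairing c1 c < 0" using c1_bounds[OF m(1)] by auto
    have up: "of_int m < pairing (A k) c"
    proof (rule ccontr)
      assume "\<not> ?thesis"
      then have "pairing (A k) c < of_int m" "of_int m < pairing c1 c" using p(1) by (auto simp: mult_less_0_iff)
      then have "(of_int m :: real) < 0" "(-1 :: real) < of_int m" using b assms(2)[OF m(1)] by linarith+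
      then have "m < 0" "-1 < m" by linarith+
      then show False by simp
    qed
    then have "pairing c1 c < of_int m" using p(1) by (auto simp: mult_less_0_iff)
    then have "(-1 :: real) < of_int m" using b by linarith
    then have "m \<ge> 0" by linarith
    then have pos: "pairing (A k) c > 0" using up by (meson of_int_0_le_iff le_less_trans)
    have down: "pairing (E k) c < of_int m" using p(2) up by (auto simp: mult_less_0_iff)
    have gE: "g k \<in> Ext" using g_Ext assms(1) .
    let ?d = "inv (u k) c"
    have d: "?d \<in> \<Phi>" using Wf_root[OF Wf_inv[OF u_Wf[OF assms(1)]] cr] .
    have ud: "lin (g k) ?d = c"
      using Wf_bij[OF u_Wf[OF assms(1)]] unfolding u_def by (simp add: bij_is_surj surj_f_inv_f)
    define j where "j = m - shift (g k) ?d"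
    have q: "pairing (pre k c0) ?d > of_int j" "pairing target ?d < of_int j"
      using Ext_pairing[OF gE d, unfolded ud, of "pre k c0"] Ext_pairing[OF gE d, unfolded ud, of target] up down
      unfolding A_g[OF assms(1)] E_def j_def by simp_all
    have "?d \<notin> \<Phi>\<^sub>+"
    proof
      assume dp: "?d \<in> \<Phi>\<^sub>+"
      have "refl_aff ?d j \<in> Sep (pre k c0) target" using mem_Sep[OF d] q by (simp add: mult_pos_neg)
      from pre_Sep_sides(1)[OF assms(1) dp this] show False using q(1) by linarith
    qed
    then show ?thesis using pos m(1) unfolding invset_def by blast
  qed
  show "pdir (A k) (E k) \<subseteq> invset (u k)" using * by blast
  show "c \<in> pdir (A k) (E k) \<Longrightarrow> pairing (A k) c > 0" using * by blast
qed

lemma pot_bound: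
  assumes "k \<le> n" "\<And>c. c \<in> \<Phi>\<^sub>+ \<Longrightarrow> pairing (A k) c > -1" shows "pot k \<le> L (u k)"
  unfolding potential_def weight_Wf[OF u_Wf[OF assms(1)]]
  by (rule sum_wt_mono[OF pdir_bound(1)[OF assms] invset_pos])

lemma A_0_pairing: "pairing (A 0) c = pairing lam c + pairing c0 (inv v c)"
proof -
  have "A 0 = lam + v c0" by (simp add: A_def f_def sub_0 transl_def)
  then show ?thesis using pairing_Wf_inv[OF v] by (simp add: pairing_add)
qed

lemma A_0_bound: assumes "c \<in> \<Phi>\<^sub>+" shows "pairing (A 0) c > -1"
  using A_0_pairing[of c] lam_dominant[OF assms] c0_sign(2)[OF Wf_root[OF Wf_inv[OF v] pos_root[OF assms]]]
  by simp

lemma pot_0: "pot 0 \<le> L v"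
  using pot_bound[OF _ A_0_bound] u_0 by simp

subsection \<open>Subsets and foldings\<close>

text \<open>The longest element maps \<open>c1\<close> to \<open>c0\<close>, so conjugation by it
  turns separation of \<open>A k\<close> from \<open>c1\<close> into the criterion
  \<open>bruhat_less_e_snoc\<close>. Steps are indexed by \<open>k = j - 1 < n\<close>, so
  \<open>subword\<close> never includes \<open>a\<close> here.\<close>

lemma fold_positive_iff:
  "J \<in> I_set \<Phi> \<Delta> L s n a lam v \<longleftrightarrow> (\<forall>k<n. Suc k \<in> J \<longrightarrow> fold_positive k)"
proof -
  let ?w = "longest \<Phi> \<Delta>"
  have w: "?w \<in> Wf" "bij ?w" using longest_Wf Wf_bij by blast+
  have key: "bruhat_less_e \<Phi> \<Delta> L (?w \<circ> transl lam \<circ> v \<circ> subword s n a J k \<circ> s (Suc k))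
      (?w \<circ> transl lam \<circ> v \<circ> subword s n a J k) \<longleftrightarrow> fold_positive k" if k: "k < n" for k
  proof -
    have sw: "subword s n a J k = sub k" using k unfolding subword_def sub_def Let_def by simp
    have eq: "?w \<circ> transl lam \<circ> v \<circ> subword s n a J k = ?w \<circ> f k"
      unfolding sw f_def by (simp add: comp_assoc)
    have fE: "f k \<in> Ext" "bij (f k)" using f_Ext Ext_bij k by simp_all
    have "transl lam \<circ> v \<in> We \<Phi> \<Delta> L" unfolding We_def W0_eq using lam_weight v by blast
    then have "f k \<in> We \<Phi> \<Delta> L" unfolding f_def using We_Wa_right sub_Wa k by simp
    then have x: "?w \<circ> f k \<in> We \<Phi> \<Delta> L" using We_Wa_left Wf_Wa[OF w(1)] by blast
    have "conj_by (?w \<circ> f k) (s (Suc k)) = conj_by ?w (fold_refl k)"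
      unfolding fold_refl_def by (rule conj_by_comp[OF w(2) fE(2)])
    moreover have "Sep c0 ((?w \<circ> f k) c0) = conj_by ?w ` Sep c1 (A k)"
      using Sep_image[OF Wf_Ext[OF w(1)], of c1 "A k"] longest_c1 unfolding A_def by simp
    ultimately show ?thesis
      unfolding eq bruhat_less_e_snoc[OF x letter(1)[OF k]] fold_positive_def
      using inj_image_mem_iff[OF inj_conj_by[OF w(2)]] by simp
  qed
  have "J \<in> I_set \<Phi> \<Delta> L s n a lam v \<longleftrightarrow>
    (\<forall>j\<in>J. bruhat_less_e \<Phi> \<Delta> L (?w \<circ> transl lam \<circ> v \<circ> subword s n a J (j - 1) \<circ> s j)
      (?w \<circ> transl lam \<circ> v \<circ> subword s n a J (j - 1)))"
    unfolding I_set_def Let_def using J by blast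
  also have "\<dots> \<longleftrightarrow> (\<forall>k<n. Suc k \<in> J \<longrightarrow> fold_positive k)"
  proof (intro iffI ballI allI impI)
    fix k assume *: "\<forall>j\<in>J. bruhat_less_e \<Phi> \<Delta> L (?w \<circ> transl lam \<circ> v \<circ> subword s n a J (j - 1) \<circ> s j)
      (?w \<circ> transl lam \<circ> v \<circ> subword s n a J (j - 1))" "k < n" "Suc k \<in> J"
    from bspec[OF *(1) *(3)] show "fold_positive k" using key[OF *(2)] by simp
  next
    fix j assume *: "\<forall>k<n. Suc k \<in> J \<longrightarrow> fold_positive k" "j \<in> J"
    then have j: "j - 1 < n" "Suc (j - 1) = j" using J by fastforce+
    then show "bruhat_less_e \<Phi> \<Delta> L (?w \<circ> transl lam \<circ> v \<circ> subword s n a J (j - 1) \<circ> s j)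
      (?w \<circ> transl lam \<circ> v \<circ> subword s n a J (j - 1))"
      using key[OF j(1)] * by simp
  qed
  finally show ?thesis .
qed

lemma I_max_iff:
  "J \<in> I_max \<Phi> \<Delta> L s n a lam v \<longleftrightarrow>
    (\<forall>k<n. Suc k \<in> J \<longrightarrow> fold_positive k) \<and> (\<Sum>j\<in>J. L (s j)) = L v"
proof -
  have "finite J" using J finite_subset by blast
  moreover have "L (s j) > 0" if "j \<in> J" for j using weight_pos[OF s_Sa] J that by blast
  ultimately have "laurent_degree (xi_set L s J) = int (\<Sum>j\<in>J. L (s j))" by (rule laurent_degree_xi_set)
  then show ?thesis unfolding I_max_def mem_Collect_eq fold_positive_iff by (simp only: of_nat_eq_iff)
qed

lemma dominant_iff:
  "path_in \<Phi> \<Delta> s n a J (transl lam \<circ> v) (chamber \<Phi> \<Delta>) \<longleftrightarrow> (\<forall>k\<in>{1..n}. A k \<in> chamber \<Phi> \<Delta>)"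
proof -
  have "(transl lam \<circ> v \<circ> subword s n a J k) ` A0 \<Phi> \<Delta> \<subseteq> chamber \<Phi> \<Delta> \<longleftrightarrow> A k \<in> chamber \<Phi> \<Delta>"
    if k: "k \<in> {1..n}" for k
  proof -
    have "subword s n a J k ` A0 \<Phi> \<Delta> = sub k ` A0 \<Phi> \<Delta>"
    proof (cases "k = n")
      case True
      then have "subword s n a J k = sub k \<circ> a" unfolding subword_def sub_def Let_def by simp
      then have "subword s n a J k ` A0 \<Phi> \<Delta> = sub k ` (a ` A0 \<Phi> \<Delta>)" by (simp add: image_comp)
      also have "a ` A0 \<Phi> \<Delta> = A0 \<Phi> \<Delta>" using a_Pi unfolding Pi_stab_def by blast
      finally show ?thesis .
    next
      case False
      then show ?thesis unfolding subword_def sub_def Let_def by simp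
    qed
    then have "(transl lam \<circ> v \<circ> subword s n a J k) ` A0 \<Phi> \<Delta> = f k ` A0 \<Phi> \<Delta>"
      unfolding f_def by (metis image_comp)
    then show ?thesis using alcove_in_chamber[OF f_Ext, of k] k unfolding A_def by simp
  qed
  then show ?thesis unfolding path_in_def by blast
qed

section \<open>Products of root reflections along the subset, and the chain of an admissible
  subset\<close>

definition R :: "nat \<Rightarrow> 'a \<Rightarrow> 'a" where "R k = wprod (map (\<lambda>j. rfl (\<beta> j)) (filter (\<lambda>j. j \<in> J) [1..<Suc k]))"

lemma R_Suc: "R (Suc k) = (if Suc k \<in> J then R k \<circ> rfl (\<beta> (Suc k)) else R k)"
  by (simp add: R_def)

lemma R_Wf: "k \<le> n \<Longrightarrow> R k \<in> Wf"
  unfolding R_def Wf_words using J pos_root[OF beta_pos]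
  by (intro CollectI exI[of _ "map (\<lambda>j. rfl (\<beta> j)) (filter (\<lambda>j. j \<in> J) [1..<Suc k])"] conjI refl) auto

lemma u_R: "k \<le> n \<Longrightarrow> u k = v \<circ> R k"
proof (induction k)
  case 0
  show "u 0 = v \<circ> R 0" by (simp add: u_0 R_def)
next
  case (Suc k)
  from Suc.prems have k: "k < n" "k \<le> n" by simp_all
  note uk = Suc.IH[OF k(2)]
  have "u (Suc k) = (if Suc k \<in> J then u k \<circ> rfl (\<beta> (Suc k)) else u k)"
    by (rule fold_data[OF k(1)])
  then show "u (Suc k) = v \<circ> R (Suc k)"
    unfolding uk R_Suc by (cases "Suc k \<in> J") (simp_all only: if_True if_False comp_assoc)
qed

abbreviation cnt :: "nat \<Rightarrow> nat" where "cnt k \<equiv> length (filter (\<lambda>j. j \<in> J) [1..<Suc k])"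

lemma sorted_J: "sorted_list_of_set J = filter (\<lambda>j. j \<in> J) [1..<Suc n]"
proof -
  have "set (filter (\<lambda>j. j \<in> J) [1..<Suc n]) = J" using J by auto
  then show ?thesis
    using sorted_list_of_set.idem_if_sorted_distinct[of "filter (\<lambda>j. j \<in> J) [1..<Suc n]"]
    by (metis distinct_filter distinct_upt sorted_wrt_filter sorted_upt)
qed

lemma card_J: "card J = cnt n"
proof -
  have "finite J" using J finite_subset by blast
  then show ?thesis using length_sorted_list_of_set[of J] sorted_J by simp
qed

text \<open>The chain starts with the largest indices in decreasing order. Its member made of the
  indices beyond \<open>k\<close> is the inverse of the tail of the product \<open>R n\<close> after
  \<open>R k\<close>.\<close>

lemma v_chain_R: assumes "k \<le> n" shows "v_chain \<Phi> \<Delta> s J (card J - cnt k) = inv (R n) \<circ> R k"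
proof -
  define D where "D = filter (\<lambda>j. j \<in> J) [Suc k..<Suc n]"
  define F where "F = filter (\<lambda>j. j \<in> J) [1..<Suc k]"
  let ?r = "\<lambda>j. rfl (\<beta> j)"
  have "[1..<Suc n] = [1..<Suc k] @ [Suc k..<Suc n]"
    using upt_add_eq_append[of 1 "Suc k" "n - k"] assms by simp
  then have split: "filter (\<lambda>j. j \<in> J) [1..<Suc n] = F @ D" unfolding D_def F_def by simp
  have D_J: "set D \<subseteq> {1..n}" "set F \<subseteq> {1..n}" unfolding D_def F_def using J by auto
  have inv_r: "r \<circ> r = id" if "r \<in> set (map ?r D)" for r
    using that refl_aff_involution[OF pos_nz[OF beta_pos]] D_J by auto
  note wD = wprod_involutions[of "map ?r D", OF inv_r]
  have bF: "bij (R k)" using Wf_bij[OF R_Wf[OF assms]] .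
  have Rn: "R n = R k \<circ> wprod (map ?r D)" unfolding R_def split F_def by simp
  have "inv (R n) = inv (wprod (map ?r D)) \<circ> inv (R k)" unfolding Rn by (rule o_inv_distrib[OF bF wD(2)])
  then have "inv (R n) \<circ> R k = inv (wprod (map ?r D))" using bF by (simp add: comp_assoc bij_is_inj)
  also have "\<dots> = wprod (map ?r (rev D))" using wD(3) by (simp add: rev_map)
  also have "rev D = take (card J - cnt k) (rev (sorted_list_of_set J))"
    unfolding sorted_J card_J split F_def[symmetric] by simp
  finally show ?thesis unfolding v_chain_def by (rule sym)
qed

lemma v_of_R: "v_of \<Phi> \<Delta> s J = inv (R n)"
  using v_chain_R[of 0] unfolding v_of_def by (simp add: R_def)

text \<open>The count rises by one exactly at the elements of \<open>J\<close>, so every position in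
  the chain comes from a folding step.\<close>

lemma cnt_steps: "q < cnt k \<Longrightarrow> \<exists>j<k. Suc j \<in> J \<and> cnt j = q"
proof (induction k)
  case (Suc k)
  then show ?case by (cases "q < cnt k") (auto simp: less_Suc_eq split: if_splits)
qed simp

lemma admissible_iff:
  "admissible \<Phi> \<Delta> s J \<longleftrightarrow>
    (\<forall>k<n. Suc k \<in> J \<longrightarrow> bruhat_covered (W0 \<Phi>) (S0 \<Delta>) (inv (R n) \<circ> R (Suc k)) (inv (R n) \<circ> R k))"
proof -
  have cnt_le: "cnt k \<le> card J" if "k \<le> n" for k
  proof -
    have "[1..<Suc n] = [1..<Suc k] @ [Suc k..<Suc n]"
      using upt_add_eq_append[of 1 "Suc k" "n - k"] that by simp
    then show ?thesis unfolding card_J by simp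
  qed
  have idx: "card J - cnt k = Suc (card J - cnt (Suc k))" if "k < n" "Suc k \<in> J" for k
    using cnt_le[of "Suc k"] that by simp
  show ?thesis
  proof (intro iffI allI impI)
    fix k assume *: "admissible \<Phi> \<Delta> s J" "k < n" "Suc k \<in> J"
    have "card J - cnt (Suc k) < card J" using idx[OF *(2,3)] by linarith
    with *(1) have "bruhat_covered (W0 \<Phi>) (S0 \<Delta>) (v_chain \<Phi> \<Delta> s J (card J - cnt (Suc k)))
        (v_chain \<Phi> \<Delta> s J (card J - cnt k))"
      unfolding admissible_def idx[OF *(2,3)] by blast
    moreover have "k \<le> n" "Suc k \<le> n" using *(2) by simp_all
    ultimately show "bruhat_covered (W0 \<Phi>) (S0 \<Delta>) (inv (R n) \<circ> R (Suc k)) (inv (R n) \<circ> R k)"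
      by (metis v_chain_R)
  next
    assume *: "\<forall>k<n. Suc k \<in> J \<longrightarrow> bruhat_covered (W0 \<Phi>) (S0 \<Delta>) (inv (R n) \<circ> R (Suc k)) (inv (R n) \<circ> R k)"
    show "admissible \<Phi> \<Delta> s J"
      unfolding admissible_def
    proof (intro allI impI)
      fix m assume m: "m < card J"
      then have "card J - Suc m < cnt n" using card_J by simp
      then obtain k where k: "k < n" "Suc k \<in> J" "cnt k = card J - Suc m" using cnt_steps by blast
      then have "card J - cnt (Suc k) = m" "card J - cnt k = Suc m" using m idx[OF k(1,2)] by simp_all
      then show "bruhat_covered (W0 \<Phi>) (S0 \<Delta>) (v_chain \<Phi> \<Delta> s J m) (v_chain \<Phi> \<Delta> s J (Suc m))"
        using * k(1,2) v_chain_R[of "Suc k"] v_chain_R[of k] by (metis Suc_leI less_imp_le)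
    qed
  qed
qed

text \<open>Right multiplication by \<open>rfl (\<beta> (Suc k))\<close> is left multiplication by a
  conjugate reflection, so \<open>covered_iff\<close> applies.\<close>

lemma covered_u:
  assumes "k < n" "Suc k \<in> J"
  shows "bruhat_covered (W0 \<Phi>) (S0 \<Delta>) (u (Suc k)) (u k) \<longleftrightarrow> fin.len (u k) = Suc (fin.len (u (Suc k)))"
proof -
  obtain M where M: "\<beta> (Suc k) \<in> \<Phi>\<^sub>+" "u (Suc k) = (if Suc k \<in> J then u k \<circ> rfl (\<beta> (Suc k)) else u k)"
    by (rule fold_data[OF assms(1)])
  let ?b = "\<beta> (Suc k)"
  have b: "?b \<in> \<Phi>" using pos_root M(1) .
  have w: "u (Suc k) \<in> W0 \<Phi>" using u_Wf[of "Suc k"] assms(1) W0_eq by simp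
  have "u (Suc k) \<circ> rfl ?b = u k \<circ> (rfl ?b \<circ> rfl ?b)" using M(2) assms(2) by (simp add: comp_assoc)
  also have "rfl ?b \<circ> rfl ?b = id" by (rule refl_aff_involution[OF root_nz[OF b]])
  finally have uk: "u k = u (Suc k) \<circ> rfl ?b" unfolding comp_id by (rule sym)
  let ?t = "conj_by (u (Suc k)) (rfl ?b)"
  have "?t \<circ> u (Suc k) = u k" unfolding uk by (rule conj_by_comp_right[OF fin.W_bij[OF w]])
  moreover obtain y s' where ys: "y \<in> W0 \<Phi>" "s' \<in> S0 \<Delta>" "rfl ?b = conj_by y s'"
    by (rule fin.reflectionE[OF rfl_reflection[OF b]])
  then have "?t = conj_by (u (Suc k) \<circ> y) s'"
    using conj_by_comp[OF fin.W_bij[OF w] fin.W_bij[OF ys(1)]] by simp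
  then have "?t \<in> fin.reflections" using fin.conj_reflection[OF fin.W_comp[OF w ys(1)] ys(2)] by simp
  ultimately show ?thesis using fin.covered_iff[OF w] by metis
qed

lemma u_in: "k < n \<Longrightarrow> Suc k \<in> J \<Longrightarrow> u (Suc k) = u k \<circ> rfl (\<beta> (Suc k))"
  by (rule fold_data[of k]) simp_all

lemma beta_Suc_pos: "k < n \<Longrightarrow> \<beta> (Suc k) \<in> \<Phi>\<^sub>+"
  using beta_pos by simp

lemma u_n_id_imp: assumes "u n = id" shows "v = v_of \<Phi> \<Delta> s J"
proof -
  have b: "bij (R n)" using Wf_bij[OF R_Wf] by simp
  have "v = v \<circ> (R n \<circ> inv (R n))" using b by (simp add: bij_is_surj surj_iff[THEN iffD1])
  also have "\<dots> = u n \<circ> inv (R n)" unfolding u_R[OF le_refl] by (simp add: comp_assoc)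
  finally show ?thesis using assms v_of_R by simp
qed

lemma weight_0_imp_id: assumes "w \<in> Wf" "L w = 0" shows "w = id"
proof -
  have "invset w = {}"
    using assms(2) sum_wt_eq[of "{}" "invset w"] invset_pos unfolding weight_Wf[OF assms(1)] by simp
  then have "Nrefl w = {}" using Nrefl_Wf[OF assms(1)] by simp
  then show ?thesis using fin.N_empty[of w] assms(1) W0_eq by simp
qed

lemma sum_J_upto_Suc:
  fixes h :: "nat \<Rightarrow> nat"
  shows "(\<Sum>j\<in>J \<inter> {1..Suc k}. h j) = (\<Sum>j\<in>J \<inter> {1..k}. h j) + (if Suc k \<in> J then h (Suc k) else 0)"
proof (cases "Suc k \<in> J")
  case True
  then have "J \<inter> {1..Suc k} = insert (Suc k) (J \<inter> {1..k})" by auto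
  then show ?thesis using True by simp
next
  case False
  then have "J \<inter> {1..Suc k} = J \<inter> {1..k}" by (auto simp: le_Suc_eq)
  then show ?thesis using False by simp
qed

subsection \<open>From admissible subsets to positive foldings\<close>

lemma admissible_imp_I_max:
  assumes vJ: "v = v_of \<Phi> \<Delta> s J" and adm: "admissible \<Phi> \<Delta> s J"
    and dom: "dominant_subset \<Phi> \<Delta> s n a lam J" and mx: "maximal_subset \<Phi> \<Delta> L s J"
  shows "J \<in> I_max \<Phi> \<Delta> L s n a lam v"
proof -
  have u_inv: "u k = inv (R n) \<circ> R k" if "k \<le> n" for k using u_R[OF that] vJ v_of_R by simp
  have un: "u n = id" unfolding u_inv[OF le_refl] using Wf_bij[OF R_Wf[OF le_refl]] by (simp add: bij_is_inj)
  have chamber: "A (Suc k) \<in> chamber \<Phi> \<Delta>" if "k < n" for k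
    using dom dominant_iff that unfolding dominant_subset_def vJ[symmetric] by simp
  have len: "fin.len (u k) = Suc (fin.len (u (Suc k)))" if k: "k < n" "Suc k \<in> J" for k
    using adm covered_u[OF k] k u_inv[of k] u_inv[of "Suc k"] unfolding admissible_iff by simp
  \<comment> \<open>Were this root positive, \<open>u (Suc k)\<close> would send
    \<open>\<beta> (Suc k)\<close> to a negative root, and by \<open>weight_drop\<close> the fold
    would have increased the length.\<close>
  have neg: "u k (\<beta> (Suc k)) \<notin> \<Phi>\<^sub>+" if k: "k < n" "Suc k \<in> J" for k
  proof
    assume p: "u k (\<beta> (Suc k)) \<in> \<Phi>\<^sub>+"
    let ?b = "\<beta> (Suc k)"
    have b: "?b \<in> \<Phi>\<^sub>+" "?b \<noteq> 0" using beta_Suc_pos[OF k(1)] pos_nz by blast+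
    have uk: "u k \<in> Wf" "u (Suc k) \<in> Wf" using u_Wf k(1) by simp_all
    have "u (Suc k) ?b = - u k ?b"
      unfolding u_in[OF k] using refl_self[OF b(2)] linear_neg[OF Wf_linear[OF uk(1)]] by simp
    then have "u (Suc k) ?b \<notin> \<Phi>\<^sub>+" using pos_not_neg[OF p] by simp
    from weight_drop(3)[OF uk(2) b(1) this]
    have "fin.len (u (Suc k) \<circ> rfl ?b) < fin.len (u (Suc k))" .
    moreover have "u (Suc k) \<circ> rfl ?b = u k"
      unfolding u_in[OF k] comp_assoc refl_aff_involution[OF b(2)] by simp
    ultimately show False using len[OF k] by simp
  qed
  \<comment> \<open>Each cover has length gap one, which is the equality case of
    \<open>weight_drop\<close>; these drops telescope from \<open>L v\<close> down to the weight of
    the identity.\<close>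
  have drop: "L (u (Suc k)) + wt (\<beta> (Suc k)) = L (u k)" if k: "k < n" "Suc k \<in> J" for k
    using weight_drop(2)[OF u_Wf beta_Suc_pos[OF k(1)] neg[OF k]] len[OF k] k unfolding u_in[OF k] by simp
  have tele: "L (u k) + (\<Sum>j\<in>J \<inter> {1..k}. wt (\<beta> j)) = L v" if "k \<le> n" for k
    using that
  proof (induction k)
    case 0
    then show ?case by (simp add: u_0)
  next
    case (Suc k)
    then have k: "k < n" "L (u k) + (\<Sum>j\<in>J \<inter> {1..k}. wt (\<beta> j)) = L v" by simp_all
    show ?case
    proof (cases "Suc k \<in> J")
      case True
      then show ?thesis using k(2) drop[OF k(1) True] sum_J_upto_Suc[of "\<lambda>j. wt (\<beta> j)" k] by simp
    next
      case False
      have "u (Suc k) = u k" by (rule fold_data[OF k(1)]) (use False in simp)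
      then show ?thesis using k(2) False sum_J_upto_Suc[of "\<lambda>j. wt (\<beta> j)" k] by simp
    qed
  qed
  have "J \<inter> {1..n} = J" using J by blast
  then have "(\<Sum>j\<in>J. wt (\<beta> j)) = L v" using tele[OF le_refl] weight_id unfolding un by simp
  moreover have "L (s j) = wt (\<beta> j)" if "j \<in> J" for j
    using mx L_root_Lh[OF beta_pos] that J unfolding maximal_subset_def by fastforce
  ultimately have "(\<Sum>j\<in>J. L (s j)) = L v" by simp
  moreover have "fold_positive k" if k: "k < n" "Suc k \<in> J" for k
  proof -
    let ?b = "\<beta> (Suc k)"
    obtain M where M: "u k ?b \<in> \<Phi>" "fold_refl k = refl_aff (u k ?b) M" "pairing (A k) (u k ?b) < of_int M"
      by (rule fold_data[OF k(1)])
    define d where "d = - u k ?b"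
    have d: "d \<in> \<Phi>\<^sub>+" "d \<in> \<Phi>" unfolding d_def using neg[OF k] not_pos_iff[OF M(1)] minus_root[OF M(1)] by blast+
    have r: "fold_refl k = refl_aff d (- M)" unfolding M(2) d_def refl_aff_minus ..
    have Ad: "pairing (A k) d > of_int (- M)" using M(3) by (simp add: d_def pairing_minus_right)
    have adj: "Sep (A k) (refl_aff d (- M) (A k)) = {refl_aff d (- M)}"
      using fold_refl_Sep[OF k(1)] fold_refl_A[OF k(1)] unfolding r by simp
    have near: "pairing (A k) d < of_int (- M) + 1"
      by (rule adjacent_near[OF regular_A d(2) Ad adj]) (use k(1) in simp)
    \<comment> \<open>Dominance is known only for the alcoves after steps 1 to \<open>n\<close>. A
      fold does not move the alcove, so \<open>A k\<close> equals \<open>A (Suc k)\<close> and the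
      initial alcove is covered as well.\<close>
    have "pairing (A k) d > 0"
      using chamber[OF k(1)] d(1) unfolding A_in[OF k(2)] chamber_def by blast
    \<comment> \<open>\<open>A k\<close> is positive on \<open>d\<close> but less than one unit
      above the hyperplane, so the label is at least 0 and the opposite alcove lies below.\<close>
    then have "- M \<ge> 0" using near by linarith
    then have "(of_int (- M) :: real) \<ge> 0" by (simp only: of_int_0_le_iff)
    then have "pairing c1 d < of_int (- M)" using c1_bounds[OF d(1)] by linarith
    then show ?thesis
      unfolding fold_positive_def r mem_Sep[OF d(2)] using Ad by (intro mult_neg_pos) auto
  qed
  ultimately show ?thesis unfolding I_max_iff by blast
qed

subsection \<open>From positive foldings to admissible subsets\<close>

lemma I_max_imp_admissible:
  assumes I: "J \<in> I_max \<Phi> \<Delta> L s n a lam v"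
  shows "v = v_of \<Phi> \<Delta> s J" and "admissible \<Phi> \<Delta> s J"
    and "dominant_subset \<Phi> \<Delta> s n a lam J" and "maximal_subset \<Phi> \<Delta> L s J"
proof -
  have fp: "fold_positive k" if "k < n" "Suc k \<in> J" for k using I that unfolding I_max_iff by blast
  have total: "(\<Sum>j\<in>J. L (s j)) = L v" using I unfolding I_max_iff by blast
  define cost where "cost k = (\<Sum>j\<in>J \<inter> {1..k}. L (s j))" for k
  have cost_Suc: "cost (Suc k) = cost k + (if Suc k \<in> J then L (s (Suc k)) else 0)" for k
    unfolding cost_def by (rule sum_J_upto_Suc)
  have "J \<inter> {1..n} = J" using J by blast
  then have cost_n: "cost n = L v" using total by (simp add: cost_def)
  have step: "cost (Suc k) + pot (Suc k) \<le> cost k + pot k" if k: "k < n" for k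
  proof (cases "Suc k \<in> J")
    case True
    then show ?thesis using pot_in[OF k True fp[OF k True]] L_letter[OF k] cost_Suc[of k] by simp
  next
    case False
    then show ?thesis using pot_out[OF k False] cost_Suc[of k] by simp
  qed
  have upper: "cost k + pot k \<le> L v" if "k \<le> n" for k
    using that
  proof (induction k)
    case 0
    then show ?case using pot_0 by (simp add: cost_def)
  next
    case (Suc k)
    then show ?case using step[of k] by simp
  qed
  \<comment> \<open>Read backwards from step \<open>n\<close>, where the cost alone is
    \<open>L v\<close>. Together with \<open>upper\<close> this makes each inequality in
    \<open>step\<close> an equality.\<close>
  have lower: "cost k + pot k \<ge> L v" if "k \<le> n" for k
    using that
  proof (induction rule: inc_induct)
    case base
    then show ?case using cost_n by simp
  next
    case (step k)
    then show ?case using \<open>\<And>k. k < n \<Longrightarrow> cost (Suc k) + pot (Suc k) \<le> cost k + pot k\<close>[of k] by simp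
  qed
  have const: "cost k + pot k = L v" if "k \<le> n" for k using upper[OF that] lower[OF that] by simp
  define good where "good k \<longleftrightarrow> (\<forall>c\<in>\<Phi>\<^sub>+. pairing (A k) c > 0) \<and> pot k = L (u k)" for k
  have good_0: "good 0"
  proof -
    have p0: "pot 0 = L v" using const[of 0] by (simp add: cost_def)
    have b: "pdir (A 0) (E 0) \<subseteq> invset (u 0)" "\<And>c. c \<in> pdir (A 0) (E 0) \<Longrightarrow> pairing (A 0) c > 0"
      using pdir_bound[OF _ A_0_bound] by simp_all
    \<comment> \<open>Equal weights mean that every inversion of \<open>v\<close> occurs as a
      direction, where \<open>pdir_bound\<close> gives a positive pairing. For the other roots
      positivity follows from dominance of \<open>lam\<close>.\<close>
    have eq: "pdir (A 0) (E 0) = invset (u 0)"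
      by (rule sum_wt_eq[OF b(1) invset_pos])
        (use p0 weight_Wf[OF u_Wf[of 0]] u_0 in \<open>simp add: potential_def\<close>)
    have "pairing (A 0) c > 0" if c: "c \<in> \<Phi>\<^sub>+" for c
    proof (cases "c \<in> invset (u 0)")
      case False
      then have "inv v c \<in> \<Phi>\<^sub>+" using c unfolding invset_def u_0 by blast
      then show ?thesis using A_0_pairing[of c] lam_dominant[OF c] c0_bounds[of "inv v c"] by simp
    qed (use b(2) eq in blast)
    then show ?thesis unfolding good_def using p0 u_0 by simp
  qed
  have fold_step: "good (Suc k) \<and> L (s (Suc k)) = wt (\<beta> (Suc k)) \<and> fin.len (u k) = Suc (fin.len (u (Suc k)))"
    if k: "k < n" "Suc k \<in> J" and good: "good k" for k
  proof -
    let ?b = "\<beta> (Suc k)"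
    have A: "pairing (A k) c > 0" if "c \<in> \<Phi>\<^sub>+" for c using good that unfolding good_def by blast
    have A': "pairing (A (Suc k)) c > 0" if "c \<in> \<Phi>\<^sub>+" for c using A[OF that] A_in[OF k(2)] by simp
    have uk: "u k \<in> Wf" using u_Wf k(1) by simp
    have eqs: "L (s (Suc k)) = wt ?b" "pot (Suc k) + wt ?b = pot k"
      using const[of k] const[of "Suc k"] cost_Suc[of k] k pot_in[OF k fp[OF k]] L_letter[OF k(1)] by simp_all
    obtain M where M: "u k ?b \<in> \<Phi>" "fold_refl k = refl_aff (u k ?b) M" "pairing (A k) (u k ?b) < of_int M"
      by (rule fold_data[OF k(1)])
    \<comment> \<open>For a positive root the label \<open>M\<close> would be below the negative
      pairing of \<open>c1\<close> and above the positive pairing of \<open>A k\<close>.\<close>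
    have "u k ?b \<notin> \<Phi>\<^sub>+"
    proof
      assume p: "u k ?b \<in> \<Phi>\<^sub>+"
      have "(pairing c1 (u k ?b) - of_int M) * (pairing (A k) (u k ?b) - of_int M) < 0"
        using fp[OF k] mem_Sep[OF M(1)] unfolding fold_positive_def M(2) by blast
      then have "pairing c1 (u k ?b) > of_int M" using M(3) by (auto simp: mult_less_0_iff)
      then show False using c1_bounds[OF p] A[OF p] M(3) by linarith
    qed
    note dropk = weight_drop[OF uk beta_Suc_pos[OF k(1)] this, folded u_in[OF k]]
    have "pot (Suc k) \<le> L (u (Suc k))"
      using pot_bound[of "Suc k"] A' k(1) by (meson Suc_leI less_trans neg_less_0_iff_less zero_less_one)
    moreover have "pot k = L (u k)" using good good_def by blast
    ultimately have eq: "pot (Suc k) = L (u (Suc k))" "L (u (Suc k)) + wt ?b = L (u k)"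
      using dropk(1) eqs(2) by linarith+
    have "good (Suc k)" unfolding good_def using A' eq(1) by blast
    then show ?thesis using eqs(1) dropk(2) eq(2) by blast
  qed
  \<comment> \<open>Leaving the chamber through \<open>hyp c 0\<close> would lose the direction
    \<open>c\<close>: before the step this hyperplane separates \<open>A k\<close> from both
    \<open>c1\<close> and \<open>E k\<close>, afterwards the new alcove lies in the same strip
    between -1 and 0 as \<open>c1\<close>. Constancy of the potential forbids the loss.\<close>
  have cross_step: "good (Suc k)" if k: "k < n" "Suc k \<notin> J" and good: "good k" for k
  proof -
    have A: "pairing (A k) c > 0" if "c \<in> \<Phi>\<^sub>+" for c using good that unfolding good_def by blast
    have pe: "pot (Suc k) = pot k" using const[of k] const[of "Suc k"] cost_Suc[of k] k by simp
    have dir: "pdir (A (Suc k)) (E (Suc k)) = pdir (A k) (E k)"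
      by (rule sum_wt_eq[OF pdir_out[OF k] pdir_pos pe[unfolded potential_def]])
    have ue: "u (Suc k) = u k" by (rule fold_data[OF k(1)]) (use k(2) in simp)
    have "pairing (A (Suc k)) c > 0" if c: "c \<in> \<Phi>\<^sub>+" for c
    proof (rule ccontr)
      assume "\<not> ?thesis"
      moreover have cr: "c \<in> \<Phi>" using pos_root c .
      moreover have rA: "regular (A (Suc k))" using regular_A k(1) by simp
      ultimately have neg: "pairing (A (Suc k)) c < 0"
        unfolding regular_def by (metis linorder_neqE_linordered_idom of_int_0)
      have S: "Sep (A k) (A (Suc k)) = {fold_refl k}" by (rule A_out_Sep[OF k])
      have mid: "refl_aff c 0 \<in> Sep (A k) (A (Suc k))"
        unfolding mem_Sep[OF cr] using A[OF c] neg by (simp add: mult_pos_neg)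
      then have fr: "fold_refl k = refl_aff c 0" using S by simp
      have near: "pairing (A (Suc k)) c > -1"
      proof (rule ccontr)
        assume "\<not> ?thesis"
        then have "pairing (A (Suc k)) c < of_int (-1)"
          using rA cr unfolding regular_def by (metis linorder_neqE_linordered_idom of_int_1 of_int_minus)
        then have "refl_aff c (-1) \<in> Sep (A k) (A (Suc k))"
          unfolding mem_Sep[OF cr] using A[OF c] by (intro mult_pos_neg) auto
        then show False using S fr refl_aff_inject_int[OF pos_nz[OF c]] by fastforce
      qed
      have "refl_aff c 0 \<in> Sep (A k) (E k)" using fold_refl_AE[OF k(1)] fr by simp
      moreover have "refl_aff c 0 \<in> Sep (A k) c1"
        unfolding mem_Sep[OF cr] using A[OF c] c1_bounds[OF c] by (simp add: mult_pos_neg)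
      ultimately have "c \<in> pdir (A k) (E k)" unfolding pdir_def bdir_def using c cr by blast
      then have "c \<in> pdir (A (Suc k)) (E (Suc k))" using dir by simp
      then obtain m where "refl_aff c m \<in> Sep (A (Suc k)) c1" unfolding pdir_def bdir_def by blast
      then have "(pairing (A (Suc k)) c - of_int m) * (pairing c1 c - of_int m) < 0" using mem_Sep[OF cr] by blast
      moreover have "(pairing (A (Suc k)) c - of_int m) * (pairing c1 c - of_int m) > 0"
        using same_int_interval[of "-1" "pairing (A (Suc k)) c" "pairing c1 c" m] near neg c1_bounds[OF c] by simp
      ultimately show False by linarith
    qed
    then show ?thesis unfolding good_def using pe ue good good_def by simp
  qed
  have good: "good k" if "k \<le> n" for k
    using that
  proof (induction k)
    case (Suc k)
    then show ?case using fold_step[of k] cross_step[of k] by (cases "Suc k \<in> J") auto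
  qed (rule good_0)
  \<comment> \<open>The cost has reached \<open>L v\<close>, so nothing remains of the potential,
    and \<open>L (u n) = 0\<close> forces the identity.\<close>
  have "pot n = 0" using const[of n] cost_n by simp
  then have "L (u n) = 0" using good[of n] unfolding good_def by simp
  then have "u n = id" using weight_0_imp_id[OF u_Wf] by simp
  then show vJ: "v = v_of \<Phi> \<Delta> s J" by (rule u_n_id_imp)
  have u_inv: "u k = inv (R n) \<circ> R k" if "k \<le> n" for k using u_R[OF that] vJ v_of_R by simp
  show "admissible \<Phi> \<Delta> s J"
    unfolding admissible_iff
  proof (intro allI impI)
    fix k assume k: "k < n" "Suc k \<in> J"
    have "bruhat_covered (W0 \<Phi>) (S0 \<Delta>) (u (Suc k)) (u k)"
      using covered_u[OF k] fold_step[OF k good] k(1) by simp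
    then show "bruhat_covered (W0 \<Phi>) (S0 \<Delta>) (inv (R n) \<circ> R (Suc k)) (inv (R n) \<circ> R k)"
      using u_inv[of k] u_inv[of "Suc k"] k(1) by simp
  qed
  show "dominant_subset \<Phi> \<Delta> s n a lam J"
    unfolding dominant_subset_def vJ[symmetric] dominant_iff using good unfolding good_def chamber_def by simp
  show "maximal_subset \<Phi> \<Delta> L s J"
    unfolding maximal_subset_def
  proof
    fix j assume j: "j \<in> J"
    then obtain k where k: "j = Suc k" "k < n" using J by (cases j) auto
    then show "L (s j) = L_root \<Phi> \<Delta> L (\<beta> j)"
      using fold_step[of k] good[of k] j L_root_Lh[OF beta_Suc_pos[OF k(2)]] by simp
  qed
qed

end

theorem theorem5p5:
  fixes \<Phi> \<Delta> :: "'a::euclidean_space set"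
    and L :: "('a \<Rightarrow> 'a) \<Rightarrow> nat"
    and \<tau> lam :: 'a
    and s :: "nat \<Rightarrow> 'a \<Rightarrow> 'a" and n :: nat and a v :: "'a \<Rightarrow> 'a"
    and J :: "nat set"
  assumes "irreducible_root_system \<Phi>"
    and "simple_roots \<Phi> \<Delta>"
    and "pos_weight_function \<Phi> \<Delta> L"
    and "0 \<in> L_weights \<Phi> \<Delta> L"
    and "\<tau> \<in> dominant_weights \<Phi> \<Delta> L"
    and "reduced_expr \<Phi> \<Delta> L (transl \<tau>) s n a"
    and "lam \<in> dominant_weights \<Phi> \<Delta> L"
    and "v \<in> W0 \<Phi>"
    and "J \<subseteq> {1..n}"
  shows "(admissible \<Phi> \<Delta> s J \<and> dominant_subset \<Phi> \<Delta> s n a lam J \<and> maximal_subset \<Phi> \<Delta> L s J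
           \<longrightarrow> J \<in> I_max \<Phi> \<Delta> L s n a lam (v_of \<Phi> \<Delta> s J)) \<and>
         (J \<in> I_max \<Phi> \<Delta> L s n a lam v
           \<longrightarrow> v = v_of \<Phi> \<Delta> s J \<and>
               admissible \<Phi> \<Delta> s J \<and> dominant_subset \<Phi> \<Delta> s n a lam J \<and> maximal_subset \<Phi> \<Delta> L s J)"
proof -
  have "root_system \<Phi>" using assms(1) unfolding irreducible_root_system_def by blast
  then interpret reduced_translation \<Phi> \<Delta> L \<tau> s n a
    using assms by unfold_locales
  have path: "folded_path \<Phi> \<Delta> L \<tau> s n a lam w J" if "w \<in> Wf" for w
    using that assms by unfold_locales
  have "J \<in> I_max \<Phi> \<Delta> L s n a lam (v_of \<Phi> \<Delta> s J)"
    if adm: "admissible \<Phi> \<Delta> s J" "dominant_subset \<Phi> \<Delta> s n a lam J" "maximal_subset \<Phi> \<Delta> L s J"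
  proof -
    \<comment> \<open>A provisional start at \<open>id\<close> gives access to the products
      \<open>R\<close>, which do not depend on the starting element; they show that
      \<open>v_of\<close> lies in the Weyl group and may serve as the actual start.\<close>
    interpret id_path: folded_path \<Phi> \<Delta> L \<tau> s n a lam id J by (rule path[OF id_Wf])
    have "v_of \<Phi> \<Delta> s J \<in> Wf" unfolding id_path.v_of_R by (rule Wf_inv[OF id_path.R_Wf[OF le_refl]])
    then interpret folded_path \<Phi> \<Delta> L \<tau> s n a lam "v_of \<Phi> \<Delta> s J" J by (rule path)
    show ?thesis using admissible_imp_I_max adm by blast
  qed
  moreover have "v = v_of \<Phi> \<Delta> s J \<and> admissible \<Phi> \<Delta> s J \<and> dominant_subset \<Phi> \<Delta> s n a lam J \<and>
      maximal_subset \<Phi> \<Delta> L s J" if I: "J \<in> I_max \<Phi> \<Delta> L s n a lam v"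
  proof -
    interpret folded_path \<Phi> \<Delta> L \<tau> s n a lam v J using path assms(8) W0_eq by blast
    show ?thesis using I_max_imp_admissible[OF I] by blast
  qed
  ultimately show ?thesis by blast
qed

end
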